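(* Let $F:(\mathcal L,S)\to(\mathcal K,T)$ be an adjunction of 2-monads and suppose that the 2-category $T\text{-Alg}_s$ has all codescent objects. Then the left adjoint $(-)^{\dagger}_F$ to the 2-functor $J_F:T\text{-Alg}_s\to S\text{-Alg}_l$ exists and is given on objects by the formula $$X^{\dagger}_F=\mathrm{CoDesc}(\mathcal R_FX),$$ the codescent object of $\mathcal R_FX$ being taken in $T\text{-Alg}_s$.
   Context: **2-monads and algebras.** For a 2-monad $T$ on a 2-category $\mathcal K$ with unit $\eta^T$ and multiplication $\mu^T$, a strict $T$-algebra is $(A,a)$ with $a:TA\to A$, $a\eta^T_A=1_A$, $aT(a)=a\mu^T_A$. A lax morphism $(A,a)\to(B,b)$ is $(f,\overline f)$ with $f:A\to B$ and a 2-cell $\overline f:bT(f)\to fa$ such that $\overline f\eta^T_A=1_f$ and $\overline f\mu^T_A=(\overline fT(a))(bT(\overline f))$; it is strict if $\overline f$ is an identity. A 2-cell $(f,\overline f)\to(g,\overline g)$ is a 2-cell $\phi:f\to g$ with $\overline g(bT(\phi))=(\phi a)\overline f$. $T\text{-Alg}_s$ (resp. $T\text{-Alg}_l$) is the 2-category of strict $T$-algebras, strict (resp. lax) morphisms, and these 2-cells. **Adjunction of 2-monads.** An adjunction of 2-monads $F:(\mathcal L,S)\to(\mathcal K,T)$, where $S$ is a 2-monad on $\mathcal L$ and $T$ a 2-monad on $\mathcal K$, consists of a 2-functor $F_!:\mathcal L\to\mathcal K$ with a right 2-adjoint $F^*$ and a 2-natural transformation $F^c:F_!S\to TF_!$ with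 $F^c(F_!\eta^S)=\eta^TF_!$ and $F^c(F_!\mu^S)=(\mu^TF_!)(TF^c)(F^cS)$. Let $F^l:SF^*\to F^*T$ be the mate of $F^c$ under $F_!\dashv F^*$. The 2-functor $\overline F:T\text{-Alg}_l\to S\text{-Alg}_l$ sends $(A,a)$ to $(F^*A,F^*(a)F^l_A)$, a lax morphism $(f,\overline f)$ out of $(A,a)$ to $(F^*f,F^*(\overline f)F^l_A)$, and a 2-cell $\phi$ to $F^*\phi$; it restricts to strict morphisms. $J_F:T\text{-Alg}_s\to S\text{-Alg}_l$ is the inclusion $T\text{-Alg}_s\to T\text{-Alg}_l$ followed by $\overline F$. **The simplicial object $\mathcal R_FX$.** For a strict $S$-algebra $(X,x)$, $\mathcal R_FX:\Delta^{\mathrm{op}}\to T\text{-Alg}_s$ is the simplicial object with $(\mathcal R_FX)_n=TF_!S^nX$ (free $T$-algebras), face maps $d_i:TF_!S^{n+1}X\to TF_!S^nX$ given by $d_0=TF_!S^nx$, $d_i=TF_!S^{n-i}\mu^S_{S^{i-1}X}$ for $1\le i\le n$, $d_{n+1}=\mu^T_{F_!S^nX}T(F^c_{S^nX})$, and degeneracies $s_i=TF_!S^{n-i}\eta^S_{S^iX}:TF_!S^nX\to TF_!S^{n+1}X$. Equivalently, it is the simplicial object representing $Y\mapsto S\text{-Alg}_s(\mathcal R_SX,\overline FY)$, where $\mathcal R_SX$ is the bar construction, $(\mathcal R_SX)_n=S^{n+1}X$. **Codescent objects.** Let $X$ be a simplicial object in a 2-category. A cocone for $X$ with vertex $Z$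 is $(f_0,f_1)$ with $f_0:X_0\to Z$ and $f_1:f_0d_1\to f_0d_0$ a 2-cell such that $f_1s_0=1_{f_0}$ and $(f_1d_0)(f_1d_2)=f_1d_1$. A codescent object $\mathrm{CoDesc}(X)$ is an object with a cocone $(q_0,q_1)$ such that (1) for each cocone $(f_0,f_1)$ with vertex $Z$ there is a unique $f':\mathrm{CoDesc}(X)\to Z$ with $f'q_0=f_0$, $f'q_1=f_1$; (2) for cocones $(f_0,f_1),(g_0,g_1)$ with vertex $Z$ and a 2-cell $\phi:f_0\to g_0$ with $(\phi d_0)f_1=g_1(\phi d_1)$ there is a unique $\phi':f'\to g'$ with $\phi'q_0=\phi$. *)

theory Defs
  imports Main
begin

section \<open>Strict 2-categories\<close>

text \<open>
  A (strict) 2-category is given by carrier sets of objects, 1-cells and 2-cells.  Every 1-cell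
  determines its domain and codomain, and every 2-cell its source and target 1-cell.
  Composites are written in functional order; the values of the operations outside the
  carriers (or on non-composable cells) are irrelevant.
\<close>

record ('o, 'm, 'c) twocat =
  Obj :: "'o set"
  Arr :: "'m set"
  Cell :: "'c set"
  Dom :: "'m \<Rightarrow> 'o"
  Cod :: "'m \<Rightarrow> 'o"
  Src :: "'c \<Rightarrow> 'm"
  Tgt :: "'c \<Rightarrow> 'm"
  Ide :: "'o \<Rightarrow> 'm"
  Idc :: "'m \<Rightarrow> 'c"
  comp :: "'m \<Rightarrow> 'm \<Rightarrow> 'm" (infixl "\<cdot>\<index>" 75)
  hcomp :: "'c \<Rightarrow> 'c \<Rightarrow> 'c" (infixl "\<star>\<index>" 70)
  vcomp :: "'c \<Rightarrow> 'c \<Rightarrow> 'c" (infixl "\<bullet>\<index>" 65)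

definition Hom :: "('o, 'm, 'c) twocat \<Rightarrow> 'o \<Rightarrow> 'o \<Rightarrow> 'm set" where
  "Hom C A B = {f \<in> Arr C. Dom C f = A \<and> Cod C f = B}"

definition Hom2 :: "('o, 'm, 'c) twocat \<Rightarrow> 'm \<Rightarrow> 'm \<Rightarrow> 'c set" where
  "Hom2 C f g = {\<alpha> \<in> Cell C. Src C \<alpha> = f \<and> Tgt C \<alpha> = g}"

abbreviation lwhisker :: "('o, 'm, 'c) twocat \<Rightarrow> 'm \<Rightarrow> 'c \<Rightarrow> 'c" (infixl "\<lhd>\<index>" 70) where
  "f \<lhd>\<^bsub>C\<^esub> \<alpha> \<equiv> Idc C f \<star>\<^bsub>C\<^esub> \<alpha>"

abbreviation rwhisker :: "('o, 'm, 'c) twocat \<Rightarrow> 'c \<Rightarrow> 'm \<Rightarrow> 'c" (infixl "\<rhd>\<index>" 70) where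
  "\<alpha> \<rhd>\<^bsub>C\<^esub> f \<equiv> \<alpha> \<star>\<^bsub>C\<^esub> Idc C f"

locale two_category =
  fixes C :: "('o, 'm, 'c) twocat"
  assumes Dom_Obj: "f \<in> Arr C \<Longrightarrow> Dom C f \<in> Obj C"
    and Cod_Obj: "f \<in> Arr C \<Longrightarrow> Cod C f \<in> Obj C"
    and Src_Arr: "\<alpha> \<in> Cell C \<Longrightarrow> Src C \<alpha> \<in> Arr C"
    and Tgt_Arr: "\<alpha> \<in> Cell C \<Longrightarrow> Tgt C \<alpha> \<in> Arr C"
    and parallel_Dom: "\<alpha> \<in> Cell C \<Longrightarrow> Dom C (Src C \<alpha>) = Dom C (Tgt C \<alpha>)"
    and parallel_Cod: "\<alpha> \<in> Cell C \<Longrightarrow> Cod C (Src C \<alpha>) = Cod C (Tgt C \<alpha>)"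
    and Ide_Hom: "A \<in> Obj C \<Longrightarrow> Ide C A \<in> Hom C A A"
    and comp_Hom: "\<lbrakk>f \<in> Hom C A B; g \<in> Hom C B D\<rbrakk> \<Longrightarrow> g \<cdot>\<^bsub>C\<^esub> f \<in> Hom C A D"
    and comp_Ide_left: "f \<in> Hom C A B \<Longrightarrow> Ide C B \<cdot>\<^bsub>C\<^esub> f = f"
    and comp_Ide_right: "f \<in> Hom C A B \<Longrightarrow> f \<cdot>\<^bsub>C\<^esub> Ide C A = f"
    and comp_assoc: "\<lbrakk>f \<in> Hom C A B; g \<in> Hom C B D; h \<in> Hom C D E\<rbrakk>
      \<Longrightarrow> (h \<cdot>\<^bsub>C\<^esub> g) \<cdot>\<^bsub>C\<^esub> f = h \<cdot>\<^bsub>C\<^esub> (g \<cdot>\<^bsub>C\<^esub> f)"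
    and Idc_Hom2: "f \<in> Arr C \<Longrightarrow> Idc C f \<in> Hom2 C f f"
    and vcomp_Hom2: "\<lbrakk>\<alpha> \<in> Hom2 C f g; \<beta> \<in> Hom2 C g h\<rbrakk> \<Longrightarrow> \<beta> \<bullet>\<^bsub>C\<^esub> \<alpha> \<in> Hom2 C f h"
    and vcomp_Idc_left: "\<alpha> \<in> Hom2 C f g \<Longrightarrow> Idc C g \<bullet>\<^bsub>C\<^esub> \<alpha> = \<alpha>"
    and vcomp_Idc_right: "\<alpha> \<in> Hom2 C f g \<Longrightarrow> \<alpha> \<bullet>\<^bsub>C\<^esub> Idc C f = \<alpha>"
    and vcomp_assoc: "\<lbrakk>\<alpha> \<in> Hom2 C f g; \<beta> \<in> Hom2 C g h; \<gamma> \<in> Hom2 C h k\<rbrakk>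
      \<Longrightarrow> (\<gamma> \<bullet>\<^bsub>C\<^esub> \<beta>) \<bullet>\<^bsub>C\<^esub> \<alpha> = \<gamma> \<bullet>\<^bsub>C\<^esub> (\<beta> \<bullet>\<^bsub>C\<^esub> \<alpha>)"
    and hcomp_Hom2: "\<lbrakk>f \<in> Hom C A B; g \<in> Hom C B D; \<alpha> \<in> Hom2 C f f'; \<beta> \<in> Hom2 C g g'\<rbrakk>
      \<Longrightarrow> \<beta> \<star>\<^bsub>C\<^esub> \<alpha> \<in> Hom2 C (g \<cdot>\<^bsub>C\<^esub> f) (g' \<cdot>\<^bsub>C\<^esub> f')"
    and hcomp_Ide_left: "\<lbrakk>f \<in> Hom C A B; \<alpha> \<in> Hom2 C f f'\<rbrakk> \<Longrightarrow> Ide C B \<lhd>\<^bsub>C\<^esub> \<alpha> = \<alpha>"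
    and hcomp_Ide_right: "\<lbrakk>f \<in> Hom C A B; \<alpha> \<in> Hom2 C f f'\<rbrakk> \<Longrightarrow> \<alpha> \<rhd>\<^bsub>C\<^esub> Ide C A = \<alpha>"
    and hcomp_assoc: "\<lbrakk>f \<in> Hom C A B; g \<in> Hom C B D; h \<in> Hom C D E;
        \<alpha> \<in> Hom2 C f f'; \<beta> \<in> Hom2 C g g'; \<gamma> \<in> Hom2 C h h'\<rbrakk>
      \<Longrightarrow> (\<gamma> \<star>\<^bsub>C\<^esub> \<beta>) \<star>\<^bsub>C\<^esub> \<alpha> = \<gamma> \<star>\<^bsub>C\<^esub> (\<beta> \<star>\<^bsub>C\<^esub> \<alpha>)"
    and hcomp_Idc: "\<lbrakk>f \<in> Hom C A B; g \<in> Hom C B D\<rbrakk>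
      \<Longrightarrow> Idc C g \<star>\<^bsub>C\<^esub> Idc C f = Idc C (g \<cdot>\<^bsub>C\<^esub> f)"
    and interchange: "\<lbrakk>f \<in> Hom C A B; g \<in> Hom C B D;
        \<alpha> \<in> Hom2 C f f'; \<alpha>' \<in> Hom2 C f' f''; \<beta> \<in> Hom2 C g g'; \<beta>' \<in> Hom2 C g' g''\<rbrakk>
      \<Longrightarrow> (\<beta>' \<bullet>\<^bsub>C\<^esub> \<beta>) \<star>\<^bsub>C\<^esub> (\<alpha>' \<bullet>\<^bsub>C\<^esub> \<alpha>) = (\<beta>' \<star>\<^bsub>C\<^esub> \<alpha>') \<bullet>\<^bsub>C\<^esub> (\<beta> \<star>\<^bsub>C\<^esub> \<alpha>)"


section \<open>2-functors, 2-natural transformations, 2-adjunctions\<close>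

record ('o, 'm, 'c, 'p, 'n, 'd) twofun =
  on_Obj :: "'o \<Rightarrow> 'p"
  on_Arr :: "'m \<Rightarrow> 'n"
  on_Cell :: "'c \<Rightarrow> 'd"

definition id2 :: "('o, 'm, 'c, 'o, 'm, 'c) twofun" where
  "id2 = \<lparr>on_Obj = \<lambda>A. A, on_Arr = \<lambda>f. f, on_Cell = \<lambda>\<alpha>. \<alpha>\<rparr>"

definition comp2 :: "('p, 'n, 'd, 'q, 'k, 'e) twofun \<Rightarrow> ('o, 'm, 'c, 'p, 'n, 'd) twofun
    \<Rightarrow> ('o, 'm, 'c, 'q, 'k, 'e) twofun" (infixl "\<otimes>" 75) where
  "G \<otimes> F = \<lparr>on_Obj = \<lambda>A. on_Obj G (on_Obj F A),
            on_Arr = \<lambda>f. on_Arr G (on_Arr F f),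
            on_Cell = \<lambda>\<alpha>. on_Cell G (on_Cell F \<alpha>)\<rparr>"

primrec pow2 :: "('o, 'm, 'c, 'o, 'm, 'c) twofun \<Rightarrow> nat \<Rightarrow> ('o, 'm, 'c, 'o, 'm, 'c) twofun" where
  "pow2 F 0 = id2"
| "pow2 F (Suc n) = F \<otimes> pow2 F n"

locale two_functor = C: two_category C + D: two_category D
  for C :: "('o, 'm, 'c) twocat" and D :: "('p, 'n, 'd) twocat" +
  fixes F :: "('o, 'm, 'c, 'p, 'n, 'd) twofun"
  assumes F_Obj: "A \<in> Obj C \<Longrightarrow> on_Obj F A \<in> Obj D"
    and F_Hom: "f \<in> Hom C A B \<Longrightarrow> on_Arr F f \<in> Hom D (on_Obj F A) (on_Obj F B)"
    and F_Hom2: "\<alpha> \<in> Hom2 C f g \<Longrightarrow> on_Cell F \<alpha> \<in> Hom2 D (on_Arr F f) (on_Arr F g)"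
    and F_Ide: "A \<in> Obj C \<Longrightarrow> on_Arr F (Ide C A) = Ide D (on_Obj F A)"
    and F_comp: "\<lbrakk>f \<in> Hom C A B; g \<in> Hom C B E\<rbrakk>
      \<Longrightarrow> on_Arr F (g \<cdot>\<^bsub>C\<^esub> f) = on_Arr F g \<cdot>\<^bsub>D\<^esub> on_Arr F f"
    and F_Idc: "f \<in> Arr C \<Longrightarrow> on_Cell F (Idc C f) = Idc D (on_Arr F f)"
    and F_vcomp: "\<lbrakk>\<alpha> \<in> Hom2 C f g; \<beta> \<in> Hom2 C g h\<rbrakk>
      \<Longrightarrow> on_Cell F (\<beta> \<bullet>\<^bsub>C\<^esub> \<alpha>) = on_Cell F \<beta> \<bullet>\<^bsub>D\<^esub> on_Cell F \<alpha>"
    and F_hcomp: "\<lbrakk>f \<in> Hom C A B; g \<in> Hom C B E; \<alpha> \<in> Hom2 C f f'; \<beta> \<in> Hom2 C g g'\<rbrakk>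
      \<Longrightarrow> on_Cell F (\<beta> \<star>\<^bsub>C\<^esub> \<alpha>) = on_Cell F \<beta> \<star>\<^bsub>D\<^esub> on_Cell F \<alpha>"

locale two_natural = F: two_functor C D F + G: two_functor C D G
  for C :: "('o, 'm, 'c) twocat" and D :: "('p, 'n, 'd) twocat"
    and F :: "('o, 'm, 'c, 'p, 'n, 'd) twofun" and G :: "('o, 'm, 'c, 'p, 'n, 'd) twofun" +
  fixes \<tau> :: "'o \<Rightarrow> 'n"
  assumes component: "A \<in> Obj C \<Longrightarrow> \<tau> A \<in> Hom D (on_Obj F A) (on_Obj G A)"
    and natural: "f \<in> Hom C A B \<Longrightarrow> \<tau> B \<cdot>\<^bsub>D\<^esub> on_Arr F f = on_Arr G f \<cdot>\<^bsub>D\<^esub> \<tau> A"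
    and natural2: "\<lbrakk>f \<in> Hom C A B; \<alpha> \<in> Hom2 C f g\<rbrakk>
      \<Longrightarrow> \<tau> B \<lhd>\<^bsub>D\<^esub> on_Cell F \<alpha> = on_Cell G \<alpha> \<rhd>\<^bsub>D\<^esub> \<tau> A"

locale two_adjunction =
  F: two_functor C D F + G: two_functor D C G +
  eta: two_natural C C id2 "G \<otimes> F" \<eta> + eps: two_natural D D "F \<otimes> G" id2 \<epsilon>
  for C :: "('o, 'm, 'c) twocat" and D :: "('p, 'n, 'd) twocat"
    and F :: "('o, 'm, 'c, 'p, 'n, 'd) twofun" and G :: "('p, 'n, 'd, 'o, 'm, 'c) twofun"
    and \<eta> :: "'o \<Rightarrow> 'm" and \<epsilon> :: "'p \<Rightarrow> 'n" +
  assumes triangle_F: "A \<in> Obj C \<Longrightarrow> \<epsilon> (on_Obj F A) \<cdot>\<^bsub>D\<^esub> on_Arr F (\<eta> A) = Ide D (on_Obj F A)"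
    and triangle_G: "B \<in> Obj D \<Longrightarrow> on_Arr G (\<epsilon> B) \<cdot>\<^bsub>C\<^esub> \<eta> (on_Obj G B) = Ide C (on_Obj G B)"

definition left_2adjoint :: "('o, 'm, 'c) twocat \<Rightarrow> ('p, 'n, 'd) twocat
    \<Rightarrow> ('o, 'm, 'c, 'p, 'n, 'd) twofun \<Rightarrow> ('p, 'n, 'd, 'o, 'm, 'c) twofun \<Rightarrow> bool" where
  "left_2adjoint C D F G \<longleftrightarrow> (\<exists>\<eta> \<epsilon>. two_adjunction C D F G \<eta> \<epsilon>)"


section \<open>2-monads and their algebras\<close>

record ('o, 'm, 'c) monad2 =
  Fun :: "('o, 'm, 'c, 'o, 'm, 'c) twofun"
  Unit :: "'o \<Rightarrow> 'm"
  Mult :: "'o \<Rightarrow> 'm"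

abbreviation mObj :: "('o, 'm, 'c) monad2 \<Rightarrow> 'o \<Rightarrow> 'o" where "mObj T \<equiv> on_Obj (Fun T)"
abbreviation mArr :: "('o, 'm, 'c) monad2 \<Rightarrow> 'm \<Rightarrow> 'm" where "mArr T \<equiv> on_Arr (Fun T)"
abbreviation mCell :: "('o, 'm, 'c) monad2 \<Rightarrow> 'c \<Rightarrow> 'c" where "mCell T \<equiv> on_Cell (Fun T)"

locale two_monad =
  eta: two_natural K K id2 "Fun T" "Unit T" + mu: two_natural K K "Fun T \<otimes> Fun T" "Fun T" "Mult T"
  for K :: "('o, 'm, 'c) twocat" and T :: "('o, 'm, 'c) monad2" +
  assumes unit_left: "A \<in> Obj K \<Longrightarrow> Mult T A \<cdot>\<^bsub>K\<^esub> Unit T (mObj T A) = Ide K (mObj T A)"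
    and unit_right: "A \<in> Obj K \<Longrightarrow> Mult T A \<cdot>\<^bsub>K\<^esub> mArr T (Unit T A) = Ide K (mObj T A)"
    and mult_assoc: "A \<in> Obj K
      \<Longrightarrow> Mult T A \<cdot>\<^bsub>K\<^esub> Mult T (mObj T A) = Mult T A \<cdot>\<^bsub>K\<^esub> mArr T (Mult T A)"

type_synonym ('o, 'm) alg = "'o \<times> 'm"

datatype ('o, 'm, 'c) lax_mor =
  LaxMor (lm_dom: "('o, 'm) alg") (lm_cod: "('o, 'm) alg") (lm_arr: 'm) (lm_cell: 'c)

datatype ('o, 'm, 'c) alg_cell =
  AlgCell (ac_src: "('o, 'm, 'c) lax_mor") (ac_tgt: "('o, 'm, 'c) lax_mor") (ac_cell: 'c)

definition is_algebra :: "('o, 'm, 'c) twocat \<Rightarrow> ('o, 'm, 'c) monad2 \<Rightarrow> ('o, 'm) alg \<Rightarrow> bool" where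
  "is_algebra K T P \<longleftrightarrow> (case P of (A, a) \<Rightarrow>
     A \<in> Obj K \<and> a \<in> Hom K (mObj T A) A \<and>
     a \<cdot>\<^bsub>K\<^esub> Unit T A = Ide K A \<and>
     a \<cdot>\<^bsub>K\<^esub> mArr T a = a \<cdot>\<^bsub>K\<^esub> Mult T A)"

definition is_lax_mor ::
  "('o, 'm, 'c) twocat \<Rightarrow> ('o, 'm, 'c) monad2 \<Rightarrow> ('o, 'm, 'c) lax_mor \<Rightarrow> bool" where
  "is_lax_mor K T m \<longleftrightarrow> (case m of LaxMor (A, a) (B, b) f fb \<Rightarrow>
     is_algebra K T (A, a) \<and> is_algebra K T (B, b) \<and>
     f \<in> Hom K A B \<and> fb \<in> Hom2 K (b \<cdot>\<^bsub>K\<^esub> mArr T f) (f \<cdot>\<^bsub>K\<^esub> a) \<and>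
     fb \<rhd>\<^bsub>K\<^esub> Unit T A = Idc K f \<and>
     fb \<rhd>\<^bsub>K\<^esub> Mult T A = (fb \<rhd>\<^bsub>K\<^esub> mArr T a) \<bullet>\<^bsub>K\<^esub> (b \<lhd>\<^bsub>K\<^esub> mCell T fb))"

definition is_strict :: "('o, 'm, 'c) twocat \<Rightarrow> ('o, 'm, 'c) lax_mor \<Rightarrow> bool" where
  "is_strict K m \<longleftrightarrow> (\<exists>h \<in> Arr K. lm_cell m = Idc K h)"

definition is_alg_cell ::
  "('o, 'm, 'c) twocat \<Rightarrow> ('o, 'm, 'c) monad2 \<Rightarrow> ('o, 'm, 'c) alg_cell \<Rightarrow> bool" where
  "is_alg_cell K T w \<longleftrightarrow> (case w of AlgCell m m' \<phi> \<Rightarrow>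
     is_lax_mor K T m \<and> is_lax_mor K T m' \<and>
     lm_dom m = lm_dom m' \<and> lm_cod m = lm_cod m' \<and>
     \<phi> \<in> Hom2 K (lm_arr m) (lm_arr m') \<and>
     lm_cell m' \<bullet>\<^bsub>K\<^esub> (snd (lm_cod m) \<lhd>\<^bsub>K\<^esub> mCell T \<phi>) = (\<phi> \<rhd>\<^bsub>K\<^esub> snd (lm_dom m)) \<bullet>\<^bsub>K\<^esub> lm_cell m)"

definition strict_mor :: "('o, 'm, 'c) twocat \<Rightarrow> ('o, 'm) alg \<Rightarrow> ('o, 'm) alg \<Rightarrow> 'm
    \<Rightarrow> ('o, 'm, 'c) lax_mor" where
  "strict_mor K P Q f = LaxMor P Q f (Idc K (f \<cdot>\<^bsub>K\<^esub> snd P))"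

text \<open>
  The composite of \<open>(f, fb) : (A, a) \<rightarrow> (B, b)\<close> and \<open>(g, gb) : (B, b) \<rightarrow> (C, c)\<close> is
  \<open>g f\<close> with the 2-cell \<open>c T(g) T(f) \<Rightarrow> g b T(f) \<Rightarrow> g f a\<close>.
\<close>

definition lax_comp :: "('o, 'm, 'c) twocat \<Rightarrow> ('o, 'm, 'c) monad2
    \<Rightarrow> ('o, 'm, 'c) lax_mor \<Rightarrow> ('o, 'm, 'c) lax_mor \<Rightarrow> ('o, 'm, 'c) lax_mor" where
  "lax_comp K T n m = LaxMor (lm_dom m) (lm_cod n) (lm_arr n \<cdot>\<^bsub>K\<^esub> lm_arr m)
     ((lm_arr n \<lhd>\<^bsub>K\<^esub> lm_cell m) \<bullet>\<^bsub>K\<^esub> (lm_cell n \<rhd>\<^bsub>K\<^esub> mArr T (lm_arr m)))"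

definition Alg_l :: "('o, 'm, 'c) twocat \<Rightarrow> ('o, 'm, 'c) monad2
    \<Rightarrow> (('o, 'm) alg, ('o, 'm, 'c) lax_mor, ('o, 'm, 'c) alg_cell) twocat" where
  "Alg_l K T = \<lparr>
     Obj = {P. is_algebra K T P},
     Arr = {m. is_lax_mor K T m},
     Cell = {w. is_alg_cell K T w},
     Dom = lm_dom,
     Cod = lm_cod,
     Src = ac_src,
     Tgt = ac_tgt,
     Ide = \<lambda>P. strict_mor K P P (Ide K (fst P)),
     Idc = \<lambda>m. AlgCell m m (Idc K (lm_arr m)),
     comp = lax_comp K T,
     hcomp = \<lambda>v w. AlgCell (lax_comp K T (ac_src v) (ac_src w)) (lax_comp K T (ac_tgt v) (ac_tgt w))
       (ac_cell v \<star>\<^bsub>K\<^esub> ac_cell w),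
     vcomp = \<lambda>v w. AlgCell (ac_src w) (ac_tgt v) (ac_cell v \<bullet>\<^bsub>K\<^esub> ac_cell w)\<rparr>"

definition Alg_s :: "('o, 'm, 'c) twocat \<Rightarrow> ('o, 'm, 'c) monad2
    \<Rightarrow> (('o, 'm) alg, ('o, 'm, 'c) lax_mor, ('o, 'm, 'c) alg_cell) twocat" where
  "Alg_s K T = (Alg_l K T)\<lparr>
     Arr := {m. is_lax_mor K T m \<and> is_strict K m},
     Cell := {w. is_alg_cell K T w \<and> is_strict K (ac_src w) \<and> is_strict K (ac_tgt w)}\<rparr>"

definition free_alg :: "('o, 'm, 'c) monad2 \<Rightarrow> 'o \<Rightarrow> ('o, 'm) alg" where
  "free_alg T A = (mObj T A, Mult T A)"


section \<open>Adjunctions of 2-monads\<close>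

text \<open>
  The data \<open>F\<^sub>! \<stileturn> F\<^sup>*\<close> (with its unit and counit) and \<open>F\<^sup>c : F\<^sub>! S \<rightarrow> T F\<^sub>!\<close>.
\<close>

record ('o, 'm, 'c, 'p, 'n, 'd) monad_adj =
  Lower :: "('o, 'm, 'c, 'p, 'n, 'd) twofun"
  Upper :: "('p, 'n, 'd, 'o, 'm, 'c) twofun"
  AUnit :: "'o \<Rightarrow> 'm"
  ACounit :: "'p \<Rightarrow> 'n"
  Colax :: "'o \<Rightarrow> 'n"

locale two_monad_adjunction =
  S: two_monad L S + T: two_monad K T +
  adj: two_adjunction L K "Lower F" "Upper F" "AUnit F" "ACounit F" +
  colax: two_natural L K "Lower F \<otimes> Fun S" "Fun T \<otimes> Lower F" "Colax F"
  for L :: "('o, 'm, 'c) twocat" and S :: "('o, 'm, 'c) monad2"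
    and K :: "('p, 'n, 'd) twocat" and T :: "('p, 'n, 'd) monad2"
    and F :: "('o, 'm, 'c, 'p, 'n, 'd) monad_adj" +
  assumes colax_unit: "A \<in> Obj L
      \<Longrightarrow> Colax F A \<cdot>\<^bsub>K\<^esub> on_Arr (Lower F) (Unit S A) = Unit T (on_Obj (Lower F) A)"
    and colax_mult: "A \<in> Obj L
      \<Longrightarrow> Colax F A \<cdot>\<^bsub>K\<^esub> on_Arr (Lower F) (Mult S A)
        = Mult T (on_Obj (Lower F) A) \<cdot>\<^bsub>K\<^esub> mArr T (Colax F A) \<cdot>\<^bsub>K\<^esub> Colax F (mObj S A)"

text \<open>The mate \<open>F\<^sup>l : S F\<^sup>* \<rightarrow> F\<^sup>* T\<close> of \<open>F\<^sup>c\<close>.\<close>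

definition mate :: "('o, 'm, 'c) twocat \<Rightarrow> ('o, 'm, 'c) monad2 \<Rightarrow> ('p, 'n, 'd) monad2
    \<Rightarrow> ('o, 'm, 'c, 'p, 'n, 'd) monad_adj \<Rightarrow> 'p \<Rightarrow> 'm" where
  "mate L S T F A =
     on_Arr (Upper F) (mArr T (ACounit F A)) \<cdot>\<^bsub>L\<^esub>
     on_Arr (Upper F) (Colax F (on_Obj (Upper F) A)) \<cdot>\<^bsub>L\<^esub>
     AUnit F (mObj S (on_Obj (Upper F) A))"

definition lift_obj :: "('o, 'm, 'c) twocat \<Rightarrow> ('o, 'm, 'c) monad2 \<Rightarrow> ('p, 'n, 'd) monad2
    \<Rightarrow> ('o, 'm, 'c, 'p, 'n, 'd) monad_adj \<Rightarrow> ('p, 'n) alg \<Rightarrow> ('o, 'm) alg" where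
  "lift_obj L S T F P =
     (on_Obj (Upper F) (fst P), on_Arr (Upper F) (snd P) \<cdot>\<^bsub>L\<^esub> mate L S T F (fst P))"

definition lift_mor :: "('o, 'm, 'c) twocat \<Rightarrow> ('o, 'm, 'c) monad2 \<Rightarrow> ('p, 'n, 'd) monad2
    \<Rightarrow> ('o, 'm, 'c, 'p, 'n, 'd) monad_adj \<Rightarrow> ('p, 'n, 'd) lax_mor \<Rightarrow> ('o, 'm, 'c) lax_mor" where
  "lift_mor L S T F m = LaxMor (lift_obj L S T F (lm_dom m)) (lift_obj L S T F (lm_cod m))
     (on_Arr (Upper F) (lm_arr m))
     (on_Cell (Upper F) (lm_cell m) \<rhd>\<^bsub>L\<^esub> mate L S T F (fst (lm_dom m)))"

definition lift2 :: "('o, 'm, 'c) twocat \<Rightarrow> ('o, 'm, 'c) monad2 \<Rightarrow> ('p, 'n, 'd) monad2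
    \<Rightarrow> ('o, 'm, 'c, 'p, 'n, 'd) monad_adj
    \<Rightarrow> (('p, 'n) alg, ('p, 'n, 'd) lax_mor, ('p, 'n, 'd) alg_cell,
        ('o, 'm) alg, ('o, 'm, 'c) lax_mor, ('o, 'm, 'c) alg_cell) twofun" where
  "lift2 L S T F = \<lparr>
     on_Obj = lift_obj L S T F,
     on_Arr = lift_mor L S T F,
     on_Cell = \<lambda>w. AlgCell (lift_mor L S T F (ac_src w)) (lift_mor L S T F (ac_tgt w))
       (on_Cell (Upper F) (ac_cell w))\<rparr>"

text \<open>
  \<open>J\<^sub>F\<close>: as the cells of \<open>T-Alg\<^sub>s\<close> are literally cells of \<open>T-Alg\<^sub>l\<close>, the inclusion is \<^const>\<open>id2\<close>.
\<close>

definition J :: "('o, 'm, 'c) twocat \<Rightarrow> ('o, 'm, 'c) monad2 \<Rightarrow> ('p, 'n, 'd) monad2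
    \<Rightarrow> ('o, 'm, 'c, 'p, 'n, 'd) monad_adj
    \<Rightarrow> (('p, 'n) alg, ('p, 'n, 'd) lax_mor, ('p, 'n, 'd) alg_cell,
        ('o, 'm) alg, ('o, 'm, 'c) lax_mor, ('o, 'm, 'c) alg_cell) twofun" where
  "J L S T F = lift2 L S T F \<otimes> id2"


section \<open>Simplicial objects and codescent objects\<close>

text \<open>
  A simplicial object is presented by its face maps \<open>face n i : X\<^sub>n\<^sub>+\<^sub>1 \<rightarrow> X\<^sub>n\<close> (\<open>i \<le> n + 1\<close>) and
  degeneracies \<open>degen n i : X\<^sub>n \<rightarrow> X\<^sub>n\<^sub>+\<^sub>1\<close> (\<open>i \<le> n\<close>).
\<close>

record ('o, 'm) simp =
  ob :: "nat \<Rightarrow> 'o"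
  face :: "nat \<Rightarrow> nat \<Rightarrow> 'm"
  degen :: "nat \<Rightarrow> nat \<Rightarrow> 'm"

definition simplicial_object :: "('o, 'm, 'c) twocat \<Rightarrow> ('o, 'm) simp \<Rightarrow> bool" where
  "simplicial_object C X \<longleftrightarrow>
     (\<forall>n. ob X n \<in> Obj C) \<and>
     (\<forall>n. \<forall>i \<le> n + 1. face X n i \<in> Hom C (ob X (n + 1)) (ob X n)) \<and>
     (\<forall>n. \<forall>i \<le> n. degen X n i \<in> Hom C (ob X n) (ob X (n + 1))) \<and>
     (\<forall>n i j. i < j \<and> j \<le> n + 2 \<longrightarrow>
        face X n i \<cdot>\<^bsub>C\<^esub> face X (n + 1) j = face X n (j - 1) \<cdot>\<^bsub>C\<^esub> face X (n + 1) i) \<and>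
     (\<forall>n i j. i \<le> j \<and> j \<le> n \<longrightarrow>
        degen X (n + 1) i \<cdot>\<^bsub>C\<^esub> degen X n j = degen X (n + 1) (j + 1) \<cdot>\<^bsub>C\<^esub> degen X n i) \<and>
     (\<forall>n i j. i < j \<and> j \<le> n + 1 \<longrightarrow>
        face X (n + 1) i \<cdot>\<^bsub>C\<^esub> degen X (n + 1) j = degen X n (j - 1) \<cdot>\<^bsub>C\<^esub> face X n i) \<and>
     (\<forall>n. \<forall>j \<le> n. face X n j \<cdot>\<^bsub>C\<^esub> degen X n j = Ide C (ob X n)) \<and>
     (\<forall>n. \<forall>j \<le> n. face X n (j + 1) \<cdot>\<^bsub>C\<^esub> degen X n j = Ide C (ob X n)) \<and>
     (\<forall>n i j. j + 1 < i \<and> i \<le> n + 2 \<longrightarrow>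
        face X (n + 1) i \<cdot>\<^bsub>C\<^esub> degen X (n + 1) j = degen X n j \<cdot>\<^bsub>C\<^esub> face X n (i - 1))"

definition is_cocone :: "('o, 'm, 'c) twocat \<Rightarrow> ('o, 'm) simp \<Rightarrow> 'o \<Rightarrow> 'm \<Rightarrow> 'c \<Rightarrow> bool" where
  "is_cocone C X Z f0 f1 \<longleftrightarrow>
     Z \<in> Obj C \<and> f0 \<in> Hom C (ob X 0) Z \<and>
     f1 \<in> Hom2 C (f0 \<cdot>\<^bsub>C\<^esub> face X 0 1) (f0 \<cdot>\<^bsub>C\<^esub> face X 0 0) \<and>
     f1 \<rhd>\<^bsub>C\<^esub> degen X 0 0 = Idc C f0 \<and>
     (f1 \<rhd>\<^bsub>C\<^esub> face X 1 0) \<bullet>\<^bsub>C\<^esub> (f1 \<rhd>\<^bsub>C\<^esub> face X 1 2) = f1 \<rhd>\<^bsub>C\<^esub> face X 1 1"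

definition is_factorisation :: "('o, 'm, 'c) twocat \<Rightarrow> 'o \<Rightarrow> 'm \<Rightarrow> 'c
    \<Rightarrow> 'o \<Rightarrow> 'm \<Rightarrow> 'c \<Rightarrow> 'm \<Rightarrow> bool" where
  "is_factorisation C Q q0 q1 Z f0 f1 f' \<longleftrightarrow>
     f' \<in> Hom C Q Z \<and> f' \<cdot>\<^bsub>C\<^esub> q0 = f0 \<and> f' \<lhd>\<^bsub>C\<^esub> q1 = f1"

definition is_codescent_cocone ::
  "('o, 'm, 'c) twocat \<Rightarrow> ('o, 'm) simp \<Rightarrow> 'o \<Rightarrow> 'm \<Rightarrow> 'c \<Rightarrow> bool" where
  "is_codescent_cocone C X Q q0 q1 \<longleftrightarrow>
     is_cocone C X Q q0 q1 \<and>
     (\<forall>Z f0 f1. is_cocone C X Z f0 f1 \<longrightarrow> (\<exists>!f'. is_factorisation C Q q0 q1 Z f0 f1 f')) \<and>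
     (\<forall>Z f0 f1 g0 g1 \<phi> f' g'.
        is_cocone C X Z f0 f1 \<and> is_cocone C X Z g0 g1 \<and> \<phi> \<in> Hom2 C f0 g0 \<and>
        (\<phi> \<rhd>\<^bsub>C\<^esub> face X 0 0) \<bullet>\<^bsub>C\<^esub> f1 = g1 \<bullet>\<^bsub>C\<^esub> (\<phi> \<rhd>\<^bsub>C\<^esub> face X 0 1) \<and>
        is_factorisation C Q q0 q1 Z f0 f1 f' \<and> is_factorisation C Q q0 q1 Z g0 g1 g' \<longrightarrow>
        (\<exists>!\<phi>'. \<phi>' \<in> Hom2 C f' g' \<and> \<phi>' \<rhd>\<^bsub>C\<^esub> q0 = \<phi>))"

definition is_codescent_object :: "('o, 'm, 'c) twocat \<Rightarrow> ('o, 'm) simp \<Rightarrow> 'o \<Rightarrow> bool" where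
  "is_codescent_object C X Q \<longleftrightarrow> (\<exists>q0 q1. is_codescent_cocone C X Q q0 q1)"

definition has_codescent_objects :: "('o, 'm, 'c) twocat \<Rightarrow> bool" where
  "has_codescent_objects C \<longleftrightarrow> (\<forall>X. simplicial_object C X \<longrightarrow> (\<exists>Q. is_codescent_object C X Q))"


section \<open>The simplicial object \<open>\<R>\<^sub>F X\<close>\<close>

text \<open>
  \<open>(\<R>\<^sub>F X)\<^sub>n\<close> is the free \<open>T\<close>-algebra on \<open>F\<^sub>! S\<^sup>n X\<close>.  In the middle case of the face maps, \<open>i \<ge> 1\<close>, so
  the predecessor \<open>i - 1\<close> is not truncated.
\<close>

definition Res_ob :: "('o, 'm, 'c) monad2 \<Rightarrow> ('p, 'n, 'd) monad2
    \<Rightarrow> ('o, 'm, 'c, 'p, 'n, 'd) monad_adj \<Rightarrow> 'o \<Rightarrow> nat \<Rightarrow> ('p, 'n) alg" where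
  "Res_ob S T F X n = free_alg T (on_Obj (Lower F) (on_Obj (pow2 (Fun S) n) X))"

definition Res :: "('o, 'm, 'c) monad2 \<Rightarrow> ('p, 'n, 'd) twocat \<Rightarrow> ('p, 'n, 'd) monad2
    \<Rightarrow> ('o, 'm, 'c, 'p, 'n, 'd) monad_adj \<Rightarrow> ('o, 'm) alg
    \<Rightarrow> (('p, 'n) alg, ('p, 'n, 'd) lax_mor) simp" where
  "Res S K T F P = (let X = fst P; x = snd P in \<lparr>
     ob = Res_ob S T F X,
     face = \<lambda>n i. strict_mor K (Res_ob S T F X (n + 1)) (Res_ob S T F X n)
       (if i = 0 then
          mArr T (on_Arr (Lower F) (on_Arr (pow2 (Fun S) n) x))
        else if i \<le> n then
          mArr T (on_Arr (Lower F) (on_Arr (pow2 (Fun S) (n - i))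
            (Mult S (on_Obj (pow2 (Fun S) (i - 1)) X))))
        else
          Mult T (on_Obj (Lower F) (on_Obj (pow2 (Fun S) n) X)) \<cdot>\<^bsub>K\<^esub>
          mArr T (Colax F (on_Obj (pow2 (Fun S) n) X))),
     degen = \<lambda>n i. strict_mor K (Res_ob S T F X n) (Res_ob S T F X (n + 1))
       (mArr T (on_Arr (Lower F) (on_Arr (pow2 (Fun S) (n - i))
         (Unit S (on_Obj (pow2 (Fun S) i) X)))))\<rparr>)"

end

theory Submission
  imports Defs
begin

text \<open>
  Write \<open>P = T F\<^sub>!\<close> for the composite of \<open>F\<^sub>!\<close> with the free algebra 2-functor. It is left 2-adjoint to
  \<open>U\<close>, the composite of the forgetful 2-functor \<open>T-Alg\<^sub>s \<rightarrow> \<K>\<close> with \<open>F\<^sup>*\<close>, and the map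
  \<open>c = \<mu>\<^sup>T T(F\<^sup>c) : T F\<^sub>! S \<rightarrow> T F\<^sub>!\<close> makes \<open>P\<close> a right module over the 2-monad \<open>S\<close>. These data carry the
  whole situation: the transpose of \<open>\<epsilon> c\<close> is a natural \<open>S\<close>-algebra structure \<open>b : S U Z \<rightarrow> U Z\<close>, which
  is the one given by \<open>J\<^sub>F\<close>, and the simplicial object \<open>\<R>\<^sub>F X\<close> is the bar resolution whose last faces
  are components of \<open>c\<close> and whose other faces and degeneracies are images under \<open>P\<close>. So the theorem is
  a statement about an arbitrary right module \<open>P \<stileturn> U\<close>, and is proved at that level.

  The heart is a dictionary. Transposition identifies \<open>f\<^sub>0 : P X \<rightarrow> Z\<close> with \<open>g : X \<rightarrow> U Z\<close>. It sends
  \<open>f\<^sub>0 (P x)\<close> to \<open>g x\<close> and, because \<open>b\<close> was defined as a transpose, \<open>f\<^sub>0 c\<close> to \<open>b (S g)\<close>. So a 2-cell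
  \<open>f\<^sub>0 d\<^sub>1 \<Rightarrow> f\<^sub>0 d\<^sub>0\<close> is the same as a 2-cell \<open>b (S g) \<Rightarrow> g x\<close>, and the two cocone equations become the
  unit and multiplication laws of a lax morphism (\<open>cocone_iff_lax_mor\<close>). Likewise the equation imposed
  on a 2-cell between cocones becomes the equation defining 2-cells of \<open>S-Alg\<^sub>l\<close>. Composition with a
  strict morphism \<open>Q \<rightarrow> Z\<close> corresponds on both sides, so the two universal properties of a
  codescent object say exactly that its cocone, read as a lax morphism \<open>X \<rightarrow> J\<^sub>F Q\<close>, is a universal
  arrow in the 2-categorical sense (\<open>codescent_universal\<close>). A choice of universal arrows, one for each
  object, extends to a left 2-adjoint with the chosen values on objects.

  Codescent objects are assumed for simplicial objects only, so the simplicial identities of the bar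
  resolution are needed as well (\<open>bar_simplicial\<close>).
\<close>


section \<open>Cells with boundary conditions\<close>

text \<open>
  Composability is expressed below by equations between domains and codomains: as conditional rewrite
  rules such statements need no guessing of intermediate objects, which membership in hom-sets would
  require. The rules associate all composites to the right and distribute whiskering over vertical
  composition.
\<close>

lemma Hom_iff: "f \<in> Hom C A B \<longleftrightarrow> f \<in> Arr C \<and> Dom C f = A \<and> Cod C f = B"
  by (auto simp: Hom_def)

lemma Hom2_iff: "\<alpha> \<in> Hom2 C f g \<longleftrightarrow> \<alpha> \<in> Cell C \<and> Src C \<alpha> = f \<and> Tgt C \<alpha> = g"
  by (auto simp: Hom2_def)

context two_category
begin

lemma Dom_Tgt [simp]: "\<alpha> \<in> Cell C \<Longrightarrow> Dom C (Tgt C \<alpha>) = Dom C (Src C \<alpha>)"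
  by (simp add: parallel_Dom)

lemma Cod_Tgt [simp]: "\<alpha> \<in> Cell C \<Longrightarrow> Cod C (Tgt C \<alpha>) = Cod C (Src C \<alpha>)"
  by (simp add: parallel_Cod)

lemmas boundary_Obj [simp] = Dom_Obj Cod_Obj Src_Arr Tgt_Arr

lemma Ide_boundary [simp]:
  assumes "A \<in> Obj C"
  shows "Ide C A \<in> Arr C" "Dom C (Ide C A) = A" "Cod C (Ide C A) = A"
  using Ide_Hom[OF assms] by (simp_all add: Hom_iff)

lemma comp_boundary [simp]:
  assumes "f \<in> Arr C" "g \<in> Arr C" "Dom C g = Cod C f"
  shows "g \<cdot>\<^bsub>C\<^esub> f \<in> Arr C" "Dom C (g \<cdot>\<^bsub>C\<^esub> f) = Dom C f" "Cod C (g \<cdot>\<^bsub>C\<^esub> f) = Cod C g"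
  using comp_Hom[of f "Dom C f" "Cod C f" g "Cod C g"] assms by (simp_all add: Hom_iff)

lemma comp_assoc_right [simp]:
  assumes "f \<in> Arr C" "g \<in> Arr C" "h \<in> Arr C" "Dom C g = Cod C f" "Dom C h = Cod C g"
  shows "(h \<cdot>\<^bsub>C\<^esub> g) \<cdot>\<^bsub>C\<^esub> f = h \<cdot>\<^bsub>C\<^esub> (g \<cdot>\<^bsub>C\<^esub> f)"
  using assms by (intro comp_assoc) (simp_all add: Hom_iff)

lemma Ide_comp [simp]: "\<lbrakk>f \<in> Arr C; Cod C f = A\<rbrakk> \<Longrightarrow> Ide C A \<cdot>\<^bsub>C\<^esub> f = f"
  by (rule comp_Ide_left) (simp add: Hom_iff)

lemma comp_Ide [simp]: "\<lbrakk>f \<in> Arr C; Dom C f = A\<rbrakk> \<Longrightarrow> f \<cdot>\<^bsub>C\<^esub> Ide C A = f"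
  by (rule comp_Ide_right) (simp add: Hom_iff)

lemma Idc_boundary [simp]:
  assumes "f \<in> Arr C"
  shows "Idc C f \<in> Cell C" "Src C (Idc C f) = f" "Tgt C (Idc C f) = f"
  using Idc_Hom2[OF assms] by (simp_all add: Hom2_iff)

lemma vcomp_boundary [simp]:
  assumes "\<alpha> \<in> Cell C" "\<beta> \<in> Cell C" "Src C \<beta> = Tgt C \<alpha>"
  shows "\<beta> \<bullet>\<^bsub>C\<^esub> \<alpha> \<in> Cell C" "Src C (\<beta> \<bullet>\<^bsub>C\<^esub> \<alpha>) = Src C \<alpha>" "Tgt C (\<beta> \<bullet>\<^bsub>C\<^esub> \<alpha>) = Tgt C \<beta>"
  using vcomp_Hom2[of \<alpha> "Src C \<alpha>" "Tgt C \<alpha>" \<beta> "Tgt C \<beta>"] assms by (simp_all add: Hom2_iff)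

lemma vcomp_assoc_right [simp]:
  assumes "\<alpha> \<in> Cell C" "\<beta> \<in> Cell C" "\<gamma> \<in> Cell C" "Src C \<beta> = Tgt C \<alpha>" "Src C \<gamma> = Tgt C \<beta>"
  shows "(\<gamma> \<bullet>\<^bsub>C\<^esub> \<beta>) \<bullet>\<^bsub>C\<^esub> \<alpha> = \<gamma> \<bullet>\<^bsub>C\<^esub> (\<beta> \<bullet>\<^bsub>C\<^esub> \<alpha>)"
  using assms by (intro vcomp_assoc) (simp_all add: Hom2_iff)

lemma Idc_vcomp [simp]: "\<lbrakk>\<alpha> \<in> Cell C; Tgt C \<alpha> = f\<rbrakk> \<Longrightarrow> Idc C f \<bullet>\<^bsub>C\<^esub> \<alpha> = \<alpha>"
  by (rule vcomp_Idc_left) (simp add: Hom2_iff)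

lemma vcomp_Idc [simp]: "\<lbrakk>\<alpha> \<in> Cell C; Src C \<alpha> = f\<rbrakk> \<Longrightarrow> \<alpha> \<bullet>\<^bsub>C\<^esub> Idc C f = \<alpha>"
  by (rule vcomp_Idc_right) (simp add: Hom2_iff)

lemma hcomp_boundary [simp]:
  assumes "\<alpha> \<in> Cell C" "\<beta> \<in> Cell C" "Dom C (Src C \<beta>) = Cod C (Src C \<alpha>)"
  shows "\<beta> \<star>\<^bsub>C\<^esub> \<alpha> \<in> Cell C"
    "Src C (\<beta> \<star>\<^bsub>C\<^esub> \<alpha>) = Src C \<beta> \<cdot>\<^bsub>C\<^esub> Src C \<alpha>" "Tgt C (\<beta> \<star>\<^bsub>C\<^esub> \<alpha>) = Tgt C \<beta> \<cdot>\<^bsub>C\<^esub> Tgt C \<alpha>"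
  using hcomp_Hom2[of "Src C \<alpha>" "Dom C (Src C \<alpha>)" "Cod C (Src C \<alpha>)" "Src C \<beta>" "Cod C (Src C \<beta>)"
      \<alpha> "Tgt C \<alpha>" \<beta> "Tgt C \<beta>"] assms
  by (simp_all add: Hom_iff Hom2_iff)

lemma hcomp_assoc_right [simp]:
  assumes "\<alpha> \<in> Cell C" "\<beta> \<in> Cell C" "\<gamma> \<in> Cell C"
    "Dom C (Src C \<beta>) = Cod C (Src C \<alpha>)" "Dom C (Src C \<gamma>) = Cod C (Src C \<beta>)"
  shows "(\<gamma> \<star>\<^bsub>C\<^esub> \<beta>) \<star>\<^bsub>C\<^esub> \<alpha> = \<gamma> \<star>\<^bsub>C\<^esub> (\<beta> \<star>\<^bsub>C\<^esub> \<alpha>)"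
  using assms
  by (intro hcomp_assoc[of "Src C \<alpha>" _ _ "Src C \<beta>" _ "Src C \<gamma>"]) (auto simp add: Hom_iff Hom2_iff)

lemma Ide_hcomp [simp]: "\<lbrakk>\<alpha> \<in> Cell C; Cod C (Src C \<alpha>) = A\<rbrakk> \<Longrightarrow> Ide C A \<lhd>\<^bsub>C\<^esub> \<alpha> = \<alpha>"
  by (rule hcomp_Ide_left[of "Src C \<alpha>"]) (auto simp add: Hom_iff Hom2_iff)

lemma hcomp_Ide [simp]: "\<lbrakk>\<alpha> \<in> Cell C; Dom C (Src C \<alpha>) = A\<rbrakk> \<Longrightarrow> \<alpha> \<rhd>\<^bsub>C\<^esub> Ide C A = \<alpha>"
  by (rule hcomp_Ide_right[of "Src C \<alpha>"]) (auto simp add: Hom_iff Hom2_iff)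

lemma Idc_hcomp_Idc [simp]:
  "\<lbrakk>f \<in> Arr C; g \<in> Arr C; Dom C g = Cod C f\<rbrakk> \<Longrightarrow> Idc C g \<star>\<^bsub>C\<^esub> Idc C f = Idc C (g \<cdot>\<^bsub>C\<^esub> f)"
  by (rule hcomp_Idc) (auto simp add: Hom_iff)

lemma lwhisker_lwhisker [simp]:
  assumes "\<alpha> \<in> Cell C" "f \<in> Arr C" "g \<in> Arr C" "Dom C f = Cod C (Src C \<alpha>)" "Dom C g = Cod C f"
  shows "g \<lhd>\<^bsub>C\<^esub> (f \<lhd>\<^bsub>C\<^esub> \<alpha>) = (g \<cdot>\<^bsub>C\<^esub> f) \<lhd>\<^bsub>C\<^esub> \<alpha>"
  using assms by (subst hcomp_assoc_right[symmetric]) simp_all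

lemma hcomp_vcomp:
  assumes "\<alpha> \<in> Cell C" "\<alpha>' \<in> Cell C" "\<beta> \<in> Cell C" "\<beta>' \<in> Cell C"
    "Src C \<alpha>' = Tgt C \<alpha>" "Src C \<beta>' = Tgt C \<beta>" "Dom C (Src C \<beta>) = Cod C (Src C \<alpha>)"
  shows "(\<beta>' \<bullet>\<^bsub>C\<^esub> \<beta>) \<star>\<^bsub>C\<^esub> (\<alpha>' \<bullet>\<^bsub>C\<^esub> \<alpha>) = (\<beta>' \<star>\<^bsub>C\<^esub> \<alpha>') \<bullet>\<^bsub>C\<^esub> (\<beta> \<star>\<^bsub>C\<^esub> \<alpha>)"
  using assms
  by (intro interchange[of "Src C \<alpha>" _ _ "Src C \<beta>"]) (auto simp add: Hom_iff Hom2_iff)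

lemma lwhisker_vcomp [simp]:
  assumes "\<alpha> \<in> Cell C" "\<alpha>' \<in> Cell C" "f \<in> Arr C" "Src C \<alpha>' = Tgt C \<alpha>" "Dom C f = Cod C (Src C \<alpha>)"
  shows "f \<lhd>\<^bsub>C\<^esub> (\<alpha>' \<bullet>\<^bsub>C\<^esub> \<alpha>) = (f \<lhd>\<^bsub>C\<^esub> \<alpha>') \<bullet>\<^bsub>C\<^esub> (f \<lhd>\<^bsub>C\<^esub> \<alpha>)"
  using hcomp_vcomp[of \<alpha> \<alpha>' "Idc C f" "Idc C f"] assms by simp

lemma rwhisker_vcomp [simp]:
  assumes "\<alpha> \<in> Cell C" "\<alpha>' \<in> Cell C" "f \<in> Arr C" "Src C \<alpha>' = Tgt C \<alpha>" "Cod C f = Dom C (Src C \<alpha>)"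
  shows "(\<alpha>' \<bullet>\<^bsub>C\<^esub> \<alpha>) \<rhd>\<^bsub>C\<^esub> f = (\<alpha>' \<rhd>\<^bsub>C\<^esub> f) \<bullet>\<^bsub>C\<^esub> (\<alpha> \<rhd>\<^bsub>C\<^esub> f)"
  using hcomp_vcomp[of "Idc C f" "Idc C f" \<alpha> \<alpha>'] assms by simp

lemma hcomp_eq_lower_first:
  assumes "\<alpha> \<in> Cell C" "\<beta> \<in> Cell C" "Dom C (Src C \<beta>) = Cod C (Src C \<alpha>)"
  shows "\<beta> \<star>\<^bsub>C\<^esub> \<alpha> = (\<beta> \<rhd>\<^bsub>C\<^esub> Tgt C \<alpha>) \<bullet>\<^bsub>C\<^esub> (Src C \<beta> \<lhd>\<^bsub>C\<^esub> \<alpha>)"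
  using hcomp_vcomp[of \<alpha> "Idc C (Tgt C \<alpha>)" "Idc C (Src C \<beta>)" \<beta>] assms by simp

lemma hcomp_eq_upper_first:
  assumes "\<alpha> \<in> Cell C" "\<beta> \<in> Cell C" "Dom C (Src C \<beta>) = Cod C (Src C \<alpha>)"
  shows "\<beta> \<star>\<^bsub>C\<^esub> \<alpha> = (Tgt C \<beta> \<lhd>\<^bsub>C\<^esub> \<alpha>) \<bullet>\<^bsub>C\<^esub> (\<beta> \<rhd>\<^bsub>C\<^esub> Src C \<alpha>)"
  using hcomp_vcomp[of "Idc C (Src C \<alpha>)" \<alpha> \<beta> "Idc C (Tgt C \<beta>)"] assms by simp

text \<open>
  Both sides are the horizontal composite: two cells acting on disjoint parts of a composite of 1-cells
  may be applied in either order.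
\<close>

lemma middle_exchange:
  assumes "\<alpha> \<in> Cell C" "\<beta> \<in> Cell C" "Dom C (Src C \<beta>) = Cod C (Src C \<alpha>)"
  shows "(\<beta> \<rhd>\<^bsub>C\<^esub> Tgt C \<alpha>) \<bullet>\<^bsub>C\<^esub> (Src C \<beta> \<lhd>\<^bsub>C\<^esub> \<alpha>) = (Tgt C \<beta> \<lhd>\<^bsub>C\<^esub> \<alpha>) \<bullet>\<^bsub>C\<^esub> (\<beta> \<rhd>\<^bsub>C\<^esub> Src C \<alpha>)"
  using assms hcomp_eq_lower_first hcomp_eq_upper_first by metis

lemma middle_exchange_assoc:
  assumes "\<alpha> \<in> Cell C" "\<beta> \<in> Cell C" "Dom C (Src C \<beta>) = Cod C (Src C \<alpha>)"
    "\<delta> \<in> Cell C" "Tgt C \<delta> = Src C \<beta> \<cdot>\<^bsub>C\<^esub> Src C \<alpha>"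
  shows "(\<beta> \<rhd>\<^bsub>C\<^esub> Tgt C \<alpha>) \<bullet>\<^bsub>C\<^esub> ((Src C \<beta> \<lhd>\<^bsub>C\<^esub> \<alpha>) \<bullet>\<^bsub>C\<^esub> \<delta>)
    = (Tgt C \<beta> \<lhd>\<^bsub>C\<^esub> \<alpha>) \<bullet>\<^bsub>C\<^esub> ((\<beta> \<rhd>\<^bsub>C\<^esub> Src C \<alpha>) \<bullet>\<^bsub>C\<^esub> \<delta>)"
proof -
  have "((\<beta> \<rhd>\<^bsub>C\<^esub> Tgt C \<alpha>) \<bullet>\<^bsub>C\<^esub> (Src C \<beta> \<lhd>\<^bsub>C\<^esub> \<alpha>)) \<bullet>\<^bsub>C\<^esub> \<delta>
      = ((Tgt C \<beta> \<lhd>\<^bsub>C\<^esub> \<alpha>) \<bullet>\<^bsub>C\<^esub> (\<beta> \<rhd>\<^bsub>C\<^esub> Src C \<alpha>)) \<bullet>\<^bsub>C\<^esub> \<delta>"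
    by (simp only: middle_exchange[OF assms(1-3)])
  then show ?thesis
    using assms by simp
qed

end

context two_functor
begin

lemma F_Arr [simp]:
  assumes "f \<in> Arr C"
  shows "on_Arr F f \<in> Arr D" "Dom D (on_Arr F f) = on_Obj F (Dom C f)"
    "Cod D (on_Arr F f) = on_Obj F (Cod C f)"
  using F_Hom[of f "Dom C f" "Cod C f"] assms by (simp_all add: Hom_iff)

lemma F_Cell [simp]:
  assumes "\<alpha> \<in> Cell C"
  shows "on_Cell F \<alpha> \<in> Cell D" "Src D (on_Cell F \<alpha>) = on_Arr F (Src C \<alpha>)"
    "Tgt D (on_Cell F \<alpha>) = on_Arr F (Tgt C \<alpha>)"
  using F_Hom2[of \<alpha> "Src C \<alpha>" "Tgt C \<alpha>"] assms by (simp_all add: Hom2_iff)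

lemmas F_simps [simp] = F_Obj F_Ide F_Idc

lemma F_comp_Arr [simp]:
  "\<lbrakk>f \<in> Arr C; g \<in> Arr C; Dom C g = Cod C f\<rbrakk>
    \<Longrightarrow> on_Arr F (g \<cdot>\<^bsub>C\<^esub> f) = on_Arr F g \<cdot>\<^bsub>D\<^esub> on_Arr F f"
  by (rule F_comp) (auto simp: Hom_iff)

lemma F_vcomp_Cell [simp]:
  "\<lbrakk>\<alpha> \<in> Cell C; \<beta> \<in> Cell C; Src C \<beta> = Tgt C \<alpha>\<rbrakk>
    \<Longrightarrow> on_Cell F (\<beta> \<bullet>\<^bsub>C\<^esub> \<alpha>) = on_Cell F \<beta> \<bullet>\<^bsub>D\<^esub> on_Cell F \<alpha>"
  by (rule F_vcomp) (auto simp: Hom2_iff)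

lemma F_hcomp_Cell [simp]:
  "\<lbrakk>\<alpha> \<in> Cell C; \<beta> \<in> Cell C; Dom C (Src C \<beta>) = Cod C (Src C \<alpha>)\<rbrakk>
    \<Longrightarrow> on_Cell F (\<beta> \<star>\<^bsub>C\<^esub> \<alpha>) = on_Cell F \<beta> \<star>\<^bsub>D\<^esub> on_Cell F \<alpha>"
  by (rule F_hcomp[of "Src C \<alpha>" _ _ "Src C \<beta>"]) (auto simp: Hom_iff Hom2_iff)

end

lemma id2_simps [simp]:
  "on_Obj id2 A = A" "on_Arr id2 f = f" "on_Cell id2 \<alpha> = \<alpha>"
  by (simp_all add: id2_def)

lemma comp2_simps [simp]:
  "on_Obj (G \<otimes> F) A = on_Obj G (on_Obj F A)"
  "on_Arr (G \<otimes> F) f = on_Arr G (on_Arr F f)"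
  "on_Cell (G \<otimes> F) \<alpha> = on_Cell G (on_Cell F \<alpha>)"
  by (simp_all add: comp2_def)

lemma two_functorI:
  assumes "two_category C" "two_category D"
    and "\<And>A. A \<in> Obj C \<Longrightarrow> on_Obj F A \<in> Obj D"
    and "\<And>f. f \<in> Arr C \<Longrightarrow> on_Arr F f \<in> Arr D \<and> Dom D (on_Arr F f) = on_Obj F (Dom C f)
            \<and> Cod D (on_Arr F f) = on_Obj F (Cod C f)"
    and "\<And>\<alpha>. \<alpha> \<in> Cell C \<Longrightarrow> on_Cell F \<alpha> \<in> Cell D \<and> Src D (on_Cell F \<alpha>) = on_Arr F (Src C \<alpha>)
            \<and> Tgt D (on_Cell F \<alpha>) = on_Arr F (Tgt C \<alpha>)"
    and "\<And>A. A \<in> Obj C \<Longrightarrow> on_Arr F (Ide C A) = Ide D (on_Obj F A)"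
    and "\<And>f g. \<lbrakk>f \<in> Arr C; g \<in> Arr C; Dom C g = Cod C f\<rbrakk>
            \<Longrightarrow> on_Arr F (g \<cdot>\<^bsub>C\<^esub> f) = on_Arr F g \<cdot>\<^bsub>D\<^esub> on_Arr F f"
    and "\<And>f. f \<in> Arr C \<Longrightarrow> on_Cell F (Idc C f) = Idc D (on_Arr F f)"
    and "\<And>\<alpha> \<beta>. \<lbrakk>\<alpha> \<in> Cell C; \<beta> \<in> Cell C; Src C \<beta> = Tgt C \<alpha>\<rbrakk>
            \<Longrightarrow> on_Cell F (\<beta> \<bullet>\<^bsub>C\<^esub> \<alpha>) = on_Cell F \<beta> \<bullet>\<^bsub>D\<^esub> on_Cell F \<alpha>"
    and "\<And>\<alpha> \<beta>. \<lbrakk>\<alpha> \<in> Cell C; \<beta> \<in> Cell C; Dom C (Src C \<beta>) = Cod C (Src C \<alpha>)\<rbrakk>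
            \<Longrightarrow> on_Cell F (\<beta> \<star>\<^bsub>C\<^esub> \<alpha>) = on_Cell F \<beta> \<star>\<^bsub>D\<^esub> on_Cell F \<alpha>"
  shows "two_functor C D F"
proof -
  interpret C: two_category C by fact
  interpret D: two_category D by fact
  show ?thesis
    by unfold_locales (use assms in \<open>auto simp: Hom_iff Hom2_iff\<close>)
qed

lemma two_functor_id2: "two_category C \<Longrightarrow> two_functor C C id2"
  by (rule two_functorI) auto

lemma two_functor_comp2:
  assumes "two_functor C D F" "two_functor D E G"
  shows "two_functor C E (G \<otimes> F)"
proof -
  interpret F: two_functor C D F by fact
  interpret G: two_functor D E G by fact
  show ?thesis
    by (rule two_functorI) (simp_all add: F.C.two_category_axioms G.D.two_category_axioms)
qed

context two_natural
begin

lemma component_Arr [simp]: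
  assumes "A \<in> Obj C"
  shows "\<tau> A \<in> Arr D" "Dom D (\<tau> A) = on_Obj F A" "Cod D (\<tau> A) = on_Obj G A"
  using component[OF assms] by (simp_all add: Hom_iff)

lemma natural_Arr: "\<lbrakk>f \<in> Arr C; Cod C f = B\<rbrakk>
    \<Longrightarrow> \<tau> B \<cdot>\<^bsub>D\<^esub> on_Arr F f = on_Arr G f \<cdot>\<^bsub>D\<^esub> \<tau> (Dom C f)"
  using natural[of f "Dom C f" B] by (auto simp: Hom_iff)

lemma natural_Arr_assoc:
  assumes "f \<in> Arr C" "Cod C f = B" "h \<in> Arr D" "Cod D h = on_Obj F (Dom C f)"
  shows "\<tau> B \<cdot>\<^bsub>D\<^esub> (on_Arr F f \<cdot>\<^bsub>D\<^esub> h) = on_Arr G f \<cdot>\<^bsub>D\<^esub> (\<tau> (Dom C f) \<cdot>\<^bsub>D\<^esub> h)"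
proof -
  have "\<tau> B \<cdot>\<^bsub>D\<^esub> (on_Arr F f \<cdot>\<^bsub>D\<^esub> h) = (\<tau> B \<cdot>\<^bsub>D\<^esub> on_Arr F f) \<cdot>\<^bsub>D\<^esub> h"
    using assms by (subst F.D.comp_assoc_right) auto
  then show ?thesis
    using assms by (auto simp: natural_Arr)
qed

lemma natural_Cell: "\<lbrakk>\<alpha> \<in> Cell C; Cod C (Src C \<alpha>) = B\<rbrakk>
    \<Longrightarrow> \<tau> B \<lhd>\<^bsub>D\<^esub> on_Cell F \<alpha> = on_Cell G \<alpha> \<rhd>\<^bsub>D\<^esub> \<tau> (Dom C (Src C \<alpha>))"
  using natural2[of "Src C \<alpha>" "Dom C (Src C \<alpha>)" B \<alpha> "Tgt C \<alpha>"] by (auto simp: Hom_iff Hom2_iff)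

end

lemma two_naturalI:
  assumes "two_functor C D F" "two_functor C D G"
    and "\<And>A. A \<in> Obj C \<Longrightarrow> \<tau> A \<in> Arr D \<and> Dom D (\<tau> A) = on_Obj F A \<and> Cod D (\<tau> A) = on_Obj G A"
    and "\<And>f. f \<in> Arr C \<Longrightarrow> \<tau> (Cod C f) \<cdot>\<^bsub>D\<^esub> on_Arr F f = on_Arr G f \<cdot>\<^bsub>D\<^esub> \<tau> (Dom C f)"
    and "\<And>\<alpha>. \<alpha> \<in> Cell C \<Longrightarrow> \<tau> (Cod C (Src C \<alpha>)) \<lhd>\<^bsub>D\<^esub> on_Cell F \<alpha>
            = on_Cell G \<alpha> \<rhd>\<^bsub>D\<^esub> \<tau> (Dom C (Src C \<alpha>))"
  shows "two_natural C D F G \<tau>"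
proof -
  interpret F: two_functor C D F by fact
  interpret G: two_functor C D G by fact
  show ?thesis
    by unfold_locales (use assms in \<open>auto simp: Hom_iff Hom2_iff\<close>)
qed


section \<open>Algebras, lax morphisms and their composition\<close>

lemma is_algebra_iff: "is_algebra K T P \<longleftrightarrow>
   fst P \<in> Obj K \<and> snd P \<in> Arr K \<and> Dom K (snd P) = mObj T (fst P) \<and> Cod K (snd P) = fst P \<and>
   snd P \<cdot>\<^bsub>K\<^esub> Unit T (fst P) = Ide K (fst P) \<and>
   snd P \<cdot>\<^bsub>K\<^esub> mArr T (snd P) = snd P \<cdot>\<^bsub>K\<^esub> Mult T (fst P)"
  by (auto simp: is_algebra_def Hom_iff split: prod.splits)

lemma is_lax_mor_iff: "is_lax_mor K T m \<longleftrightarrow>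
   is_algebra K T (lm_dom m) \<and> is_algebra K T (lm_cod m) \<and>
   lm_arr m \<in> Arr K \<and> Dom K (lm_arr m) = fst (lm_dom m) \<and> Cod K (lm_arr m) = fst (lm_cod m) \<and>
   lm_cell m \<in> Cell K \<and> Src K (lm_cell m) = snd (lm_cod m) \<cdot>\<^bsub>K\<^esub> mArr T (lm_arr m) \<and>
   Tgt K (lm_cell m) = lm_arr m \<cdot>\<^bsub>K\<^esub> snd (lm_dom m) \<and>
   lm_cell m \<rhd>\<^bsub>K\<^esub> Unit T (fst (lm_dom m)) = Idc K (lm_arr m) \<and>
   lm_cell m \<rhd>\<^bsub>K\<^esub> Mult T (fst (lm_dom m))
     = (lm_cell m \<rhd>\<^bsub>K\<^esub> mArr T (snd (lm_dom m))) \<bullet>\<^bsub>K\<^esub> (snd (lm_cod m) \<lhd>\<^bsub>K\<^esub> mCell T (lm_cell m))"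
proof -
  obtain A a B b f fb where "m = LaxMor (A, a) (B, b) f fb"
    by (metis lax_mor.exhaust surj_pair)
  then show ?thesis
    by (simp only: is_lax_mor_def Hom_iff Hom2_iff lax_mor.case prod.case lax_mor.sel
        fst_conv snd_conv conj_assoc)
qed

lemma is_alg_cell_iff: "is_alg_cell K T w \<longleftrightarrow>
   is_lax_mor K T (ac_src w) \<and> is_lax_mor K T (ac_tgt w) \<and>
   lm_dom (ac_src w) = lm_dom (ac_tgt w) \<and> lm_cod (ac_src w) = lm_cod (ac_tgt w) \<and>
   ac_cell w \<in> Cell K \<and> Src K (ac_cell w) = lm_arr (ac_src w) \<and>
   Tgt K (ac_cell w) = lm_arr (ac_tgt w) \<and>
   lm_cell (ac_tgt w) \<bullet>\<^bsub>K\<^esub> (snd (lm_cod (ac_src w)) \<lhd>\<^bsub>K\<^esub> mCell T (ac_cell w))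
     = (ac_cell w \<rhd>\<^bsub>K\<^esub> snd (lm_dom (ac_src w))) \<bullet>\<^bsub>K\<^esub> lm_cell (ac_src w)"
  by (cases w) (simp only: is_alg_cell_def Hom2_iff alg_cell.case alg_cell.sel conj_assoc)

lemma lax_mor_eqI:
  "\<lbrakk>lm_dom m = lm_dom n; lm_cod m = lm_cod n; lm_arr m = lm_arr n; lm_cell m = lm_cell n\<rbrakk> \<Longrightarrow> m = n"
  by (cases m; cases n) simp

lemma alg_cell_eqI:
  "\<lbrakk>ac_src v = ac_src w; ac_tgt v = ac_tgt w; ac_cell v = ac_cell w\<rbrakk> \<Longrightarrow> v = w"
  by (cases v; cases w) simp

lemma lax_comp_sel [simp]:
  "lm_dom (lax_comp K T n m) = lm_dom m"
  "lm_cod (lax_comp K T n m) = lm_cod n"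
  "lm_arr (lax_comp K T n m) = lm_arr n \<cdot>\<^bsub>K\<^esub> lm_arr m"
  "lm_cell (lax_comp K T n m)
     = (lm_arr n \<lhd>\<^bsub>K\<^esub> lm_cell m) \<bullet>\<^bsub>K\<^esub> (lm_cell n \<rhd>\<^bsub>K\<^esub> mArr T (lm_arr m))"
  by (simp_all add: lax_comp_def)

lemma strict_mor_sel [simp]:
  "lm_dom (strict_mor K P Q f) = P"
  "lm_cod (strict_mor K P Q f) = Q"
  "lm_arr (strict_mor K P Q f) = f"
  "lm_cell (strict_mor K P Q f) = Idc K (f \<cdot>\<^bsub>K\<^esub> snd P)"
  by (simp_all add: strict_mor_def)

context two_monad
begin

text \<open>
  Orientation matters for the following rules: \<open>T \<mu>\<close> is replaced by \<open>\<mu> T\<close>, and components of \<open>\<eta>\<close> and \<open>\<mu>\<close>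
  move to the right by naturality. The algebra law replaces \<open>T a\<close> by \<open>\<mu>\<close> in the same direction, so that
  the boundaries of pasted cells reach a common normal form.
\<close>

lemmas monad_laws [simp] = unit_left unit_right mult_assoc[symmetric]

lemma mult_assoc_comp [simp]:
  assumes "A \<in> Obj K" "h \<in> Arr K" "Cod K h = mObj T (mObj T (mObj T A))"
  shows "Mult T A \<cdot>\<^bsub>K\<^esub> (mArr T (Mult T A) \<cdot>\<^bsub>K\<^esub> h) = Mult T A \<cdot>\<^bsub>K\<^esub> (Mult T (mObj T A) \<cdot>\<^bsub>K\<^esub> h)"
proof -
  have "Mult T A \<cdot>\<^bsub>K\<^esub> (mArr T (Mult T A) \<cdot>\<^bsub>K\<^esub> h) = (Mult T A \<cdot>\<^bsub>K\<^esub> mArr T (Mult T A)) \<cdot>\<^bsub>K\<^esub> h"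
    using assms by (subst eta.F.C.comp_assoc_right) simp_all
  then show ?thesis
    using assms by simp
qed

lemma unit_natural [simp]:
  "\<lbrakk>f \<in> Arr K; Cod K f = B\<rbrakk> \<Longrightarrow> Unit T B \<cdot>\<^bsub>K\<^esub> f = mArr T f \<cdot>\<^bsub>K\<^esub> Unit T (Dom K f)"
  using eta.natural_Arr[of f B] by simp

lemma mult_natural [simp]:
  "\<lbrakk>f \<in> Arr K; Cod K f = B\<rbrakk>
    \<Longrightarrow> Mult T B \<cdot>\<^bsub>K\<^esub> mArr T (mArr T f) = mArr T f \<cdot>\<^bsub>K\<^esub> Mult T (Dom K f)"
  using mu.natural_Arr[of f B] by simp

lemma mult_natural_assoc [simp]:
  "\<lbrakk>f \<in> Arr K; Cod K f = B; h \<in> Arr K; Cod K h = mObj T (mObj T (Dom K f))\<rbrakk>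
    \<Longrightarrow> Mult T B \<cdot>\<^bsub>K\<^esub> (mArr T (mArr T f) \<cdot>\<^bsub>K\<^esub> h) = mArr T f \<cdot>\<^bsub>K\<^esub> (Mult T (Dom K f) \<cdot>\<^bsub>K\<^esub> h)"
  using mu.natural_Arr_assoc[of f B h] by simp

lemma algebraD [simp]:
  assumes "is_algebra K T P"
  shows "fst P \<in> Obj K" "snd P \<in> Arr K" "Dom K (snd P) = mObj T (fst P)" "Cod K (snd P) = fst P"
    "snd P \<cdot>\<^bsub>K\<^esub> Unit T (fst P) = Ide K (fst P)"
    "snd P \<cdot>\<^bsub>K\<^esub> mArr T (snd P) = snd P \<cdot>\<^bsub>K\<^esub> Mult T (fst P)"
  using assms by (simp_all add: is_algebra_iff)

lemma algebra_assoc [simp]: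
  assumes "is_algebra K T P" "h \<in> Arr K" "Cod K h = mObj T (mObj T (fst P))"
  shows "snd P \<cdot>\<^bsub>K\<^esub> (mArr T (snd P) \<cdot>\<^bsub>K\<^esub> h) = snd P \<cdot>\<^bsub>K\<^esub> (Mult T (fst P) \<cdot>\<^bsub>K\<^esub> h)"
proof -
  have "snd P \<cdot>\<^bsub>K\<^esub> (mArr T (snd P) \<cdot>\<^bsub>K\<^esub> h) = (snd P \<cdot>\<^bsub>K\<^esub> mArr T (snd P)) \<cdot>\<^bsub>K\<^esub> h"
    using assms by (subst eta.F.C.comp_assoc_right) simp_all
  then show ?thesis
    using assms by simp
qed

lemma lax_morD [simp]:
  assumes "is_lax_mor K T m"
  shows "is_algebra K T (lm_dom m)" "is_algebra K T (lm_cod m)"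
   "lm_arr m \<in> Arr K" "Dom K (lm_arr m) = fst (lm_dom m)" "Cod K (lm_arr m) = fst (lm_cod m)"
   "lm_cell m \<in> Cell K" "Src K (lm_cell m) = snd (lm_cod m) \<cdot>\<^bsub>K\<^esub> mArr T (lm_arr m)"
   "Tgt K (lm_cell m) = lm_arr m \<cdot>\<^bsub>K\<^esub> snd (lm_dom m)"
  using assms by (simp_all add: is_lax_mor_iff)

lemma lax_mor_unit:
  "is_lax_mor K T m \<Longrightarrow> lm_cell m \<rhd>\<^bsub>K\<^esub> Unit T (fst (lm_dom m)) = Idc K (lm_arr m)"
  by (simp only: is_lax_mor_iff)

lemma lax_mor_mult:
  "is_lax_mor K T m \<Longrightarrow> lm_cell m \<rhd>\<^bsub>K\<^esub> Mult T (fst (lm_dom m))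
     = (lm_cell m \<rhd>\<^bsub>K\<^esub> mArr T (snd (lm_dom m))) \<bullet>\<^bsub>K\<^esub> (snd (lm_cod m) \<lhd>\<^bsub>K\<^esub> mCell T (lm_cell m))"
  by (simp only: is_lax_mor_iff)

lemma alg_cellD [simp]:
  assumes "is_alg_cell K T w"
  shows "is_lax_mor K T (ac_src w)" "is_lax_mor K T (ac_tgt w)"
   "lm_dom (ac_tgt w) = lm_dom (ac_src w)" "lm_cod (ac_tgt w) = lm_cod (ac_src w)"
   "ac_cell w \<in> Cell K" "Src K (ac_cell w) = lm_arr (ac_src w)"
   "Tgt K (ac_cell w) = lm_arr (ac_tgt w)"
  using assms unfolding is_alg_cell_iff by auto

lemma alg_cell_coherence:
  "is_alg_cell K T w \<Longrightarrow>
   lm_cell (ac_tgt w) \<bullet>\<^bsub>K\<^esub> (snd (lm_cod (ac_src w)) \<lhd>\<^bsub>K\<^esub> mCell T (ac_cell w))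
     = (ac_cell w \<rhd>\<^bsub>K\<^esub> snd (lm_dom (ac_src w))) \<bullet>\<^bsub>K\<^esub> lm_cell (ac_src w)"
  unfolding is_alg_cell_iff by blast

text \<open>
  For an identity 2-cell the lax laws reduce to equations between boundaries, and those follow from
  the algebra laws.
\<close>

lemma strict_mor_is_lax_mor:
  assumes "is_algebra K T P" "is_algebra K T Q"
    and "f \<in> Arr K" "Dom K f = fst P" "Cod K f = fst Q"
    and "f \<cdot>\<^bsub>K\<^esub> snd P = snd Q \<cdot>\<^bsub>K\<^esub> mArr T f"
  shows "is_lax_mor K T (strict_mor K P Q f)"
proof -
  have "Dom K (snd P) = mObj T (fst P)" "f \<cdot>\<^bsub>K\<^esub> snd P \<cdot>\<^bsub>K\<^esub> Unit T (fst P) = f"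
    using assms(1-5) by simp_all
  moreover have "(f \<cdot>\<^bsub>K\<^esub> snd P) \<cdot>\<^bsub>K\<^esub> mArr T (snd P) = (f \<cdot>\<^bsub>K\<^esub> snd P) \<cdot>\<^bsub>K\<^esub> Mult T (fst P)"
    using assms(1-5) by simp
  moreover have "snd Q \<cdot>\<^bsub>K\<^esub> mArr T (f \<cdot>\<^bsub>K\<^esub> snd P) = (f \<cdot>\<^bsub>K\<^esub> snd P) \<cdot>\<^bsub>K\<^esub> mArr T (snd P)"
  proof -
    have "snd Q \<cdot>\<^bsub>K\<^esub> mArr T (f \<cdot>\<^bsub>K\<^esub> snd P) = (snd Q \<cdot>\<^bsub>K\<^esub> mArr T f) \<cdot>\<^bsub>K\<^esub> mArr T (snd P)"
      using assms(1-5) by simp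
    then show ?thesis
      by (simp only: assms(6))
  qed
  ultimately show ?thesis
    unfolding is_lax_mor_iff strict_mor_sel
    using assms(1-5) by (simp flip: assms(6))
qed

text \<open>
  The multiplication law for \<open>g f\<close> pastes the laws for \<open>f\<close> and \<open>g\<close>. They produce the cells \<open>g b T(fb)\<close>
  and \<open>gb T(b) T(T f)\<close> in the wrong order; exchanging them turns the pasting into the composite of the
  two instances of the cell of \<open>g f\<close>.
\<close>

lemma lax_comp_is_lax_mor [simp]:
  assumes m: "is_lax_mor K T m" and n: "is_lax_mor K T n" and nm: "lm_dom n = lm_cod m"
  shows "is_lax_mor K T (lax_comp K T n m)"
proof -
  let ?A = "fst (lm_dom m)" and ?a = "snd (lm_dom m)" and ?B = "fst (lm_cod m)"
    and ?b = "snd (lm_cod m)" and ?C = "fst (lm_cod n)" and ?c = "snd (lm_cod n)"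
  let ?f = "lm_arr m" and ?fb = "lm_cell m" and ?g = "lm_arr n" and ?gb = "lm_cell n"
  note [simp] = assms
  have gD [simp]: "Dom K ?g = ?B" "Tgt K ?gb = ?g \<cdot>\<^bsub>K\<^esub> ?b"
    by (simp_all add: lax_morD(4,8)[OF n])
  have "?gb \<rhd>\<^bsub>K\<^esub> (mArr T ?f \<cdot>\<^bsub>K\<^esub> Unit T ?A) = (?gb \<rhd>\<^bsub>K\<^esub> Unit T ?B) \<rhd>\<^bsub>K\<^esub> ?f"
    by simp
  also have "\<dots> = Idc K (?g \<cdot>\<^bsub>K\<^esub> ?f)"
    using lax_mor_unit[OF n] by simp
  finally have unit: "((?g \<lhd>\<^bsub>K\<^esub> ?fb) \<bullet>\<^bsub>K\<^esub> (?gb \<rhd>\<^bsub>K\<^esub> mArr T ?f)) \<rhd>\<^bsub>K\<^esub> Unit T ?A = Idc K (?g \<cdot>\<^bsub>K\<^esub> ?f)"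
    using lax_mor_unit[OF m] by simp
  have "?gb \<rhd>\<^bsub>K\<^esub> (mArr T ?f \<cdot>\<^bsub>K\<^esub> Mult T ?A) = (?gb \<rhd>\<^bsub>K\<^esub> Mult T ?B) \<rhd>\<^bsub>K\<^esub> mArr T (mArr T ?f)"
    by simp
  also have "\<dots> = (?gb \<rhd>\<^bsub>K\<^esub> mArr T (?b \<cdot>\<^bsub>K\<^esub> mArr T ?f)) \<bullet>\<^bsub>K\<^esub> (?c \<lhd>\<^bsub>K\<^esub> mCell T (?gb \<rhd>\<^bsub>K\<^esub> mArr T ?f))"
    using lax_mor_mult[OF n] by simp
  finally have g: "?gb \<rhd>\<^bsub>K\<^esub> (mArr T ?f \<cdot>\<^bsub>K\<^esub> Mult T ?A)
      = (?gb \<rhd>\<^bsub>K\<^esub> mArr T (?b \<cdot>\<^bsub>K\<^esub> mArr T ?f)) \<bullet>\<^bsub>K\<^esub> (?c \<lhd>\<^bsub>K\<^esub> mCell T (?gb \<rhd>\<^bsub>K\<^esub> mArr T ?f))" .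
  have "((?g \<lhd>\<^bsub>K\<^esub> ?fb) \<bullet>\<^bsub>K\<^esub> (?gb \<rhd>\<^bsub>K\<^esub> mArr T ?f)) \<rhd>\<^bsub>K\<^esub> Mult T ?A
      = (?g \<lhd>\<^bsub>K\<^esub> (?fb \<rhd>\<^bsub>K\<^esub> Mult T ?A)) \<bullet>\<^bsub>K\<^esub> (?gb \<rhd>\<^bsub>K\<^esub> (mArr T ?f \<cdot>\<^bsub>K\<^esub> Mult T ?A))"
    by simp
  also have "\<dots> = (?g \<lhd>\<^bsub>K\<^esub> (?fb \<rhd>\<^bsub>K\<^esub> mArr T ?a)) \<bullet>\<^bsub>K\<^esub> (((?g \<cdot>\<^bsub>K\<^esub> ?b) \<lhd>\<^bsub>K\<^esub> mCell T ?fb) \<bullet>\<^bsub>K\<^esub>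
       ((?gb \<rhd>\<^bsub>K\<^esub> mArr T (?b \<cdot>\<^bsub>K\<^esub> mArr T ?f)) \<bullet>\<^bsub>K\<^esub> (?c \<lhd>\<^bsub>K\<^esub> mCell T (?gb \<rhd>\<^bsub>K\<^esub> mArr T ?f))))"
    unfolding g lax_mor_mult[OF m] by simp
  \<comment> \<open>exchange \<open>fb\<close> and \<open>gb\<close>; this is the horizontal composite \<open>gb \<star> T(fb)\<close> decomposed in two ways\<close>
  also have "((?g \<cdot>\<^bsub>K\<^esub> ?b) \<lhd>\<^bsub>K\<^esub> mCell T ?fb) \<bullet>\<^bsub>K\<^esub>
       ((?gb \<rhd>\<^bsub>K\<^esub> mArr T (?b \<cdot>\<^bsub>K\<^esub> mArr T ?f)) \<bullet>\<^bsub>K\<^esub> (?c \<lhd>\<^bsub>K\<^esub> mCell T (?gb \<rhd>\<^bsub>K\<^esub> mArr T ?f)))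
     = (?gb \<rhd>\<^bsub>K\<^esub> mArr T (?f \<cdot>\<^bsub>K\<^esub> ?a)) \<bullet>\<^bsub>K\<^esub> (((?c \<cdot>\<^bsub>K\<^esub> mArr T ?g) \<lhd>\<^bsub>K\<^esub> mCell T ?fb)
        \<bullet>\<^bsub>K\<^esub> (?c \<lhd>\<^bsub>K\<^esub> mCell T (?gb \<rhd>\<^bsub>K\<^esub> mArr T ?f)))"
    using eta.F.C.middle_exchange_assoc[of "mCell T ?fb" ?gb "?c \<lhd>\<^bsub>K\<^esub> mCell T (?gb \<rhd>\<^bsub>K\<^esub> mArr T ?f)"]
    by simp
  also have "(?g \<lhd>\<^bsub>K\<^esub> (?fb \<rhd>\<^bsub>K\<^esub> mArr T ?a)) \<bullet>\<^bsub>K\<^esub> \<dots> =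
     (((?g \<lhd>\<^bsub>K\<^esub> ?fb) \<bullet>\<^bsub>K\<^esub> (?gb \<rhd>\<^bsub>K\<^esub> mArr T ?f)) \<rhd>\<^bsub>K\<^esub> mArr T ?a)
     \<bullet>\<^bsub>K\<^esub> (?c \<lhd>\<^bsub>K\<^esub> mCell T ((?g \<lhd>\<^bsub>K\<^esub> ?fb) \<bullet>\<^bsub>K\<^esub> (?gb \<rhd>\<^bsub>K\<^esub> mArr T ?f)))"
    by simp
  finally have mult: "((?g \<lhd>\<^bsub>K\<^esub> ?fb) \<bullet>\<^bsub>K\<^esub> (?gb \<rhd>\<^bsub>K\<^esub> mArr T ?f)) \<rhd>\<^bsub>K\<^esub> Mult T ?A =
     (((?g \<lhd>\<^bsub>K\<^esub> ?fb) \<bullet>\<^bsub>K\<^esub> (?gb \<rhd>\<^bsub>K\<^esub> mArr T ?f)) \<rhd>\<^bsub>K\<^esub> mArr T ?a)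
     \<bullet>\<^bsub>K\<^esub> (?c \<lhd>\<^bsub>K\<^esub> mCell T ((?g \<lhd>\<^bsub>K\<^esub> ?fb) \<bullet>\<^bsub>K\<^esub> (?gb \<rhd>\<^bsub>K\<^esub> mArr T ?f)))" .
  show ?thesis
    unfolding is_lax_mor_iff lax_comp_sel
    by (intro conjI unit mult) simp_all
qed

end


section \<open>The 2-categories of algebras\<close>

lemma Alg_l_sel [simp]:
  "P \<in> Obj (Alg_l K T) \<longleftrightarrow> is_algebra K T P"
  "m \<in> Arr (Alg_l K T) \<longleftrightarrow> is_lax_mor K T m"
  "w \<in> Cell (Alg_l K T) \<longleftrightarrow> is_alg_cell K T w"
  "Dom (Alg_l K T) = lm_dom" "Cod (Alg_l K T) = lm_cod"
  "Src (Alg_l K T) = ac_src" "Tgt (Alg_l K T) = ac_tgt"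
  "Ide (Alg_l K T) P = strict_mor K P P (Ide K (fst P))"
  "Idc (Alg_l K T) m = AlgCell m m (Idc K (lm_arr m))"
  "n \<cdot>\<^bsub>Alg_l K T\<^esub> m = lax_comp K T n m"
  "v \<star>\<^bsub>Alg_l K T\<^esub> w = AlgCell (lax_comp K T (ac_src v) (ac_src w)) (lax_comp K T (ac_tgt v) (ac_tgt w))
       (ac_cell v \<star>\<^bsub>K\<^esub> ac_cell w)"
  "v \<bullet>\<^bsub>Alg_l K T\<^esub> w = AlgCell (ac_src w) (ac_tgt v) (ac_cell v \<bullet>\<^bsub>K\<^esub> ac_cell w)"
  by (simp_all add: Alg_l_def)

lemma Alg_s_sel [simp]:
  "P \<in> Obj (Alg_s K T) \<longleftrightarrow> is_algebra K T P"
  "m \<in> Arr (Alg_s K T) \<longleftrightarrow> is_lax_mor K T m \<and> is_strict K m"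
  "w \<in> Cell (Alg_s K T) \<longleftrightarrow> is_alg_cell K T w \<and> is_strict K (ac_src w) \<and> is_strict K (ac_tgt w)"
  "Dom (Alg_s K T) = lm_dom" "Cod (Alg_s K T) = lm_cod"
  "Src (Alg_s K T) = ac_src" "Tgt (Alg_s K T) = ac_tgt"
  "Ide (Alg_s K T) P = strict_mor K P P (Ide K (fst P))"
  "Idc (Alg_s K T) m = AlgCell m m (Idc K (lm_arr m))"
  "n \<cdot>\<^bsub>Alg_s K T\<^esub> m = lax_comp K T n m"
  "v \<star>\<^bsub>Alg_s K T\<^esub> w = AlgCell (lax_comp K T (ac_src v) (ac_src w)) (lax_comp K T (ac_tgt v) (ac_tgt w))
       (ac_cell v \<star>\<^bsub>K\<^esub> ac_cell w)"
  "v \<bullet>\<^bsub>Alg_s K T\<^esub> w = AlgCell (ac_src w) (ac_tgt v) (ac_cell v \<bullet>\<^bsub>K\<^esub> ac_cell w)"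
  by (simp_all add: Alg_s_def Alg_l_def)

lemma two_categoryI:
  assumes "\<And>f. f \<in> Arr C \<Longrightarrow> Dom C f \<in> Obj C \<and> Cod C f \<in> Obj C"
    and "\<And>\<alpha>. \<alpha> \<in> Cell C \<Longrightarrow> Src C \<alpha> \<in> Arr C \<and> Tgt C \<alpha> \<in> Arr C
          \<and> Dom C (Tgt C \<alpha>) = Dom C (Src C \<alpha>) \<and> Cod C (Tgt C \<alpha>) = Cod C (Src C \<alpha>)"
    and "\<And>A. A \<in> Obj C \<Longrightarrow> Ide C A \<in> Arr C \<and> Dom C (Ide C A) = A \<and> Cod C (Ide C A) = A"
    and "\<And>f g. \<lbrakk>f \<in> Arr C; g \<in> Arr C; Dom C g = Cod C f\<rbrakk> \<Longrightarrow> g \<cdot>\<^bsub>C\<^esub> f \<in> Arr C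
          \<and> Dom C (g \<cdot>\<^bsub>C\<^esub> f) = Dom C f \<and> Cod C (g \<cdot>\<^bsub>C\<^esub> f) = Cod C g"
    and "\<And>f. f \<in> Arr C \<Longrightarrow> Ide C (Cod C f) \<cdot>\<^bsub>C\<^esub> f = f \<and> f \<cdot>\<^bsub>C\<^esub> Ide C (Dom C f) = f"
    and "\<And>f g h. \<lbrakk>f \<in> Arr C; g \<in> Arr C; h \<in> Arr C; Dom C g = Cod C f; Dom C h = Cod C g\<rbrakk>
          \<Longrightarrow> (h \<cdot>\<^bsub>C\<^esub> g) \<cdot>\<^bsub>C\<^esub> f = h \<cdot>\<^bsub>C\<^esub> (g \<cdot>\<^bsub>C\<^esub> f)"
    and "\<And>f. f \<in> Arr C \<Longrightarrow> Idc C f \<in> Cell C \<and> Src C (Idc C f) = f \<and> Tgt C (Idc C f) = f"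
    and "\<And>\<alpha> \<beta>. \<lbrakk>\<alpha> \<in> Cell C; \<beta> \<in> Cell C; Src C \<beta> = Tgt C \<alpha>\<rbrakk> \<Longrightarrow> \<beta> \<bullet>\<^bsub>C\<^esub> \<alpha> \<in> Cell C
          \<and> Src C (\<beta> \<bullet>\<^bsub>C\<^esub> \<alpha>) = Src C \<alpha> \<and> Tgt C (\<beta> \<bullet>\<^bsub>C\<^esub> \<alpha>) = Tgt C \<beta>"
    and "\<And>\<alpha>. \<alpha> \<in> Cell C \<Longrightarrow> Idc C (Tgt C \<alpha>) \<bullet>\<^bsub>C\<^esub> \<alpha> = \<alpha> \<and> \<alpha> \<bullet>\<^bsub>C\<^esub> Idc C (Src C \<alpha>) = \<alpha>"
    and "\<And>\<alpha> \<beta> \<gamma>. \<lbrakk>\<alpha> \<in> Cell C; \<beta> \<in> Cell C; \<gamma> \<in> Cell C; Src C \<beta> = Tgt C \<alpha>; Src C \<gamma> = Tgt C \<beta>\<rbrakk>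
          \<Longrightarrow> (\<gamma> \<bullet>\<^bsub>C\<^esub> \<beta>) \<bullet>\<^bsub>C\<^esub> \<alpha> = \<gamma> \<bullet>\<^bsub>C\<^esub> (\<beta> \<bullet>\<^bsub>C\<^esub> \<alpha>)"
    and "\<And>\<alpha> \<beta>. \<lbrakk>\<alpha> \<in> Cell C; \<beta> \<in> Cell C; Dom C (Src C \<beta>) = Cod C (Src C \<alpha>)\<rbrakk> \<Longrightarrow> \<beta> \<star>\<^bsub>C\<^esub> \<alpha> \<in> Cell C
          \<and> Src C (\<beta> \<star>\<^bsub>C\<^esub> \<alpha>) = Src C \<beta> \<cdot>\<^bsub>C\<^esub> Src C \<alpha> \<and> Tgt C (\<beta> \<star>\<^bsub>C\<^esub> \<alpha>) = Tgt C \<beta> \<cdot>\<^bsub>C\<^esub> Tgt C \<alpha>"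
    and "\<And>\<alpha>. \<alpha> \<in> Cell C \<Longrightarrow> Ide C (Cod C (Src C \<alpha>)) \<lhd>\<^bsub>C\<^esub> \<alpha> = \<alpha> \<and> \<alpha> \<rhd>\<^bsub>C\<^esub> Ide C (Dom C (Src C \<alpha>)) = \<alpha>"
    and "\<And>\<alpha> \<beta> \<gamma>. \<lbrakk>\<alpha> \<in> Cell C; \<beta> \<in> Cell C; \<gamma> \<in> Cell C; Dom C (Src C \<beta>) = Cod C (Src C \<alpha>);
            Dom C (Src C \<gamma>) = Cod C (Src C \<beta>)\<rbrakk> \<Longrightarrow> (\<gamma> \<star>\<^bsub>C\<^esub> \<beta>) \<star>\<^bsub>C\<^esub> \<alpha> = \<gamma> \<star>\<^bsub>C\<^esub> (\<beta> \<star>\<^bsub>C\<^esub> \<alpha>)"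
    and "\<And>f g. \<lbrakk>f \<in> Arr C; g \<in> Arr C; Dom C g = Cod C f\<rbrakk> \<Longrightarrow> Idc C g \<star>\<^bsub>C\<^esub> Idc C f = Idc C (g \<cdot>\<^bsub>C\<^esub> f)"
    and "\<And>\<alpha> \<alpha>' \<beta> \<beta>'. \<lbrakk>\<alpha> \<in> Cell C; \<alpha>' \<in> Cell C; \<beta> \<in> Cell C; \<beta>' \<in> Cell C;
            Src C \<alpha>' = Tgt C \<alpha>; Src C \<beta>' = Tgt C \<beta>; Dom C (Src C \<beta>) = Cod C (Src C \<alpha>)\<rbrakk>
          \<Longrightarrow> (\<beta>' \<bullet>\<^bsub>C\<^esub> \<beta>) \<star>\<^bsub>C\<^esub> (\<alpha>' \<bullet>\<^bsub>C\<^esub> \<alpha>) = (\<beta>' \<star>\<^bsub>C\<^esub> \<alpha>') \<bullet>\<^bsub>C\<^esub> (\<beta> \<star>\<^bsub>C\<^esub> \<alpha>)"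
  shows "two_category C"
  by unfold_locales (use assms in \<open>auto simp: Hom_iff Hom2_iff\<close>)

context two_monad
begin

lemma Ide_is_lax_mor [simp]: "is_algebra K T P \<Longrightarrow> is_lax_mor K T (strict_mor K P P (Ide K (fst P)))"
  by (rule strict_mor_is_lax_mor) simp_all

lemma Idc_is_alg_cell [simp]: "is_lax_mor K T m \<Longrightarrow> is_alg_cell K T (AlgCell m m (Idc K (lm_arr m)))"
  unfolding is_alg_cell_iff by simp

lemma vcomp_is_alg_cell [simp]:
  assumes v: "is_alg_cell K T v" and w: "is_alg_cell K T w" and vw: "ac_src v = ac_tgt w"
  shows "is_alg_cell K T (AlgCell (ac_src w) (ac_tgt v) (ac_cell v \<bullet>\<^bsub>K\<^esub> ac_cell w))"
proof -
  note [simp] = assms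
  have vD [simp]: "Src K (ac_cell v) = lm_arr (ac_tgt w)"
    "lm_dom (ac_tgt v) = lm_dom (ac_src w)" "lm_cod (ac_tgt v) = lm_cod (ac_src w)"
    using alg_cellD[OF v] by simp_all
  let ?a = "snd (lm_dom (ac_src w))" and ?b = "snd (lm_cod (ac_src w))"
  let ?\<phi> = "ac_cell w" and ?\<psi> = "ac_cell v"
  have "lm_cell (ac_tgt v) \<bullet>\<^bsub>K\<^esub> (?b \<lhd>\<^bsub>K\<^esub> mCell T (?\<psi> \<bullet>\<^bsub>K\<^esub> ?\<phi>))
      = (lm_cell (ac_tgt v) \<bullet>\<^bsub>K\<^esub> (?b \<lhd>\<^bsub>K\<^esub> mCell T ?\<psi>)) \<bullet>\<^bsub>K\<^esub> (?b \<lhd>\<^bsub>K\<^esub> mCell T ?\<phi>)"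
    by simp
  also have "\<dots> = (?\<psi> \<rhd>\<^bsub>K\<^esub> ?a) \<bullet>\<^bsub>K\<^esub> (lm_cell (ac_tgt w) \<bullet>\<^bsub>K\<^esub> (?b \<lhd>\<^bsub>K\<^esub> mCell T ?\<phi>))"
    using alg_cell_coherence[OF v] by simp
  also have "\<dots> = ((?\<psi> \<bullet>\<^bsub>K\<^esub> ?\<phi>) \<rhd>\<^bsub>K\<^esub> ?a) \<bullet>\<^bsub>K\<^esub> lm_cell (ac_src w)"
    using alg_cell_coherence[OF w] by simp
  finally show ?thesis
    unfolding is_alg_cell_iff by simp
qed

text \<open>
  The coherence squares of \<open>\<psi>\<close> and \<open>\<phi>\<close> are glued along \<open>\<psi> \<star> b T(\<phi>)\<close>: interchange lets first the
  square of \<open>\<psi>\<close> and then that of \<open>\<phi>\<close> be pulled across the lax structure cells.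
\<close>

lemma hcomp_is_alg_cell [simp]:
  assumes v: "is_alg_cell K T v" and w: "is_alg_cell K T w"
    and vw: "lm_dom (ac_src v) = lm_cod (ac_src w)"
  shows "is_alg_cell K T (AlgCell (lax_comp K T (ac_src v) (ac_src w)) (lax_comp K T (ac_tgt v) (ac_tgt w))
       (ac_cell v \<star>\<^bsub>K\<^esub> ac_cell w))"
proof -
  note [simp] = assms
  let ?a = "snd (lm_dom (ac_src w))" and ?b = "snd (lm_cod (ac_src w))"
    and ?c = "snd (lm_cod (ac_src v))"
  let ?\<phi> = "ac_cell w" and ?\<psi> = "ac_cell v"
  let ?f = "lm_arr (ac_src w)" and ?fb = "lm_cell (ac_src w)"
    and ?f' = "lm_arr (ac_tgt w)" and ?fb' = "lm_cell (ac_tgt w)"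
    and ?g = "lm_arr (ac_src v)" and ?gb = "lm_cell (ac_src v)"
    and ?g' = "lm_arr (ac_tgt v)" and ?gb' = "lm_cell (ac_tgt v)"
  have [simp]: "Tgt K ?gb = ?g \<cdot>\<^bsub>K\<^esub> ?b" "Tgt K ?gb' = ?g' \<cdot>\<^bsub>K\<^esub> ?b" "Dom K ?g = fst (lm_cod (ac_src w))"
     "Dom K ?g' = fst (lm_cod (ac_src w))"
    by (simp_all add: lax_morD(4,8)[OF alg_cellD(1)[OF v]] lax_morD(4,8)[OF alg_cellD(2)[OF v]])
  have "(?gb' \<rhd>\<^bsub>K\<^esub> mArr T ?f') \<bullet>\<^bsub>K\<^esub> ((?c \<lhd>\<^bsub>K\<^esub> mCell T ?\<psi>) \<star>\<^bsub>K\<^esub> mCell T ?\<phi>)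
      = (?gb' \<bullet>\<^bsub>K\<^esub> (?c \<lhd>\<^bsub>K\<^esub> mCell T ?\<psi>)) \<star>\<^bsub>K\<^esub> (Idc K (mArr T ?f') \<bullet>\<^bsub>K\<^esub> mCell T ?\<phi>)"
    by (rule eta.F.C.hcomp_vcomp[symmetric]) simp_all
  also have "\<dots> = ((?\<psi> \<rhd>\<^bsub>K\<^esub> ?b) \<bullet>\<^bsub>K\<^esub> ?gb) \<star>\<^bsub>K\<^esub> (mCell T ?\<phi> \<bullet>\<^bsub>K\<^esub> Idc K (mArr T ?f))"
    using alg_cell_coherence[OF v] by simp
  also have "\<dots> = ((?\<psi> \<rhd>\<^bsub>K\<^esub> ?b) \<star>\<^bsub>K\<^esub> mCell T ?\<phi>) \<bullet>\<^bsub>K\<^esub> (?gb \<rhd>\<^bsub>K\<^esub> mArr T ?f)"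
    by (rule eta.F.C.hcomp_vcomp) simp_all
  finally have upper: "(?gb' \<rhd>\<^bsub>K\<^esub> mArr T ?f') \<bullet>\<^bsub>K\<^esub> ((?c \<lhd>\<^bsub>K\<^esub> mCell T ?\<psi>) \<star>\<^bsub>K\<^esub> mCell T ?\<phi>)
    = ((?\<psi> \<rhd>\<^bsub>K\<^esub> ?b) \<star>\<^bsub>K\<^esub> mCell T ?\<phi>) \<bullet>\<^bsub>K\<^esub> (?gb \<rhd>\<^bsub>K\<^esub> mArr T ?f)" .
  have "(?g' \<lhd>\<^bsub>K\<^esub> ?fb') \<bullet>\<^bsub>K\<^esub> (?\<psi> \<star>\<^bsub>K\<^esub> (?b \<lhd>\<^bsub>K\<^esub> mCell T ?\<phi>))
      = (Idc K ?g' \<bullet>\<^bsub>K\<^esub> ?\<psi>) \<star>\<^bsub>K\<^esub> (?fb' \<bullet>\<^bsub>K\<^esub> (?b \<lhd>\<^bsub>K\<^esub> mCell T ?\<phi>))"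
    by (rule eta.F.C.hcomp_vcomp[symmetric]) simp_all
  also have "\<dots> = (?\<psi> \<bullet>\<^bsub>K\<^esub> Idc K ?g) \<star>\<^bsub>K\<^esub> ((?\<phi> \<rhd>\<^bsub>K\<^esub> ?a) \<bullet>\<^bsub>K\<^esub> ?fb)"
    using alg_cell_coherence[OF w] by simp
  also have "\<dots> = (?\<psi> \<star>\<^bsub>K\<^esub> (?\<phi> \<rhd>\<^bsub>K\<^esub> ?a)) \<bullet>\<^bsub>K\<^esub> (?g \<lhd>\<^bsub>K\<^esub> ?fb)"
    by (rule eta.F.C.hcomp_vcomp) simp_all
  finally have lower: "(?g' \<lhd>\<^bsub>K\<^esub> ?fb') \<bullet>\<^bsub>K\<^esub> (?\<psi> \<star>\<^bsub>K\<^esub> (?b \<lhd>\<^bsub>K\<^esub> mCell T ?\<phi>))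
      = (?\<psi> \<star>\<^bsub>K\<^esub> (?\<phi> \<rhd>\<^bsub>K\<^esub> ?a)) \<bullet>\<^bsub>K\<^esub> (?g \<lhd>\<^bsub>K\<^esub> ?fb)" .
  have "((?g' \<lhd>\<^bsub>K\<^esub> ?fb') \<bullet>\<^bsub>K\<^esub> (?gb' \<rhd>\<^bsub>K\<^esub> mArr T ?f')) \<bullet>\<^bsub>K\<^esub> (?c \<lhd>\<^bsub>K\<^esub> mCell T (?\<psi> \<star>\<^bsub>K\<^esub> ?\<phi>))
      = (?g' \<lhd>\<^bsub>K\<^esub> ?fb') \<bullet>\<^bsub>K\<^esub> ((?gb' \<rhd>\<^bsub>K\<^esub> mArr T ?f') \<bullet>\<^bsub>K\<^esub> ((?c \<lhd>\<^bsub>K\<^esub> mCell T ?\<psi>) \<star>\<^bsub>K\<^esub> mCell T ?\<phi>))"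
    by simp
  also have "\<dots> = ((?g' \<lhd>\<^bsub>K\<^esub> ?fb') \<bullet>\<^bsub>K\<^esub> (?\<psi> \<star>\<^bsub>K\<^esub> (?b \<lhd>\<^bsub>K\<^esub> mCell T ?\<phi>))) \<bullet>\<^bsub>K\<^esub> (?gb \<rhd>\<^bsub>K\<^esub> mArr T ?f)"
    unfolding upper by simp
  also have "\<dots> = ((?\<psi> \<star>\<^bsub>K\<^esub> ?\<phi>) \<rhd>\<^bsub>K\<^esub> ?a) \<bullet>\<^bsub>K\<^esub> ((?g \<lhd>\<^bsub>K\<^esub> ?fb) \<bullet>\<^bsub>K\<^esub> (?gb \<rhd>\<^bsub>K\<^esub> mArr T ?f))"
    unfolding lower by simp
  finally show ?thesis
    unfolding is_alg_cell_iff alg_cell.sel lax_comp_sel by (intro conjI) simp_all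
qed

lemma two_category_Alg_l: "two_category (Alg_l K T)"
proof (rule two_categoryI, goal_cases)
  case (6 f g h)
  then have [simp]: "Dom K (lm_arr g) = fst (lm_cod f)" "Dom K (lm_arr h) = fst (lm_cod g)"
    "Tgt K (lm_cell g) = lm_arr g \<cdot>\<^bsub>K\<^esub> snd (lm_cod f)"
    "Tgt K (lm_cell h) = lm_arr h \<cdot>\<^bsub>K\<^esub> snd (lm_cod g)"
    using lax_morD(4,8)[of g] lax_morD(4,8)[of h] by simp_all
  show ?case
    using 6 by (intro lax_mor_eqI) simp_all
next
  case (12 w)
  then show ?case
    by (auto intro!: alg_cell_eqI lax_mor_eqI)
next
  case (14 f g)
  then have "Dom K (lm_arr g) = fst (lm_cod f)"
    using lax_morD(4)[of g] by simp
  then show ?case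
    using 14 by (simp)
next
  case (13 u v w)
  then have u [simp]: "Dom K (lm_arr (ac_src v)) = fst (lm_cod (ac_src u))"
      "Dom K (lm_arr (ac_src w)) = fst (lm_cod (ac_src v))"
      "Tgt K (lm_cell (ac_src v)) = lm_arr (ac_src v) \<cdot>\<^bsub>K\<^esub> snd (lm_cod (ac_src u))"
      "Tgt K (lm_cell (ac_src w)) = lm_arr (ac_src w) \<cdot>\<^bsub>K\<^esub> snd (lm_cod (ac_src v))"
      "Dom K (lm_arr (ac_tgt v)) = fst (lm_cod (ac_src u))"
      "Dom K (lm_arr (ac_tgt w)) = fst (lm_cod (ac_src v))"
      "Tgt K (lm_cell (ac_tgt v)) = lm_arr (ac_tgt v) \<cdot>\<^bsub>K\<^esub> snd (lm_cod (ac_src u))"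
      "Tgt K (lm_cell (ac_tgt w)) = lm_arr (ac_tgt w) \<cdot>\<^bsub>K\<^esub> snd (lm_cod (ac_src v))"
    using lax_morD(4,8)[of "ac_src v"] lax_morD(4,8)[of "ac_src w"]
      lax_morD(4,8)[of "ac_tgt v"] lax_morD(4,8)[of "ac_tgt w"] by simp_all
  show ?case
    using 13 by (auto intro!: alg_cell_eqI lax_mor_eqI)
next
  case (15 u u' v v')
  then have "Dom K (lm_arr (ac_src v)) = fst (lm_cod (ac_src u))"
    using lax_morD(4,8)[of "ac_src v"] by simp
  then show ?case
    using 15 by (auto intro!: alg_cell_eqI eta.F.C.hcomp_vcomp)
qed (auto intro!: lax_mor_eqI alg_cell_eqI)

text \<open>
  An identity 2-cell is the identity of its target \<open>f a\<close>, so a strict morphism is determined by its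
  underlying 1-cell.
\<close>

lemma strict_iff:
  assumes "is_lax_mor K T m"
  shows "is_strict K m \<longleftrightarrow> m = strict_mor K (lm_dom m) (lm_cod m) (lm_arr m)"
proof
  assume "is_strict K m"
  then obtain h where h: "h \<in> Arr K" "lm_cell m = Idc K h"
    by (auto simp: is_strict_def)
  then have "h = lm_arr m \<cdot>\<^bsub>K\<^esub> snd (lm_dom m)"
    using lax_morD(8)[OF assms] by simp
  with h show "m = strict_mor K (lm_dom m) (lm_cod m) (lm_arr m)"
    by (intro lax_mor_eqI) simp_all
next
  assume m: "m = strict_mor K (lm_dom m) (lm_cod m) (lm_arr m)"
  have "lm_arr m \<cdot>\<^bsub>K\<^esub> snd (lm_dom m) \<in> Arr K"
    using assms by simp
  moreover have "lm_cell m = Idc K (lm_arr m \<cdot>\<^bsub>K\<^esub> snd (lm_dom m))"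
    by (subst m) simp
  ultimately show "is_strict K m"
    by (auto simp: is_strict_def)
qed

lemma strictD [simp]:
  assumes "is_lax_mor K T m" "is_strict K m"
  shows "lm_cell m = Idc K (lm_arr m \<cdot>\<^bsub>K\<^esub> snd (lm_dom m))"
    "snd (lm_cod m) \<cdot>\<^bsub>K\<^esub> mArr T (lm_arr m) = lm_arr m \<cdot>\<^bsub>K\<^esub> snd (lm_dom m)"
proof -
  show c: "lm_cell m = Idc K (lm_arr m \<cdot>\<^bsub>K\<^esub> snd (lm_dom m))"
    using assms strict_iff strict_mor_sel(4) by metis
  show "snd (lm_cod m) \<cdot>\<^bsub>K\<^esub> mArr T (lm_arr m) = lm_arr m \<cdot>\<^bsub>K\<^esub> snd (lm_dom m)"
    using assms(1) lax_morD(7)[OF assms(1)] unfolding c by simp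
qed

lemma strict_mor_is_strict [simp]:
  "\<lbrakk>is_algebra K T P; f \<in> Arr K; Dom K f = fst P\<rbrakk> \<Longrightarrow> is_strict K (strict_mor K P Q f)"
  unfolding is_strict_def by (rule bexI[of _ "f \<cdot>\<^bsub>K\<^esub> snd P"]) simp_all

lemma lax_comp_strict:
  assumes "is_lax_mor K T m" "is_lax_mor K T n" "lm_dom n = lm_cod m" "is_strict K m" "is_strict K n"
  shows "lax_comp K T n m = strict_mor K (lm_dom m) (lm_cod n) (lm_arr n \<cdot>\<^bsub>K\<^esub> lm_arr m)"
proof -
  have [simp]: "Dom K (lm_arr n) = fst (lm_cod m)" 
    "snd (lm_cod n) \<cdot>\<^bsub>K\<^esub> mArr T (lm_arr n) = lm_arr n \<cdot>\<^bsub>K\<^esub> snd (lm_cod m)"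
    using lax_morD(4)[of n] strictD[of n] assms by simp_all
  show ?thesis
    using assms by (intro lax_mor_eqI) simp_all
qed

lemma lax_comp_is_strict [simp]:
  assumes "is_lax_mor K T m" "is_lax_mor K T n" "lm_dom n = lm_cod m" "is_strict K m" "is_strict K n"
  shows "is_strict K (lax_comp K T n m)"
  using lax_comp_strict[OF assms] lax_morD(4)[of n] assms by simp

text \<open>Strict morphisms are closed under composition, so the axioms are inherited.\<close>

lemma two_category_Alg_s: "two_category (Alg_s K T)"
proof -
  interpret A: two_category "Alg_l K T" by (rule two_category_Alg_l)
  show ?thesis
  proof (rule two_categoryI, goal_cases)
    case (5 f)
    then show ?case using A.Ide_comp[of f] A.comp_Ide[of f] by simp
  next
    case (6 f g h)
    then show ?case using A.comp_assoc_right[of f g h] by simp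
  next
    case (9 w)
    then show ?case using A.Idc_vcomp[of w] A.vcomp_Idc[of w] by simp
  next
    case (10 u v w)
    then show ?case using A.vcomp_assoc_right[of u v w] by simp
  next
    case (12 w)
    then show ?case using A.Ide_hcomp[of w] A.hcomp_Ide[of w] by simp
  next
    case (13 u v w)
    then show ?case using A.hcomp_assoc_right[of u v w] by simp
  next
    case (14 f g)
    then show ?case using A.Idc_hcomp_Idc[of f g] by simp
  next
    case (15 u u' v v')
    then show ?case using A.hcomp_vcomp[of u u' v v'] by simp
  qed auto
qed

end


section \<open>Left 2-adjoints from universal arrows\<close>

text \<open>
  Equivalently, for every \<open>Z\<close> the functor \<open>D(Q, Z) \<rightarrow> C(X, G Z)\<close> given by \<open>f \<mapsto> G(f) u\<close> is an isomorphism
  of categories: the third conjunct is bijectivity on objects, the fourth is full faithfulness.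
\<close>

definition universal_2arrow :: "('o, 'm, 'c) twocat \<Rightarrow> ('p, 'n, 'd) twocat
    \<Rightarrow> ('p, 'n, 'd, 'o, 'm, 'c) twofun \<Rightarrow> 'o \<Rightarrow> 'p \<Rightarrow> 'm \<Rightarrow> bool" where
  "universal_2arrow C D G X Q u \<longleftrightarrow> Q \<in> Obj D \<and> u \<in> Hom C X (on_Obj G Q) \<and>
     (\<forall>Z \<in> Obj D. \<forall>g \<in> Hom C X (on_Obj G Z). \<exists>!f. f \<in> Hom D Q Z \<and> on_Arr G f \<cdot>\<^bsub>C\<^esub> u = g) \<and>
     (\<forall>Z \<in> Obj D. \<forall>f \<in> Hom D Q Z. \<forall>f' \<in> Hom D Q Z.
        \<forall>\<phi> \<in> Hom2 C (on_Arr G f \<cdot>\<^bsub>C\<^esub> u) (on_Arr G f' \<cdot>\<^bsub>C\<^esub> u).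
          \<exists>!\<psi>. \<psi> \<in> Hom2 D f f' \<and> on_Cell G \<psi> \<rhd>\<^bsub>C\<^esub> u = \<phi>)"

locale universal_2arrows = G: two_functor D C G
  for C :: "('o, 'm, 'c) twocat" and D :: "('p, 'n, 'd) twocat"
    and G :: "('p, 'n, 'd, 'o, 'm, 'c) twofun" +
  fixes Q :: "'o \<Rightarrow> 'p" and u :: "'o \<Rightarrow> 'm"
  assumes universal: "X \<in> Obj C \<Longrightarrow> universal_2arrow C D G X (Q X) (u X)"
begin

definition extend :: "'o \<Rightarrow> 'p \<Rightarrow> 'm \<Rightarrow> 'n" where
  "extend X Z g = (THE f. f \<in> Hom D (Q X) Z \<and> on_Arr G f \<cdot>\<^bsub>C\<^esub> u X = g)"

definition extend2 :: "'o \<Rightarrow> 'n \<Rightarrow> 'n \<Rightarrow> 'c \<Rightarrow> 'd" where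
  "extend2 X f f' \<phi> = (THE \<psi>. \<psi> \<in> Hom2 D f f' \<and> on_Cell G \<psi> \<rhd>\<^bsub>C\<^esub> u X = \<phi>)"

lemma u_boundary [simp]:
  assumes "X \<in> Obj C"
  shows "Q X \<in> Obj D" "u X \<in> Arr C" "Dom C (u X) = X" "Cod C (u X) = on_Obj G (Q X)"
  using universal[OF assms] by (auto simp: universal_2arrow_def Hom_iff)

lemma extend [simp]:
  assumes "g \<in> Arr C" "Dom C g = X" "Z \<in> Obj D" "Cod C g = on_Obj G Z"
  shows "extend X Z g \<in> Arr D" "Dom D (extend X Z g) = Q X" "Cod D (extend X Z g) = Z"
    "on_Arr G (extend X Z g) \<cdot>\<^bsub>C\<^esub> u X = g"
proof -
  have "X \<in> Obj C" using assms by auto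
  then have "\<exists>!f. f \<in> Hom D (Q X) Z \<and> on_Arr G f \<cdot>\<^bsub>C\<^esub> u X = g"
    using universal[of X] assms unfolding universal_2arrow_def by (simp add: Hom_iff)
  then have "extend X Z g \<in> Hom D (Q X) Z \<and> on_Arr G (extend X Z g) \<cdot>\<^bsub>C\<^esub> u X = g"
    unfolding extend_def by (rule theI')
  then show "extend X Z g \<in> Arr D" "Dom D (extend X Z g) = Q X" "Cod D (extend X Z g) = Z"
    "on_Arr G (extend X Z g) \<cdot>\<^bsub>C\<^esub> u X = g"
    by (simp_all add: Hom_iff)
qed

lemma extend_unique:
  assumes "X \<in> Obj C" "f \<in> Arr D" "f' \<in> Arr D" "Dom D f = Q X" "Dom D f' = Q X" "Cod D f = Cod D f'"
    and eq: "on_Arr G f \<cdot>\<^bsub>C\<^esub> u X = on_Arr G f' \<cdot>\<^bsub>C\<^esub> u X"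
  shows "f = f'"
proof -
  have "\<exists>!h. h \<in> Hom D (Q X) (Cod D f') \<and> on_Arr G h \<cdot>\<^bsub>C\<^esub> u X = on_Arr G f' \<cdot>\<^bsub>C\<^esub> u X"
    using universal[of X] assms(1-6) unfolding universal_2arrow_def by (simp add: Hom_iff)
  then show ?thesis
    using assms by (auto simp: Hom_iff)
qed

lemma extend2_ex1:
  assumes "X \<in> Obj C" "f \<in> Arr D" "f' \<in> Arr D" "Dom D f = Q X" "Dom D f' = Q X" "Cod D f = Cod D f'"
    and "\<phi> \<in> Cell C" "Src C \<phi> = on_Arr G f \<cdot>\<^bsub>C\<^esub> u X" "Tgt C \<phi> = on_Arr G f' \<cdot>\<^bsub>C\<^esub> u X"
  shows "\<exists>!\<psi>. \<psi> \<in> Hom2 D f f' \<and> on_Cell G \<psi> \<rhd>\<^bsub>C\<^esub> u X = \<phi>"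
proof -
  have "Cod D f' \<in> Obj D" "f \<in> Hom D (Q X) (Cod D f')" "f' \<in> Hom D (Q X) (Cod D f')"
    "\<phi> \<in> Hom2 C (on_Arr G f \<cdot>\<^bsub>C\<^esub> u X) (on_Arr G f' \<cdot>\<^bsub>C\<^esub> u X)"
    using assms by (auto simp add: Hom_iff Hom2_iff)
  then show ?thesis
    using universal[OF \<open>X \<in> Obj C\<close>] unfolding universal_2arrow_def by blast
qed

lemma extend2 [simp]:
  assumes "X \<in> Obj C" "f \<in> Arr D" "f' \<in> Arr D" "Dom D f = Q X" "Dom D f' = Q X" "Cod D f = Cod D f'"
    and "\<phi> \<in> Cell C" "Src C \<phi> = on_Arr G f \<cdot>\<^bsub>C\<^esub> u X" "Tgt C \<phi> = on_Arr G f' \<cdot>\<^bsub>C\<^esub> u X"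
  shows "extend2 X f f' \<phi> \<in> Cell D" "Src D (extend2 X f f' \<phi>) = f" "Tgt D (extend2 X f f' \<phi>) = f'"
    "on_Cell G (extend2 X f f' \<phi>) \<rhd>\<^bsub>C\<^esub> u X = \<phi>"
  using theI'[OF extend2_ex1[OF assms]] unfolding extend2_def by (simp_all add: Hom2_iff)

lemma extend2_unique:
  assumes "X \<in> Obj C" "\<psi> \<in> Cell D" "\<psi>' \<in> Cell D" "Dom D (Src D \<psi>) = Q X"
    "Src D \<psi> = Src D \<psi>'" "Tgt D \<psi> = Tgt D \<psi>'"
    and eq: "on_Cell G \<psi> \<rhd>\<^bsub>C\<^esub> u X = on_Cell G \<psi>' \<rhd>\<^bsub>C\<^esub> u X"
  shows "\<psi> = \<psi>'"
proof -
  have "\<exists>!h. h \<in> Hom2 D (Src D \<psi>) (Tgt D \<psi>) \<and> on_Cell G h \<rhd>\<^bsub>C\<^esub> u X = on_Cell G \<psi> \<rhd>\<^bsub>C\<^esub> u X"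
    using assms(1-4) by (intro extend2_ex1) simp_all
  then show ?thesis
    using assms by (auto simp: Hom2_iff)
qed

text \<open>
  The action of the adjoint on 1-cells and 2-cells is forced by naturality of \<open>u\<close>, and every equation
  about it holds because both sides have the same restriction along \<open>u\<close>.
\<close>

definition adj_Arr :: "'m \<Rightarrow> 'n" where
  "adj_Arr f = extend (Dom C f) (Q (Cod C f)) (u (Cod C f) \<cdot>\<^bsub>C\<^esub> f)"

definition adjoint :: "('o, 'm, 'c, 'p, 'n, 'd) twofun" where
  "adjoint = \<lparr>on_Obj = Q, on_Arr = adj_Arr,
     on_Cell = \<lambda>\<alpha>. extend2 (Dom C (Src C \<alpha>)) (adj_Arr (Src C \<alpha>)) (adj_Arr (Tgt C \<alpha>))
       (u (Cod C (Src C \<alpha>)) \<lhd>\<^bsub>C\<^esub> \<alpha>)\<rparr>"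

definition counit :: "'p \<Rightarrow> 'n" where
  "counit Z = extend (on_Obj G Z) Z (Ide C (on_Obj G Z))"

lemma adjoint_Obj [simp]: "on_Obj adjoint X = Q X"
  by (simp add: adjoint_def)

lemma adjoint_Arr [simp]:
  assumes "f \<in> Arr C"
  shows "on_Arr adjoint f \<in> Arr D" "Dom D (on_Arr adjoint f) = Q (Dom C f)"
    "Cod D (on_Arr adjoint f) = Q (Cod C f)"
  using assms by (simp_all add: adjoint_def adj_Arr_def)

lemma adjoint_Arr_u:
  "\<lbrakk>f \<in> Arr C; Dom C f = X\<rbrakk> \<Longrightarrow> on_Arr G (on_Arr adjoint f) \<cdot>\<^bsub>C\<^esub> u X = u (Cod C f) \<cdot>\<^bsub>C\<^esub> f"
  by (auto simp: adjoint_def adj_Arr_def)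

lemma adjoint_Cell_spec:
  assumes "\<alpha> \<in> Cell C"
  shows "on_Cell adjoint \<alpha> \<in> Cell D \<and> Src D (on_Cell adjoint \<alpha>) = on_Arr adjoint (Src C \<alpha>)
    \<and> Tgt D (on_Cell adjoint \<alpha>) = on_Arr adjoint (Tgt C \<alpha>)
    \<and> on_Cell G (on_Cell adjoint \<alpha>) \<rhd>\<^bsub>C\<^esub> u (Dom C (Src C \<alpha>)) = u (Cod C (Src C \<alpha>)) \<lhd>\<^bsub>C\<^esub> \<alpha>"
proof -
  have "on_Cell adjoint \<alpha> = extend2 (Dom C (Src C \<alpha>)) (on_Arr adjoint (Src C \<alpha>))
      (on_Arr adjoint (Tgt C \<alpha>)) (u (Cod C (Src C \<alpha>)) \<lhd>\<^bsub>C\<^esub> \<alpha>)"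
    by (simp add: adjoint_def)
  then show ?thesis
    using assms by (simp add: adjoint_Arr_u)
qed

lemma adjoint_Cell [simp]:
  assumes "\<alpha> \<in> Cell C"
  shows "on_Cell adjoint \<alpha> \<in> Cell D" "Src D (on_Cell adjoint \<alpha>) = on_Arr adjoint (Src C \<alpha>)"
    "Tgt D (on_Cell adjoint \<alpha>) = on_Arr adjoint (Tgt C \<alpha>)"
  using adjoint_Cell_spec[OF assms] by simp_all

lemma adjoint_Cell_u:
  "\<lbrakk>\<alpha> \<in> Cell C; Dom C (Src C \<alpha>) = X\<rbrakk>
    \<Longrightarrow> on_Cell G (on_Cell adjoint \<alpha>) \<rhd>\<^bsub>C\<^esub> u X = u (Cod C (Src C \<alpha>)) \<lhd>\<^bsub>C\<^esub> \<alpha>"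
  using adjoint_Cell_spec by blast

lemma adjoint_Arr_u_assoc:
  assumes "f \<in> Arr C" "Dom C f = X" "h \<in> Arr C" "Cod C h = X"
  shows "on_Arr G (on_Arr adjoint f) \<cdot>\<^bsub>C\<^esub> (u X \<cdot>\<^bsub>C\<^esub> h) = u (Cod C f) \<cdot>\<^bsub>C\<^esub> (f \<cdot>\<^bsub>C\<^esub> h)"
proof -
  have X: "X \<in> Obj C" using assms by auto
  have "on_Arr G (on_Arr adjoint f) \<cdot>\<^bsub>C\<^esub> (u X \<cdot>\<^bsub>C\<^esub> h)
      = (on_Arr G (on_Arr adjoint f) \<cdot>\<^bsub>C\<^esub> u X) \<cdot>\<^bsub>C\<^esub> h"
    using assms X by simp
  also have "\<dots> = u (Cod C f) \<cdot>\<^bsub>C\<^esub> (f \<cdot>\<^bsub>C\<^esub> h)"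
    unfolding adjoint_Arr_u[OF assms(1,2)] using assms X by simp
  finally show ?thesis .
qed

lemma adjoint_Cell_u_hcomp:
  assumes "\<beta> \<in> Cell C" "Dom C (Src C \<beta>) = X" "\<alpha> \<in> Cell C" "Cod C (Src C \<alpha>) = X"
  shows "on_Cell G (on_Cell adjoint \<beta>) \<star>\<^bsub>C\<^esub> (u X \<lhd>\<^bsub>C\<^esub> \<alpha>) = u (Cod C (Src C \<beta>)) \<lhd>\<^bsub>C\<^esub> (\<beta> \<star>\<^bsub>C\<^esub> \<alpha>)"
proof -
  have X: "X \<in> Obj C" using assms by auto
  have "on_Cell G (on_Cell adjoint \<beta>) \<star>\<^bsub>C\<^esub> (u X \<lhd>\<^bsub>C\<^esub> \<alpha>)
      = (on_Cell G (on_Cell adjoint \<beta>) \<rhd>\<^bsub>C\<^esub> u X) \<star>\<^bsub>C\<^esub> \<alpha>"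
    using assms X by simp
  also have "\<dots> = u (Cod C (Src C \<beta>)) \<lhd>\<^bsub>C\<^esub> (\<beta> \<star>\<^bsub>C\<^esub> \<alpha>)"
    unfolding adjoint_Cell_u[OF assms(1,2)] using assms X by simp
  finally show ?thesis .
qed

lemma adjoint_functor: "two_functor C D adjoint"
proof (rule two_functorI, goal_cases)
  case (6 A)
  then show ?case
    by (intro extend_unique[of A]) (simp_all add: adjoint_Arr_u)
next
  case (7 f g)
  then show ?case
    by (intro extend_unique[of "Dom C f"]) (simp_all add: adjoint_Arr_u adjoint_Arr_u_assoc)
next
  case (8 f)
  then show ?case
    by (intro extend2_unique[of "Dom C f"]) (simp_all add: adjoint_Cell_u adjoint_Arr_u)
next
  case (9 \<alpha> \<beta>)
  then have "Cod C (Src C \<beta>) = Cod C (Src C \<alpha>)" "Dom C (Src C \<beta>) = Dom C (Src C \<alpha>)"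
    by simp_all
  then show ?case
    using 9 by (intro extend2_unique[of "Dom C (Src C \<alpha>)"]) (simp_all add: adjoint_Cell_u)
next
  case (10 \<alpha> \<beta>)
  have tgt: "on_Arr adjoint (Tgt C \<beta> \<cdot>\<^bsub>C\<^esub> Tgt C \<alpha>)
      = on_Arr adjoint (Tgt C \<beta>) \<cdot>\<^bsub>D\<^esub> on_Arr adjoint (Tgt C \<alpha>)"
    using 10 by (intro extend_unique[of "Dom C (Src C \<alpha>)"]) (simp_all add: adjoint_Arr_u adjoint_Arr_u_assoc)
  have src: "on_Arr adjoint (Src C \<beta> \<cdot>\<^bsub>C\<^esub> Src C \<alpha>)
      = on_Arr adjoint (Src C \<beta>) \<cdot>\<^bsub>D\<^esub> on_Arr adjoint (Src C \<alpha>)"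
    using 10 by (intro extend_unique[of "Dom C (Src C \<alpha>)"]) (simp_all add: adjoint_Arr_u adjoint_Arr_u_assoc)
  show ?case
    using 10 by (intro extend2_unique[of "Dom C (Src C \<alpha>)"]) (simp_all add: adjoint_Cell_u adjoint_Cell_u_hcomp src tgt)
qed (simp_all add: G.C.two_category_axioms G.D.two_category_axioms)

lemma counit [simp]:
  assumes "Z \<in> Obj D"
  shows "counit Z \<in> Arr D" "Dom D (counit Z) = Q (on_Obj G Z)" "Cod D (counit Z) = Z"
    "on_Arr G (counit Z) \<cdot>\<^bsub>C\<^esub> u (on_Obj G Z) = Ide C (on_Obj G Z)"
  using assms by (simp_all add: counit_def)

lemma counit_u_Arr [simp]:
  assumes "Z \<in> Obj D" "h \<in> Arr C" "Cod C h = on_Obj G Z"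
  shows "on_Arr G (counit Z) \<cdot>\<^bsub>C\<^esub> (u (on_Obj G Z) \<cdot>\<^bsub>C\<^esub> h) = h"
proof -
  have "on_Arr G (counit Z) \<cdot>\<^bsub>C\<^esub> (u (on_Obj G Z) \<cdot>\<^bsub>C\<^esub> h)
      = (on_Arr G (counit Z) \<cdot>\<^bsub>C\<^esub> u (on_Obj G Z)) \<cdot>\<^bsub>C\<^esub> h"
    using assms G.C.comp_assoc_right by (simp del: counit(4))
  then show ?thesis
    using assms by simp
qed

lemma adjunction: "two_adjunction C D adjoint G u counit"
proof -
  interpret H: two_functor C D adjoint by (rule adjoint_functor)
  have GH: "two_functor C C (G \<otimes> adjoint)"
    by (rule two_functor_comp2[OF H.two_functor_axioms G.two_functor_axioms])
  have HG: "two_functor D D (adjoint \<otimes> G)"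
    by (rule two_functor_comp2[OF G.two_functor_axioms H.two_functor_axioms])
  have "two_natural C C id2 (G \<otimes> adjoint) u"
    by (rule two_naturalI[OF two_functor_id2[OF G.D.two_category_axioms] GH])
      (simp_all add: adjoint_Arr_u adjoint_Cell_u)
  moreover have "two_natural D D (adjoint \<otimes> G) id2 counit"
  proof (rule two_naturalI[OF HG two_functor_id2[OF G.C.two_category_axioms]], goal_cases)
    case (2 f)
    then show ?case
      by (intro extend_unique[of "on_Obj G (Dom D f)"]) (simp_all add: adjoint_Arr_u)
  next
    case (3 \<alpha>)
    have eq: "counit (Cod D f) \<cdot>\<^bsub>D\<^esub> on_Arr adjoint (on_Arr G f) = f \<cdot>\<^bsub>D\<^esub> counit (Dom D f)"
      if "f \<in> Arr D" for f
      using that by (intro extend_unique[of "on_Obj G (Dom D f)"]) (simp_all add: adjoint_Arr_u)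
    show ?case
      using 3 eq[of "Src D \<alpha>"] eq[of "Tgt D \<alpha>"]
      by (intro extend2_unique[of "on_Obj G (Dom D (Src D \<alpha>))"]) (simp_all add: adjoint_Cell_u)
  qed simp
  moreover have "counit (on_Obj adjoint X) \<cdot>\<^bsub>D\<^esub> on_Arr adjoint (u X) = Ide D (on_Obj adjoint X)"
    if "X \<in> Obj C" for X
    using that by (intro extend_unique[of X]) (simp_all add: adjoint_Arr_u)
  ultimately show ?thesis
    by (intro two_adjunction.intro two_adjunction_axioms.intro)
      (simp_all add: H.two_functor_axioms G.two_functor_axioms)
qed

end


section \<open>Transposition along an adjunction with a right action\<close>

text \<open>
  A left 2-adjoint \<open>P : \<L> \<rightarrow> \<A>\<close> carrying a right action of the 2-monad \<open>S\<close>. This is the same as an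
  adjunction of 2-monads from \<open>(\<L>, S)\<close> to \<open>\<A>\<close> with its identity 2-monad, and it is the form to which the
  general case is reduced, with \<open>\<A> = T-Alg\<^sub>s\<close>.
\<close>

locale module_adjunction =
  S: two_monad L S + adj: two_adjunction L A P U \<eta> \<epsilon> + act: two_natural L A "P \<otimes> Fun S" P c
  for L :: "('o, 'm, 'c) twocat" and S :: "('o, 'm, 'c) monad2"
    and A :: "('p, 'n, 'd) twocat"
    and P :: "('o, 'm, 'c, 'p, 'n, 'd) twofun" and U :: "('p, 'n, 'd, 'o, 'm, 'c) twofun"
    and \<eta> :: "'o \<Rightarrow> 'm" and \<epsilon> :: "'p \<Rightarrow> 'n" and c :: "'o \<Rightarrow> 'n" +
  assumes act_unit: "X \<in> Obj L \<Longrightarrow> c X \<cdot>\<^bsub>A\<^esub> on_Arr P (Unit S X) = Ide A (on_Obj P X)"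
    and act_mult: "X \<in> Obj L \<Longrightarrow> c X \<cdot>\<^bsub>A\<^esub> on_Arr P (Mult S X) = c X \<cdot>\<^bsub>A\<^esub> c (mObj S X)"
begin

text \<open>
  Transposition, for 1-cells and for 2-cells. The object of \<open>\<L>\<close> is an argument of \<open>flat\<close> because \<open>P\<close> need
  not be injective on objects.
\<close>

definition flat :: "'o \<Rightarrow> 'n \<Rightarrow> 'm" where
  "flat X f = on_Arr U f \<cdot>\<^bsub>L\<^esub> \<eta> X"

definition flat2 :: "'o \<Rightarrow> 'd \<Rightarrow> 'c" where
  "flat2 X \<alpha> = on_Cell U \<alpha> \<rhd>\<^bsub>L\<^esub> \<eta> X"

definition sharp :: "'p \<Rightarrow> 'm \<Rightarrow> 'n" where
  "sharp Z g = \<epsilon> Z \<cdot>\<^bsub>A\<^esub> on_Arr P g"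

definition sharp2 :: "'p \<Rightarrow> 'c \<Rightarrow> 'd" where
  "sharp2 Z \<phi> = \<epsilon> Z \<lhd>\<^bsub>A\<^esub> on_Cell P \<phi>"

lemma eta_boundary [simp]:
  assumes "X \<in> Obj L"
  shows "\<eta> X \<in> Arr L" "Dom L (\<eta> X) = X" "Cod L (\<eta> X) = on_Obj U (on_Obj P X)"
  using adj.eta.component_Arr[OF assms] by simp_all

lemma eps_boundary [simp]:
  assumes "Z \<in> Obj A"
  shows "\<epsilon> Z \<in> Arr A" "Dom A (\<epsilon> Z) = on_Obj P (on_Obj U Z)" "Cod A (\<epsilon> Z) = Z"
  using adj.eps.component_Arr[OF assms] by simp_all

lemma act_boundary [simp]:
  assumes "X \<in> Obj L"
  shows "c X \<in> Arr A" "Dom A (c X) = on_Obj P (mObj S X)" "Cod A (c X) = on_Obj P X"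
  using act.component_Arr[OF assms] by simp_all

lemmas triangles [simp] = adj.triangle_F adj.triangle_G

lemma triangle_G_assoc [simp]:
  assumes "Z \<in> Obj A" "h \<in> Arr L" "Cod L h = on_Obj U Z"
  shows "on_Arr U (\<epsilon> Z) \<cdot>\<^bsub>L\<^esub> (\<eta> (on_Obj U Z) \<cdot>\<^bsub>L\<^esub> h) = h"
proof -
  have "on_Arr U (\<epsilon> Z) \<cdot>\<^bsub>L\<^esub> (\<eta> (on_Obj U Z) \<cdot>\<^bsub>L\<^esub> h) = (on_Arr U (\<epsilon> Z) \<cdot>\<^bsub>L\<^esub> \<eta> (on_Obj U Z)) \<cdot>\<^bsub>L\<^esub> h"
    using assms by (simp del: triangles)
  then show ?thesis using assms by simp
qed

lemma eta_natural:
  "\<lbrakk>h \<in> Arr L; Dom L h = X\<rbrakk> \<Longrightarrow> on_Arr U (on_Arr P h) \<cdot>\<^bsub>L\<^esub> \<eta> X = \<eta> (Cod L h) \<cdot>\<^bsub>L\<^esub> h"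
  using adj.eta.natural_Arr[of h "Cod L h"] by auto

lemma eta_natural2:
  "\<lbrakk>\<phi> \<in> Cell L; Dom L (Src L \<phi>) = X\<rbrakk>
    \<Longrightarrow> on_Cell U (on_Cell P \<phi>) \<rhd>\<^bsub>L\<^esub> \<eta> X = \<eta> (Cod L (Src L \<phi>)) \<lhd>\<^bsub>L\<^esub> \<phi>"
  using adj.eta.natural_Cell[of \<phi> "Cod L (Src L \<phi>)"] by auto

lemma eps_natural:
  "\<lbrakk>k \<in> Arr A; Cod A k = W\<rbrakk> \<Longrightarrow> \<epsilon> W \<cdot>\<^bsub>A\<^esub> on_Arr P (on_Arr U k) = k \<cdot>\<^bsub>A\<^esub> \<epsilon> (Dom A k)"
  using adj.eps.natural_Arr[of k W] by auto

lemma eps_natural2: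
  "\<lbrakk>\<alpha> \<in> Cell A; Cod A (Src A \<alpha>) = W\<rbrakk>
    \<Longrightarrow> \<epsilon> W \<lhd>\<^bsub>A\<^esub> on_Cell P (on_Cell U \<alpha>) = \<alpha> \<rhd>\<^bsub>A\<^esub> \<epsilon> (Dom A (Src A \<alpha>))"
  using adj.eps.natural_Cell[of \<alpha> W] by auto

lemma act_natural:
  "\<lbrakk>h \<in> Arr L; Cod L h = Y\<rbrakk> \<Longrightarrow> c Y \<cdot>\<^bsub>A\<^esub> on_Arr P (mArr S h) = on_Arr P h \<cdot>\<^bsub>A\<^esub> c (Dom L h)"
  using act.natural_Arr[of h Y] by auto

lemma act_natural2:
  "\<lbrakk>\<phi> \<in> Cell L; Cod L (Src L \<phi>) = Y\<rbrakk>
    \<Longrightarrow> c Y \<lhd>\<^bsub>A\<^esub> on_Cell P (mCell S \<phi>) = on_Cell P \<phi> \<rhd>\<^bsub>A\<^esub> c (Dom L (Src L \<phi>))"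
  using act.natural_Cell[of \<phi> Y] by auto

lemma flat_boundary [simp]:
  assumes "X \<in> Obj L" "f \<in> Arr A" "Dom A f = on_Obj P X"
  shows "flat X f \<in> Arr L" "Dom L (flat X f) = X" "Cod L (flat X f) = on_Obj U (Cod A f)"
  using assms by (simp_all add: flat_def)

lemma flat2_boundary [simp]:
  assumes "X \<in> Obj L" "\<alpha> \<in> Cell A" "Dom A (Src A \<alpha>) = on_Obj P X"
  shows "flat2 X \<alpha> \<in> Cell L" "Src L (flat2 X \<alpha>) = flat X (Src A \<alpha>)"
    "Tgt L (flat2 X \<alpha>) = flat X (Tgt A \<alpha>)"
  using assms by (simp_all add: flat_def flat2_def)

lemma sharp_boundary [simp]:
  assumes "Z \<in> Obj A" "g \<in> Arr L" "Cod L g = on_Obj U Z"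
  shows "sharp Z g \<in> Arr A" "Dom A (sharp Z g) = on_Obj P (Dom L g)" "Cod A (sharp Z g) = Z"
  using assms by (simp_all add: sharp_def)

lemma sharp2_boundary [simp]:
  assumes "Z \<in> Obj A" "\<phi> \<in> Cell L" "Cod L (Src L \<phi>) = on_Obj U Z"
  shows "sharp2 Z \<phi> \<in> Cell A" "Src A (sharp2 Z \<phi>) = sharp Z (Src L \<phi>)"
    "Tgt A (sharp2 Z \<phi>) = sharp Z (Tgt L \<phi>)"
  using assms by (simp_all add: sharp_def sharp2_def)

lemma flat_sharp [simp]:
  assumes "Z \<in> Obj A" "g \<in> Arr L" "Dom L g = X" "Cod L g = on_Obj U Z"
  shows "flat X (sharp Z g) = g"
proof -
  have "X \<in> Obj L" using assms by auto
  then show ?thesis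
    using assms by (simp add: flat_def sharp_def eta_natural)
qed

lemma flat2_sharp2 [simp]:
  assumes "Z \<in> Obj A" "\<phi> \<in> Cell L" "Dom L (Src L \<phi>) = X" "Cod L (Src L \<phi>) = on_Obj U Z"
  shows "flat2 X (sharp2 Z \<phi>) = \<phi>"
proof -
  have "X \<in> Obj L" using assms by auto
  then show ?thesis
    using assms by (simp add: flat2_def sharp2_def eta_natural2)
qed

lemma sharp_flat [simp]:
  assumes "X \<in> Obj L" "f \<in> Arr A" "Dom A f = on_Obj P X" "Cod A f = Z"
  shows "sharp Z (flat X f) = f"
proof -
  have "sharp Z (flat X f) = (\<epsilon> Z \<cdot>\<^bsub>A\<^esub> on_Arr P (on_Arr U f)) \<cdot>\<^bsub>A\<^esub> on_Arr P (\<eta> X)"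
    using assms by (auto simp: flat_def sharp_def)
  also have "\<dots> = f"
    unfolding eps_natural[OF assms(2,4)] using assms by simp
  finally show ?thesis .
qed

lemma sharp2_flat2 [simp]:
  assumes "X \<in> Obj L" "\<alpha> \<in> Cell A" "Dom A (Src A \<alpha>) = on_Obj P X" "Cod A (Src A \<alpha>) = Z"
  shows "sharp2 Z (flat2 X \<alpha>) = \<alpha>"
proof -
  have "sharp2 Z (flat2 X \<alpha>) = (\<epsilon> Z \<lhd>\<^bsub>A\<^esub> on_Cell P (on_Cell U \<alpha>)) \<rhd>\<^bsub>A\<^esub> on_Arr P (\<eta> X)"
    using assms by (auto simp: flat2_def sharp2_def)
  also have "\<dots> = \<alpha>"
    unfolding eps_natural2[OF assms(2,4)] using assms by simp
  finally show ?thesis .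
qed

lemma flat_inject:
  assumes "X \<in> Obj L" "f \<in> Arr A" "f' \<in> Arr A" "Dom A f = on_Obj P X" "Dom A f' = on_Obj P X"
    "Cod A f = Cod A f'"
  shows "flat X f = flat X f' \<longleftrightarrow> f = f'"
  using sharp_flat[of X f] sharp_flat[of X f'] assms by metis

lemma flat2_inject:
  assumes "X \<in> Obj L" "\<alpha> \<in> Cell A" "\<alpha>' \<in> Cell A" "Dom A (Src A \<alpha>) = on_Obj P X"
    "Dom A (Src A \<alpha>') = on_Obj P X" "Cod A (Src A \<alpha>) = Cod A (Src A \<alpha>')"
  shows "flat2 X \<alpha> = flat2 X \<alpha>' \<longleftrightarrow> \<alpha> = \<alpha>'"
  using sharp2_flat2[of X \<alpha>] sharp2_flat2[of X \<alpha>'] assms by metis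

lemma flat_precomp [simp]:
  assumes "h \<in> Arr L" "Dom L h = X" "f \<in> Arr A" "Dom A f = on_Obj P (Cod L h)"
  shows "flat X (f \<cdot>\<^bsub>A\<^esub> on_Arr P h) = flat (Cod L h) f \<cdot>\<^bsub>L\<^esub> h"
proof -
  have "X \<in> Obj L" using assms by auto
  then show ?thesis
    using assms by (simp add: flat_def eta_natural)
qed

lemma flat2_precomp [simp]:
  assumes "h \<in> Arr L" "Dom L h = X" "\<alpha> \<in> Cell A" "Dom A (Src A \<alpha>) = on_Obj P (Cod L h)"
  shows "flat2 X (\<alpha> \<rhd>\<^bsub>A\<^esub> on_Arr P h) = flat2 (Cod L h) \<alpha> \<rhd>\<^bsub>L\<^esub> h"
proof -
  have "X \<in> Obj L" using assms by auto
  then show ?thesis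
    using assms by (simp add: flat2_def eta_natural)
qed

lemma flat_postcomp:
  assumes "X \<in> Obj L" "f \<in> Arr A" "Dom A f = on_Obj P X" "k \<in> Arr A" "Dom A k = Cod A f"
  shows "flat X (k \<cdot>\<^bsub>A\<^esub> f) = on_Arr U k \<cdot>\<^bsub>L\<^esub> flat X f"
  using assms by (simp add: flat_def)

lemma flat2_postcomp:
  assumes "X \<in> Obj L" "\<alpha> \<in> Cell A" "Dom A (Src A \<alpha>) = on_Obj P X" "k \<in> Arr A"
    "Dom A k = Cod A (Src A \<alpha>)"
  shows "flat2 X (k \<lhd>\<^bsub>A\<^esub> \<alpha>) = on_Arr U k \<lhd>\<^bsub>L\<^esub> flat2 X \<alpha>"
  using assms by (simp add: flat2_def)

lemma flat2_whisker:
  assumes "X \<in> Obj L" "q \<in> Arr A" "Dom A q = on_Obj P X" "\<psi> \<in> Cell A"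
    "Dom A (Src A \<psi>) = Cod A q"
  shows "flat2 X (\<psi> \<rhd>\<^bsub>A\<^esub> q) = on_Cell U \<psi> \<rhd>\<^bsub>L\<^esub> flat X q"
  using assms by (simp add: flat2_def flat_def)

lemma flat2_vcomp:
  assumes "X \<in> Obj L" "\<alpha> \<in> Cell A" "Dom A (Src A \<alpha>) = on_Obj P X" "\<beta> \<in> Cell A" "Src A \<beta> = Tgt A \<alpha>"
  shows "flat2 X (\<beta> \<bullet>\<^bsub>A\<^esub> \<alpha>) = flat2 X \<beta> \<bullet>\<^bsub>L\<^esub> flat2 X \<alpha>"
  using assms by (simp add: flat2_def)

lemma flat2_Idc:
  assumes "X \<in> Obj L" "f \<in> Arr A" "Dom A f = on_Obj P X"
  shows "flat2 X (Idc A f) = Idc L (flat X f)"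
  using assms by (simp add: flat2_def flat_def)

text \<open>
  The \<open>S\<close>-algebra structure of \<open>U Z\<close> is the component at \<open>Z\<close> of the mate \<open>S U \<rightarrow> U\<close> of the right action.
\<close>

definition action :: "'p \<Rightarrow> 'm" where
  "action Z = flat (mObj S (on_Obj U Z)) (\<epsilon> Z \<cdot>\<^bsub>A\<^esub> c (on_Obj U Z))"

lemma action_boundary [simp]:
  assumes "Z \<in> Obj A"
  shows "action Z \<in> Arr L" "Dom L (action Z) = mObj S (on_Obj U Z)" "Cod L (action Z) = on_Obj U Z"
  using assms by (simp_all add: action_def)

text \<open>
  Transposition turns precomposition with the right action into the algebra structure. Every 1-cell \<open>f\<close>
  is \<open>\<epsilon>\<close> after \<open>P(f\<^sup>\<flat>)\<close>, and naturality of \<open>c\<close> moves \<open>P(f\<^sup>\<flat>)\<close> across the action, which reduces the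
  claim to \<open>f = \<epsilon>\<close>, where it is the definition of the structure. The same argument applies to 2-cells.
\<close>

lemma flat_act [simp]:
  assumes "X \<in> Obj L" "f \<in> Arr A" "Dom A f = on_Obj P X" "mObj S X = Y"
  shows "flat Y (f \<cdot>\<^bsub>A\<^esub> c X) = action (Cod A f) \<cdot>\<^bsub>L\<^esub> mArr S (flat X f)"
proof -
  have [simp]: "Y = mObj S X" using assms(4) by simp
  let ?Z = "Cod A f"
  have "action ?Z \<cdot>\<^bsub>L\<^esub> mArr S (flat X f)
      = flat (mObj S X) ((\<epsilon> ?Z \<cdot>\<^bsub>A\<^esub> c (on_Obj U ?Z)) \<cdot>\<^bsub>A\<^esub> on_Arr P (mArr S (flat X f)))"
    unfolding action_def using assms(1-3) by (subst flat_precomp) simp_all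
  also have "\<dots> = flat (mObj S X) (sharp ?Z (flat X f) \<cdot>\<^bsub>A\<^esub> c X)"
    using assms(1-3) by (simp add: act_natural sharp_def del: sharp_flat)
  finally show ?thesis
    using assms(1-3) by simp
qed

lemma flat2_act [simp]:
  assumes "X \<in> Obj L" "\<alpha> \<in> Cell A" "Dom A (Src A \<alpha>) = on_Obj P X" "mObj S X = Y"
  shows "flat2 Y (\<alpha> \<rhd>\<^bsub>A\<^esub> c X) = action (Cod A (Src A \<alpha>)) \<lhd>\<^bsub>L\<^esub> mCell S (flat2 X \<alpha>)"
proof -
  have [simp]: "Y = mObj S X" using assms(4) by simp
  let ?Z = "Cod A (Src A \<alpha>)" and ?\<phi> = "flat2 X \<alpha>"
  have "action ?Z \<lhd>\<^bsub>L\<^esub> mCell S ?\<phi>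
      = on_Arr U (\<epsilon> ?Z \<cdot>\<^bsub>A\<^esub> c (on_Obj U ?Z)) \<lhd>\<^bsub>L\<^esub> (\<eta> (mObj S (on_Obj U ?Z)) \<lhd>\<^bsub>L\<^esub> mCell S ?\<phi>)"
    using assms(1-3) by (simp add: action_def flat_def)
  also have "\<dots> = on_Cell U (\<epsilon> ?Z \<lhd>\<^bsub>A\<^esub> (c (on_Obj U ?Z) \<lhd>\<^bsub>A\<^esub> on_Cell P (mCell S ?\<phi>))) \<rhd>\<^bsub>L\<^esub> \<eta> (mObj S X)"
    using assms(1-3) by (simp add: eta_natural2)
  also have "\<dots> = flat2 (mObj S X) (sharp2 ?Z ?\<phi> \<rhd>\<^bsub>A\<^esub> c X)"
    using assms(1-3) unfolding flat2_def[of "mObj S X"] by (subst act_natural2) (simp_all add: sharp2_def del: sharp2_flat2)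
  finally show ?thesis
    using assms(1-3) by simp
qed

definition lifted :: "'p \<Rightarrow> ('o, 'm) alg" where
  "lifted Z = (on_Obj U Z, action Z)"

lemma lifted_sel [simp]: "fst (lifted Z) = on_Obj U Z" "snd (lifted Z) = action Z"
  by (simp_all add: lifted_def)

text \<open>
  Both sides of each algebra law are transposes of composites of \<open>\<epsilon>\<close> with the right action, and these
  composites agree by the unit and multiplication laws of the action.
\<close>

lemma lifted_is_algebra [simp]:
  assumes "Z \<in> Obj A"
  shows "is_algebra L S (lifted Z)"
proof -
  let ?X = "on_Obj U Z"
  have "action Z \<cdot>\<^bsub>L\<^esub> Unit S ?X = flat ?X (\<epsilon> Z \<cdot>\<^bsub>A\<^esub> c ?X \<cdot>\<^bsub>A\<^esub> on_Arr P (Unit S ?X))"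
    unfolding action_def using assms by (subst flat_precomp) simp_all
  also have "\<dots> = Ide L ?X"
    using assms by (simp add: act_unit flat_def)
  finally have unit: "action Z \<cdot>\<^bsub>L\<^esub> Unit S ?X = Ide L ?X" .
  have "action Z \<cdot>\<^bsub>L\<^esub> mArr S (action Z) = flat (mObj S (mObj S ?X)) ((\<epsilon> Z \<cdot>\<^bsub>A\<^esub> c ?X) \<cdot>\<^bsub>A\<^esub> c (mObj S ?X))"
    using assms by (subst flat_act) (simp_all add: action_def del: flat_act)
  also have "\<dots> = flat (mObj S (mObj S ?X)) ((\<epsilon> Z \<cdot>\<^bsub>A\<^esub> c ?X) \<cdot>\<^bsub>A\<^esub> on_Arr P (Mult S ?X))"
    using assms by (simp add: act_mult del: flat_act flat_precomp)
  also have "\<dots> = action Z \<cdot>\<^bsub>L\<^esub> Mult S ?X"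
    unfolding action_def using assms by (subst flat_precomp) simp_all
  finally show ?thesis
    using unit assms by (simp add: is_algebra_iff)
qed

lemma action_natural:
  assumes "k \<in> Arr A"
  shows "on_Arr U k \<cdot>\<^bsub>L\<^esub> action (Dom A k) = action (Cod A k) \<cdot>\<^bsub>L\<^esub> mArr S (on_Arr U k)"
proof -
  let ?X = "on_Obj U (Dom A k)"
  have "on_Arr U k \<cdot>\<^bsub>L\<^esub> action (Dom A k) = flat (mObj S ?X) ((k \<cdot>\<^bsub>A\<^esub> \<epsilon> (Dom A k)) \<cdot>\<^bsub>A\<^esub> c ?X)"
    using assms by (simp add: action_def flat_postcomp del: flat_act)
  also have "\<dots> = action (Cod A k) \<cdot>\<^bsub>L\<^esub> mArr S (flat ?X (k \<cdot>\<^bsub>A\<^esub> \<epsilon> (Dom A k)))"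
    using assms by (subst flat_act) simp_all
  also have "flat ?X (k \<cdot>\<^bsub>A\<^esub> \<epsilon> (Dom A k)) = on_Arr U k"
    using assms by (simp add: flat_def)
  finally show ?thesis .
qed

end


section \<open>The bar resolution\<close>

text \<open>
  The faces and degeneracies of the bar resolution other than the last faces, before \<open>P\<close> is applied.
  They are generated by recursion because every one of them except the topmost is the image under \<open>S\<close>
  of one a level lower; this is what the simplicial identities are proved by.
\<close>

primrec bar_face :: "('o, 'm, 'c) monad2 \<Rightarrow> ('o, 'm) alg \<Rightarrow> nat \<Rightarrow> nat \<Rightarrow> 'm" where
  "bar_face S X 0 i = snd X"
| "bar_face S X (Suc n) i
    = (if i \<le> n then mArr S (bar_face S X n i) else Mult S (on_Obj (pow2 (Fun S) n) (fst X)))"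

primrec bar_degen :: "('o, 'm, 'c) monad2 \<Rightarrow> ('o, 'm) alg \<Rightarrow> nat \<Rightarrow> nat \<Rightarrow> 'm" where
  "bar_degen S X 0 i = Unit S (fst X)"
| "bar_degen S X (Suc n) i
    = (if i \<le> n then mArr S (bar_degen S X n i) else Unit S (on_Obj (pow2 (Fun S) (Suc n)) (fst X)))"

lemma bar_face_eq:
  "i \<le> n \<Longrightarrow> bar_face S X n i = (if i = 0 then on_Arr (pow2 (Fun S) n) (snd X)
     else on_Arr (pow2 (Fun S) (n - i)) (Mult S (on_Obj (pow2 (Fun S) (i - 1)) (fst X))))"
  by (induction n) (auto simp: Suc_diff_le le_Suc_eq)

lemma bar_degen_eq:
  "i \<le> n \<Longrightarrow> bar_degen S X n i
     = on_Arr (pow2 (Fun S) (n - i)) (Unit S (on_Obj (pow2 (Fun S) i) (fst X)))"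
  by (induction n) (auto simp: Suc_diff_le le_Suc_eq)

lemma bar_face_simps [simp]:
  "i \<le> n \<Longrightarrow> bar_face S X (Suc n) i = mArr S (bar_face S X n i)"
  "bar_face S X (Suc n) (Suc n) = Mult S (on_Obj (pow2 (Fun S) n) (fst X))"
  by simp_all

lemma bar_degen_simps [simp]:
  "i \<le> n \<Longrightarrow> bar_degen S X (Suc n) i = mArr S (bar_degen S X n i)"
  "bar_degen S X (Suc n) (Suc n) = Unit S (mObj S (on_Obj (pow2 (Fun S) n) (fst X)))"
  by simp_all

declare bar_face.simps(2) [simp del] bar_degen.simps(2) [simp del]

context two_monad
begin

context
  fixes X
  assumes X [simp]: "is_algebra K T X"
begin

abbreviation (input) "pw n \<equiv> on_Obj (pow2 (Fun T) n) (fst X)"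
abbreviation (input) "d \<equiv> bar_face T X"
abbreviation (input) "s \<equiv> bar_degen T X"

lemma pow2_Obj [simp]: "pw n \<in> Obj K"
  by (induction n) simp_all

lemma bar_face_boundary [simp]:
  assumes "i \<le> n"
  shows "d n i \<in> Arr K" "Dom K (d n i) = mObj T (pw n)" "Cod K (d n i) = pw n"
proof -
  have "d n i \<in> Arr K \<and> Dom K (d n i) = mObj T (pw n) \<and> Cod K (d n i) = pw n"
    using assms by (induction n) (auto simp: le_Suc_eq)
  then show "d n i \<in> Arr K" "Dom K (d n i) = mObj T (pw n)" "Cod K (d n i) = pw n"
    by simp_all
qed

lemma bar_degen_boundary [simp]:
  assumes "i \<le> n"
  shows "s n i \<in> Arr K" "Dom K (s n i) = pw n" "Cod K (s n i) = mObj T (pw n)"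
proof -
  have "s n i \<in> Arr K \<and> Dom K (s n i) = pw n \<and> Cod K (s n i) = mObj T (pw n)"
    using assms by (induction n) (auto simp: le_Suc_eq)
  then show "s n i \<in> Arr K" "Dom K (s n i) = pw n" "Cod K (s n i) = mObj T (pw n)"
    by simp_all
qed

text \<open>
  In each identity, if neither index is topmost then both sides are images under \<open>T\<close> of the identity
  one level lower. The remaining cases are naturality of \<open>\<eta>\<close> or \<open>\<mu>\<close>, a monad law, or, in the lowest
  degree, a law of the algebra.
\<close>

lemma bar_face_face:
  "\<lbrakk>i < j; j \<le> Suc n\<rbrakk> \<Longrightarrow> d n i \<cdot>\<^bsub>K\<^esub> d (Suc n) j = d n (j - 1) \<cdot>\<^bsub>K\<^esub> d (Suc n) i"
proof (induction n arbitrary: i j)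
  case 0
  then show ?case by (simp add: bar_face.simps(2))
next
  case (Suc n)
  consider "j \<le> Suc n" | "j = Suc (Suc n)" "i \<le> n" | "j = Suc (Suc n)" "i = Suc n"
    using Suc.prems by linarith
  then show ?case
  proof cases
    case 1
    have "mArr T (d n i \<cdot>\<^bsub>K\<^esub> d (Suc n) j) = mArr T (d n (j - 1) \<cdot>\<^bsub>K\<^esub> d (Suc n) i)"
      using Suc.IH[of i j] Suc.prems 1 by simp
    then show ?thesis
      using 1 Suc.prems by simp
  qed simp_all
qed

lemma bar_degen_degen:
  "\<lbrakk>i \<le> j; j \<le> n\<rbrakk> \<Longrightarrow> s (Suc n) i \<cdot>\<^bsub>K\<^esub> s n j = s (Suc n) (Suc j) \<cdot>\<^bsub>K\<^esub> s n i"
proof (induction n arbitrary: i j)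
  case 0
  then show ?case by (simp add: bar_degen.simps(2))
next
  case (Suc n)
  consider "j \<le> n" | "j = Suc n" "i \<le> n" | "j = Suc n" "i = Suc n"
    using Suc.prems by linarith
  then show ?case
  proof cases
    case 1
    have "mArr T (s (Suc n) i \<cdot>\<^bsub>K\<^esub> s n j) = mArr T (s (Suc n) (Suc j) \<cdot>\<^bsub>K\<^esub> s n i)"
      using Suc.IH[of i j] Suc.prems 1 by simp
    then show ?thesis
      using 1 Suc.prems by simp
  qed simp_all
qed

lemma bar_face_degen_below:
  "\<lbrakk>i < j; j \<le> Suc n\<rbrakk> \<Longrightarrow> d (Suc n) i \<cdot>\<^bsub>K\<^esub> s (Suc n) j = s n (j - 1) \<cdot>\<^bsub>K\<^esub> d n i"
proof (induction n arbitrary: i j)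
  case 0
  then show ?case by (simp add: bar_degen.simps(2))
next
  case (Suc n)
  consider "j \<le> Suc n" | "j = Suc (Suc n)"
    using Suc.prems by linarith
  then show ?case
  proof cases
    case 1
    have "mArr T (d (Suc n) i \<cdot>\<^bsub>K\<^esub> s (Suc n) j) = mArr T (s n (j - 1) \<cdot>\<^bsub>K\<^esub> d n i)"
      using Suc.IH[of i j] Suc.prems 1 by simp
    then show ?thesis
      using 1 Suc.prems by simp
  qed (use Suc.prems in simp)
qed

lemma bar_face_degen_same: "j \<le> n \<Longrightarrow> d n j \<cdot>\<^bsub>K\<^esub> s n j = Ide K (pw n)"
proof (induction n)
  case (Suc n)
  show ?case
  proof (cases "j \<le> n")
    case True
    then have "mArr T (d n j \<cdot>\<^bsub>K\<^esub> s n j) = mArr T (Ide K (pw n))"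
      using Suc.IH by simp
    then show ?thesis
      using True by simp
  next
    case False
    then have "j = Suc n" using Suc.prems by simp
    then show ?thesis by simp
  qed
qed simp

lemma bar_face_degen_next: "j < n \<Longrightarrow> d n (Suc j) \<cdot>\<^bsub>K\<^esub> s n j = Ide K (pw n)"
proof (induction n)
  case (Suc n)
  show ?case
  proof (cases "j < n")
    case True
    then have "mArr T (d n (Suc j) \<cdot>\<^bsub>K\<^esub> s n j) = mArr T (Ide K (pw n))"
      using Suc.IH by simp
    then show ?thesis
      using True by simp
  next
    case False
    then have [simp]: "j = n" using Suc.prems by simp
    have "s n n = Unit T (pw n)"
      by (cases n) simp_all
    then show ?thesis by simp
  qed
qed simp

lemma bar_face_degen_above:
  "\<lbrakk>Suc j < i; i \<le> Suc n\<rbrakk> \<Longrightarrow> d (Suc n) i \<cdot>\<^bsub>K\<^esub> s (Suc n) j = s n j \<cdot>\<^bsub>K\<^esub> d n (i - 1)"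
proof (induction n arbitrary: i j)
  case (Suc n)
  consider "i \<le> Suc n" | "i = Suc (Suc n)"
    using Suc.prems by linarith
  then show ?case
  proof cases
    case 1
    have "mArr T (d (Suc n) i \<cdot>\<^bsub>K\<^esub> s (Suc n) j) = mArr T (s n j \<cdot>\<^bsub>K\<^esub> d n (i - 1))"
      using Suc.IH[of j i] Suc.prems 1 by simp
    then show ?thesis
      using 1 Suc.prems by simp
  qed (use Suc.prems in simp)
qed simp

end

end

context module_adjunction
begin

text \<open>
  A simplicial object is constrained only at indices that occur in its presentation, since the
  values of the maps at other indices are immaterial.
\<close>

definition is_bar :: "('o, 'm) alg \<Rightarrow> ('p, 'n) simp \<Rightarrow> bool" where
  "is_bar X R \<longleftrightarrow>
     (\<forall>n. ob R n = on_Obj P (on_Obj (pow2 (Fun S) n) (fst X))) \<and>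
     (\<forall>n. \<forall>i \<le> n. face R n i = on_Arr P (bar_face S X n i)) \<and>
     (\<forall>n. face R n (Suc n) = c (on_Obj (pow2 (Fun S) n) (fst X))) \<and>
     (\<forall>n. \<forall>i \<le> n. degen R n i = on_Arr P (bar_degen S X n i))"

lemma is_barD:
  assumes "is_bar X R"
  shows "ob R n = on_Obj P (on_Obj (pow2 (Fun S) n) (fst X))"
    "i \<le> n \<Longrightarrow> face R n i = on_Arr P (bar_face S X n i)"
    "face R n (Suc n) = c (on_Obj (pow2 (Fun S) n) (fst X))"
    "i \<le> n \<Longrightarrow> degen R n i = on_Arr P (bar_degen S X n i)"
  using assms by (simp_all add: is_bar_def)

text \<open>
  Identities between faces and degeneracies in the image of \<open>P\<close> hold already in \<open>\<L>\<close>. Those in which a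
  last face meets another map are naturality of the action, and its multiplication law \<open>c c = c P(\<mu>)\<close> or
  unit law \<open>c P(\<eta>) = 1\<close> in the topmost position.
\<close>

theorem bar_simplicial:
  assumes X: "is_algebra L S X" and R: "is_bar X R"
  shows "simplicial_object A R"
proof -
  note [simp] = X is_barD[OF R] act_unit act_natural S.pow2_Obj[OF X] S.bar_face_boundary[OF X]
    S.bar_degen_boundary[OF X]
  let ?d = "bar_face S X" and ?s = "bar_degen S X"
  have face_face: "face R n i \<cdot>\<^bsub>A\<^esub> face R (n + 1) j = face R n (j - 1) \<cdot>\<^bsub>A\<^esub> face R (n + 1) i"
    if ij: "i < j" "j \<le> n + 2" for n i j
  proof -
    consider "j \<le> Suc n" | "j = Suc (Suc n)" "i \<le> n" | "j = Suc (Suc n)" "i = Suc n"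
      using ij by linarith
    then show ?thesis
    proof cases
      case 1
      have "on_Arr P (?d n i \<cdot>\<^bsub>L\<^esub> ?d (Suc n) j) = on_Arr P (?d n (j - 1) \<cdot>\<^bsub>L\<^esub> ?d (Suc n) i)"
        using S.bar_face_face[OF X, of i j n] ij 1 by simp
      then show ?thesis using ij 1 by simp
    qed (simp_all add: act_mult)
  qed
  have degen_degen: "degen R (n + 1) i \<cdot>\<^bsub>A\<^esub> degen R n j = degen R (n + 1) (j + 1) \<cdot>\<^bsub>A\<^esub> degen R n i"
    if "i \<le> j" "j \<le> n" for n i j
  proof -
    have "on_Arr P (?s (Suc n) i \<cdot>\<^bsub>L\<^esub> ?s n j) = on_Arr P (?s (Suc n) (Suc j) \<cdot>\<^bsub>L\<^esub> ?s n i)"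
      using S.bar_degen_degen[OF X, of i j n] that by simp
    then show ?thesis using that by simp
  qed
  have below: "face R (n + 1) i \<cdot>\<^bsub>A\<^esub> degen R (n + 1) j = degen R n (j - 1) \<cdot>\<^bsub>A\<^esub> face R n i"
    if "i < j" "j \<le> n + 1" for n i j
  proof -
    have "on_Arr P (?d (Suc n) i \<cdot>\<^bsub>L\<^esub> ?s (Suc n) j) = on_Arr P (?s n (j - 1) \<cdot>\<^bsub>L\<^esub> ?d n i)"
      using S.bar_face_degen_below[OF X, of i j n] that by simp
    then show ?thesis using that by simp
  qed
  have same: "face R n j \<cdot>\<^bsub>A\<^esub> degen R n j = Ide A (ob R n)" if "j \<le> n" for n j
  proof -
    have "on_Arr P (?d n j \<cdot>\<^bsub>L\<^esub> ?s n j) = on_Arr P (Ide L (on_Obj (pow2 (Fun S) n) (fst X)))"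
      using S.bar_face_degen_same[OF X, of j n] that by simp
    then show ?thesis using that by simp
  qed
  have nxt: "face R n (j + 1) \<cdot>\<^bsub>A\<^esub> degen R n j = Ide A (ob R n)" if "j \<le> n" for n j
  proof (cases "j < n")
    case True
    have "on_Arr P (?d n (Suc j) \<cdot>\<^bsub>L\<^esub> ?s n j) = on_Arr P (Ide L (on_Obj (pow2 (Fun S) n) (fst X)))"
      using S.bar_face_degen_next[OF X, of j n] True by simp
    then show ?thesis using True by simp
  next
    case False
    then have [simp]: "j = n" using that by simp
    have "?s n n = Unit S (on_Obj (pow2 (Fun S) n) (fst X))"
      by (cases n) simp_all
    then show ?thesis by simp
  qed
  have above: "face R (n + 1) i \<cdot>\<^bsub>A\<^esub> degen R (n + 1) j = degen R n j \<cdot>\<^bsub>A\<^esub> face R n (i - 1)"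
    if "j + 1 < i" "i \<le> n + 2" for n i j
  proof (cases "i = Suc (Suc n)")
    case True
    then show ?thesis using that by simp
  next
    case False
    then have "on_Arr P (?d (Suc n) i \<cdot>\<^bsub>L\<^esub> ?s (Suc n) j) = on_Arr P (?s n j \<cdot>\<^bsub>L\<^esub> ?d n (i - 1))"
      using S.bar_face_degen_above[OF X, of j i n] that by simp
    then show ?thesis using that False by simp
  qed
  have face_Hom: "face R n i \<in> Hom A (ob R (n + 1)) (ob R n)" if "i \<le> n + 1" for n i
  proof (cases "i = Suc n")
    case False
    then have "i \<le> n" using that by simp
    then show ?thesis by (simp add: Hom_iff)
  qed (simp add: Hom_iff)
  have degen_Hom: "degen R n i \<in> Hom A (ob R n) (ob R (n + 1))" if "i \<le> n" for n i
    using that by (simp add: Hom_iff)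
  have ob_Obj: "ob R n \<in> Obj A" for n
    by simp
  show ?thesis
    unfolding simplicial_object_def
    by (intro conjI allI impI; (elim conjE)?;
        rule ob_Obj face_Hom degen_Hom face_face degen_degen below same nxt above; assumption)
qed

end


section \<open>Cocones are lax morphisms\<close>

text \<open>
  The 2-functor \<open>Z \<mapsto> (U Z, b)\<close>, prescribed on the cells of \<open>\<A>\<close> only: 2-functors with the same effect on
  cells may differ elsewhere, and all of them are covered.
\<close>

locale lifted_right_adjoint = module_adjunction L S A P U \<eta> \<epsilon> c
  for L :: "('o, 'm, 'c) twocat" and S :: "('o, 'm, 'c) monad2"
    and A :: "('p, 'n, 'd) twocat"
    and P :: "('o, 'm, 'c, 'p, 'n, 'd) twofun" and U :: "('p, 'n, 'd, 'o, 'm, 'c) twofun"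
    and \<eta> :: "'o \<Rightarrow> 'm" and \<epsilon> :: "'p \<Rightarrow> 'n" and c :: "'o \<Rightarrow> 'n" +
  fixes Jf :: "('p, 'n, 'd, ('o, 'm) alg, ('o, 'm, 'c) lax_mor, ('o, 'm, 'c) alg_cell) twofun"
  assumes J_Obj [simp]: "Z \<in> Obj A \<Longrightarrow> on_Obj Jf Z = lifted Z"
    and J_Arr [simp]: "k \<in> Arr A
      \<Longrightarrow> on_Arr Jf k = strict_mor L (lifted (Dom A k)) (lifted (Cod A k)) (on_Arr U k)"
    and J_Cell [simp]: "\<kappa> \<in> Cell A
      \<Longrightarrow> on_Cell Jf \<kappa> = AlgCell (on_Arr Jf (Src A \<kappa>)) (on_Arr Jf (Tgt A \<kappa>)) (on_Cell U \<kappa>)"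
begin

lemma J_strict [simp]:
  assumes "k \<in> Arr A" "Dom A k = Z" "Cod A k = W"
  shows "is_lax_mor L S (strict_mor L (lifted Z) (lifted W) (on_Arr U k))"
  using assms action_natural[of k] by (intro S.strict_mor_is_lax_mor) auto

lemma J_comp:
  assumes "k \<in> Arr A" "l \<in> Arr A" "Dom A l = Cod A k"
  shows "lax_comp L S (on_Arr Jf l) (on_Arr Jf k)
    = strict_mor L (lifted (Dom A k)) (lifted (Cod A l)) (on_Arr U l \<cdot>\<^bsub>L\<^esub> on_Arr U k)"
  using assms by (subst S.lax_comp_strict) simp_all

text \<open>
  The coherence condition for the image of a 2-cell is 2-dimensional naturality of the mate; it comes
  from \<open>flat2_act\<close> applied to the cell whiskered with the counit.
\<close>

lemma two_functor_J: "two_functor A (Alg_l L S) Jf"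
proof (rule two_functorI, goal_cases)
  case (5 \<kappa>)
  have "on_Cell U \<kappa> \<rhd>\<^bsub>L\<^esub> action (Dom A (Src A \<kappa>))
      = action (Cod A (Src A \<kappa>)) \<lhd>\<^bsub>L\<^esub> mCell S (on_Cell U \<kappa>)"
  proof -
    let ?Z = "Dom A (Src A \<kappa>)" and ?W = "Cod A (Src A \<kappa>)"
    let ?X = "on_Obj U ?Z"
    have "on_Cell U \<kappa> \<rhd>\<^bsub>L\<^esub> action ?Z = flat2 (mObj S ?X) ((\<kappa> \<rhd>\<^bsub>A\<^esub> \<epsilon> ?Z) \<rhd>\<^bsub>A\<^esub> c ?X)"
      using 5 by (simp add: action_def flat2_whisker del: flat2_act flat_act)
    also have "\<dots> = action ?W \<lhd>\<^bsub>L\<^esub> mCell S (flat2 ?X (\<kappa> \<rhd>\<^bsub>A\<^esub> \<epsilon> ?Z))"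
      using 5 by (subst flat2_act) simp_all
    also have "flat2 ?X (\<kappa> \<rhd>\<^bsub>A\<^esub> \<epsilon> ?Z) = on_Cell U \<kappa>"
      using 5 by (simp add: flat2_def)
    finally show ?thesis .
  qed
  moreover have "on_Arr U (Src A \<kappa>) \<cdot>\<^bsub>L\<^esub> action (Dom A (Src A \<kappa>))
      = action (Cod A (Src A \<kappa>)) \<cdot>\<^bsub>L\<^esub> mArr S (on_Arr U (Src A \<kappa>))"
    "on_Arr U (Tgt A \<kappa>) \<cdot>\<^bsub>L\<^esub> action (Dom A (Src A \<kappa>))
      = action (Cod A (Src A \<kappa>)) \<cdot>\<^bsub>L\<^esub> mArr S (on_Arr U (Tgt A \<kappa>))"
    using 5 action_natural[of "Src A \<kappa>"] action_natural[of "Tgt A \<kappa>"] by simp_all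
  ultimately show ?case
    using 5 by (simp add: is_alg_cell_iff)
next
  case (7 k l)
  then show ?case using J_comp[of k l] by simp
next
  case (10 \<kappa> \<nu>)
  then show ?case
    using J_comp[of "Src A \<kappa>" "Src A \<nu>"] J_comp[of "Tgt A \<kappa>" "Tgt A \<nu>"] by simp
qed (simp_all add: S.two_category_Alg_l adj.F.D.two_category_axioms)

context
  fixes X R
  assumes X [simp]: "is_algebra L S X" and R: "is_bar X R"
begin

lemma bar_low_degrees [simp]:
  "ob R 0 = on_Obj P (fst X)" "face R 0 0 = on_Arr P (snd X)" "face R 0 (Suc 0) = c (fst X)"
  "degen R 0 0 = on_Arr P (Unit S (fst X))"
  "face R (Suc 0) 0 = on_Arr P (mArr S (snd X))" "face R (Suc 0) (Suc 0) = on_Arr P (Mult S (fst X))"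
  "face R (Suc 0) 2 = c (mObj S (fst X))"
  using is_barD[OF R, of 0] is_barD[OF R, of "Suc 0"] by (simp_all add: numeral_2_eq_2)

text \<open>
  The dictionary: since transposition is injective, each cocone equation is equivalent to its
  transpose. Whiskering with \<open>s\<^sub>0\<close>, \<open>d\<^sub>0\<close> and the middle face transposes to whiskering with \<open>\<eta>\<close>, \<open>S x\<close> and \<open>\<mu>\<close>,
  and whiskering with the last face transposes to \<open>b S(-)\<close>.
\<close>

lemma cocone_iff_lax_mor:
  assumes "Z \<in> Obj A" "f0 \<in> Arr A" "Dom A f0 = on_Obj P (fst X)" "Cod A f0 = Z"
    "f1 \<in> Cell A" "Src A f1 = f0 \<cdot>\<^bsub>A\<^esub> c (fst X)" "Tgt A f1 = f0 \<cdot>\<^bsub>A\<^esub> on_Arr P (snd X)"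
  shows "is_cocone A R Z f0 f1
    \<longleftrightarrow> is_lax_mor L S (LaxMor X (lifted Z) (flat (fst X) f0) (flat2 (mObj S (fst X)) f1))"
proof -
  let ?X = "fst X" and ?x = "snd X"
  let ?SX = "mObj S ?X"
  let ?SSX = "mObj S ?SX"
  have unit: "f1 \<rhd>\<^bsub>A\<^esub> on_Arr P (Unit S ?X) = Idc A f0
      \<longleftrightarrow> flat2 ?SX f1 \<rhd>\<^bsub>L\<^esub> Unit S ?X = Idc L (flat ?X f0)"
  proof -
    have "f1 \<rhd>\<^bsub>A\<^esub> on_Arr P (Unit S ?X) = Idc A f0
        \<longleftrightarrow> flat2 ?X (f1 \<rhd>\<^bsub>A\<^esub> on_Arr P (Unit S ?X)) = flat2 ?X (Idc A f0)"
      using assms by (subst flat2_inject) simp_all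
    also have "\<dots> \<longleftrightarrow> flat2 ?SX f1 \<rhd>\<^bsub>L\<^esub> Unit S ?X = Idc L (flat ?X f0)"
      using assms by (subst flat2_precomp) (simp_all add: flat2_Idc)
    finally show ?thesis .
  qed
  have x2: "on_Arr P ?x \<cdot>\<^bsub>A\<^esub> on_Arr P (mArr S ?x) = on_Arr P ?x \<cdot>\<^bsub>A\<^esub> on_Arr P (Mult S ?X)"
  proof -
    have "on_Arr P (?x \<cdot>\<^bsub>L\<^esub> mArr S ?x) = on_Arr P (?x \<cdot>\<^bsub>L\<^esub> Mult S ?X)"
      by simp
    then show ?thesis
      by (simp del: S.algebraD(6))
  qed
  have mult: "(f1 \<rhd>\<^bsub>A\<^esub> on_Arr P (mArr S ?x)) \<bullet>\<^bsub>A\<^esub> (f1 \<rhd>\<^bsub>A\<^esub> c ?SX) = f1 \<rhd>\<^bsub>A\<^esub> on_Arr P (Mult S ?X)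
      \<longleftrightarrow> flat2 ?SX f1 \<rhd>\<^bsub>L\<^esub> Mult S ?X
        = (flat2 ?SX f1 \<rhd>\<^bsub>L\<^esub> mArr S ?x) \<bullet>\<^bsub>L\<^esub> (action Z \<lhd>\<^bsub>L\<^esub> mCell S (flat2 ?SX f1))"
  proof -
    have "(f1 \<rhd>\<^bsub>A\<^esub> on_Arr P (mArr S ?x)) \<bullet>\<^bsub>A\<^esub> (f1 \<rhd>\<^bsub>A\<^esub> c ?SX) = f1 \<rhd>\<^bsub>A\<^esub> on_Arr P (Mult S ?X)
        \<longleftrightarrow> flat2 ?SSX ((f1 \<rhd>\<^bsub>A\<^esub> on_Arr P (mArr S ?x)) \<bullet>\<^bsub>A\<^esub> (f1 \<rhd>\<^bsub>A\<^esub> c ?SX))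
            = flat2 ?SSX (f1 \<rhd>\<^bsub>A\<^esub> on_Arr P (Mult S ?X))"
      using assms by (subst flat2_inject) (simp_all add: act_natural act_mult x2)
    also have "flat2 ?SSX ((f1 \<rhd>\<^bsub>A\<^esub> on_Arr P (mArr S ?x)) \<bullet>\<^bsub>A\<^esub> (f1 \<rhd>\<^bsub>A\<^esub> c ?SX))
        = flat2 ?SSX (f1 \<rhd>\<^bsub>A\<^esub> on_Arr P (mArr S ?x)) \<bullet>\<^bsub>L\<^esub> flat2 ?SSX (f1 \<rhd>\<^bsub>A\<^esub> c ?SX)"
      using assms by (subst flat2_vcomp) (simp_all add: act_natural)
    finally show ?thesis
      using assms by (auto simp: eq_commute)
  qed
  have "is_cocone A R Z f0 f1 \<longleftrightarrow> f1 \<rhd>\<^bsub>A\<^esub> on_Arr P (Unit S ?X) = Idc A f0 \<and>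
     (f1 \<rhd>\<^bsub>A\<^esub> on_Arr P (mArr S ?x)) \<bullet>\<^bsub>A\<^esub> (f1 \<rhd>\<^bsub>A\<^esub> c ?SX) = f1 \<rhd>\<^bsub>A\<^esub> on_Arr P (Mult S ?X)"
    using assms by (simp add: is_cocone_def Hom_iff Hom2_iff)
  also have "\<dots> \<longleftrightarrow> is_lax_mor L S (LaxMor X (lifted Z) (flat ?X f0) (flat2 ?SX f1))"
    unfolding unit mult is_lax_mor_iff lax_mor.sel using assms by simp
  finally show ?thesis .
qed

lemma coconeD:
  assumes "is_cocone A R Z f0 f1"
  shows "Z \<in> Obj A" "f0 \<in> Arr A" "Dom A f0 = on_Obj P (fst X)" "Cod A f0 = Z"
    "f1 \<in> Cell A" "Src A f1 = f0 \<cdot>\<^bsub>A\<^esub> c (fst X)" "Tgt A f1 = f0 \<cdot>\<^bsub>A\<^esub> on_Arr P (snd X)"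
    "is_lax_mor L S (LaxMor X (lifted Z) (flat (fst X) f0) (flat2 (mObj S (fst X)) f1))"
proof -
  show 1: "Z \<in> Obj A" "f0 \<in> Arr A" "Dom A f0 = on_Obj P (fst X)" "Cod A f0 = Z"
    "f1 \<in> Cell A" "Src A f1 = f0 \<cdot>\<^bsub>A\<^esub> c (fst X)" "Tgt A f1 = f0 \<cdot>\<^bsub>A\<^esub> on_Arr P (snd X)"
    using assms by (simp_all add: is_cocone_def Hom_iff Hom2_iff)
  show "is_lax_mor L S (LaxMor X (lifted Z) (flat (fst X) f0) (flat2 (mObj S (fst X)) f1))"
    using assms cocone_iff_lax_mor[OF 1] by simp
qed

lemma cocone_of_lax_mor:
  assumes m: "is_lax_mor L S m" "lm_dom m = X" "lm_cod m = lifted Z" and Z: "Z \<in> Obj A"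
  shows "is_cocone A R Z (sharp Z (lm_arr m)) (sharp2 Z (lm_cell m))"
    and "LaxMor X (lifted Z) (flat (fst X) (sharp Z (lm_arr m)))
      (flat2 (mObj S (fst X)) (sharp2 Z (lm_cell m))) = m"
proof -
  let ?X = "fst X"
  have [simp]: "lm_arr m \<in> Arr L" "Dom L (lm_arr m) = ?X" "Cod L (lm_arr m) = on_Obj U Z"
    "lm_cell m \<in> Cell L" "Src L (lm_cell m) = action Z \<cdot>\<^bsub>L\<^esub> mArr S (lm_arr m)"
    "Tgt L (lm_cell m) = lm_arr m \<cdot>\<^bsub>L\<^esub> snd X"
    using S.lax_morD[OF m(1)] m(2,3) by simp_all
  show eq: "LaxMor X (lifted Z) (flat ?X (sharp Z (lm_arr m)))
      (flat2 (mObj S ?X) (sharp2 Z (lm_cell m))) = m"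
    using m(2,3) Z by (intro lax_mor_eqI) simp_all
  have "sharp Z (action Z \<cdot>\<^bsub>L\<^esub> mArr S (lm_arr m)) = sharp Z (lm_arr m) \<cdot>\<^bsub>A\<^esub> c ?X"
  proof -
    have "action Z \<cdot>\<^bsub>L\<^esub> mArr S (lm_arr m) = flat (mObj S ?X) (sharp Z (lm_arr m) \<cdot>\<^bsub>A\<^esub> c ?X)"
      using Z by simp
    then show ?thesis
      using Z by (simp del: flat_act)
  qed
  moreover have "sharp Z (lm_arr m \<cdot>\<^bsub>L\<^esub> snd X) = sharp Z (lm_arr m) \<cdot>\<^bsub>A\<^esub> on_Arr P (snd X)"
    using Z by (simp add: sharp_def)
  ultimately show "is_cocone A R Z (sharp Z (lm_arr m)) (sharp2 Z (lm_cell m))"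
    using Z m eq by (subst cocone_iff_lax_mor) simp_all
qed

lemma lax_comp_cocone:
  assumes "is_cocone A R Q q0 q1" "f \<in> Arr A" "Dom A f = Q" "Cod A f = Z"
  shows "lax_comp L S (on_Arr Jf f) (LaxMor X (lifted Q) (flat (fst X) q0) (flat2 (mObj S (fst X)) q1))
    = LaxMor X (lifted Z) (flat (fst X) (f \<cdot>\<^bsub>A\<^esub> q0)) (flat2 (mObj S (fst X)) (f \<lhd>\<^bsub>A\<^esub> q1))"
proof -
  note [simp] = coconeD(1-7)[OF assms(1)] assms(2-4)
  show ?thesis
    by (intro lax_mor_eqI) (simp_all add: flat_postcomp[of _ q0 f] flat2_postcomp)
qed

text \<open>
  On the side of lax morphisms this is closure under composition.
\<close>

lemma cocone_postcomp:
  assumes q: "is_cocone A R Q q0 q1" and f: "f \<in> Arr A" "Dom A f = Q" "Cod A f = Z"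
  shows "is_cocone A R Z (f \<cdot>\<^bsub>A\<^esub> q0) (f \<lhd>\<^bsub>A\<^esub> q1)"
proof -
  have "is_lax_mor L S (lax_comp L S (on_Arr Jf f)
      (LaxMor X (lifted Q) (flat (fst X) q0) (flat2 (mObj S (fst X)) q1)))"
    using f coconeD(8)[OF q] by (intro S.lax_comp_is_lax_mor) simp_all
  then show ?thesis
    unfolding lax_comp_cocone[OF q f]
    using f coconeD(1-7)[OF q] by (subst cocone_iff_lax_mor) auto
qed

text \<open>
  Under transposition the factorisations of a cocone through \<open>(q\<^sub>0, q\<^sub>1)\<close> are exactly the strict morphisms
  that exhibit the corresponding lax morphism as a composite with the given one, and similarly for
  2-cells.
\<close>

theorem codescent_universal:
  assumes "is_codescent_cocone A R Q q0 q1"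
  shows "universal_2arrow (Alg_l L S) A Jf X Q
    (LaxMor X (lifted Q) (flat (fst X) q0) (flat2 (mObj S (fst X)) q1))"
proof -
  let ?X = "fst X"
  let ?SX = "mObj S ?X"
  let ?u = "LaxMor X (lifted Q) (flat ?X q0) (flat2 ?SX q1)"
  have q: "is_cocone A R Q q0 q1"
    using assms by (simp add: is_codescent_cocone_def)
  note qD [simp] = coconeD(1-7)[OF q]
  have "\<exists>!f. f \<in> Hom A Q Z \<and> lax_comp L S (on_Arr Jf f) ?u = m"
    if Z: "Z \<in> Obj A" and m: "is_lax_mor L S m" "lm_dom m = X" "lm_cod m = lifted Z" for Z m
  proof -
    let ?f0 = "sharp Z (lm_arr m)" and ?f1 = "sharp2 Z (lm_cell m)"
    have c: "is_cocone A R Z ?f0 ?f1" and eq: "LaxMor X (lifted Z) (flat ?X ?f0) (flat2 ?SX ?f1) = m"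
      using cocone_of_lax_mor[OF m Z] by simp_all
    note cD = coconeD(1-7)[OF c]
    have "f \<in> Hom A Q Z \<and> lax_comp L S (on_Arr Jf f) ?u = m
        \<longleftrightarrow> is_factorisation A Q q0 q1 Z ?f0 ?f1 f" for f
    proof (cases "f \<in> Hom A Q Z")
      case True
      then have f: "f \<in> Arr A" "Dom A f = Q" "Cod A f = Z"
        by (simp_all add: Hom_iff)
      have "lax_comp L S (on_Arr Jf f) ?u = m
         \<longleftrightarrow> flat ?X (f \<cdot>\<^bsub>A\<^esub> q0) = flat ?X ?f0 \<and> flat2 ?SX (f \<lhd>\<^bsub>A\<^esub> q1) = flat2 ?SX ?f1"
        unfolding lax_comp_cocone[OF q f] by (subst eq[symmetric]) simp
      also have "\<dots> \<longleftrightarrow> f \<cdot>\<^bsub>A\<^esub> q0 = ?f0 \<and> f \<lhd>\<^bsub>A\<^esub> q1 = ?f1"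
        using f cD by (subst flat_inject flat2_inject; simp)+
      finally show ?thesis
        using True by (simp add: is_factorisation_def)
    qed (simp add: is_factorisation_def)
    moreover have "\<exists>!f. is_factorisation A Q q0 q1 Z ?f0 ?f1 f"
      using assms c unfolding is_codescent_cocone_def by blast
    ultimately show ?thesis by simp
  qed
  moreover have "\<exists>!\<psi>. \<psi> \<in> Hom2 A f f' \<and> on_Cell Jf \<psi> \<rhd>\<^bsub>Alg_l L S\<^esub> ?u = w"
    if f: "f \<in> Hom A Q Z" and f': "f' \<in> Hom A Q Z"
      and w: "is_alg_cell L S w" "ac_src w = lax_comp L S (on_Arr Jf f) ?u"
        "ac_tgt w = lax_comp L S (on_Arr Jf f') ?u" for Z f f' w
  proof -
    have fD: "f \<in> Arr A" "Dom A f = Q" "Cod A f = Z" "f' \<in> Arr A" "Dom A f' = Q" "Cod A f' = Z"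
      using f f' by (simp_all add: Hom_iff)
    have Z: "Z \<in> Obj A" using fD by auto
    let ?\<phi> = "ac_cell w"
    have src: "ac_src w = LaxMor X (lifted Z) (flat ?X (f \<cdot>\<^bsub>A\<^esub> q0)) (flat2 ?SX (f \<lhd>\<^bsub>A\<^esub> q1))"
      and tgt: "ac_tgt w = LaxMor X (lifted Z) (flat ?X (f' \<cdot>\<^bsub>A\<^esub> q0)) (flat2 ?SX (f' \<lhd>\<^bsub>A\<^esub> q1))"
      unfolding w using lax_comp_cocone[OF q] fD by simp_all
    have \<phi> [simp]: "?\<phi> \<in> Cell L" "Src L ?\<phi> = flat ?X (f \<cdot>\<^bsub>A\<^esub> q0)" "Tgt L ?\<phi> = flat ?X (f' \<cdot>\<^bsub>A\<^esub> q0)"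
      using S.alg_cellD[OF w(1)] src tgt by simp_all
    \<comment> \<open>the 2-cell of cocones to which \<open>w\<close> corresponds\<close>
    define \<theta> where "\<theta> = sharp2 Z ?\<phi>"
    have flat_\<theta>: "flat2 ?X \<theta> = ?\<phi>"
      unfolding \<theta>_def using fD Z by simp
    have \<theta>: "\<theta> \<in> Cell A" "Src A \<theta> = f \<cdot>\<^bsub>A\<^esub> q0" "Tgt A \<theta> = f' \<cdot>\<^bsub>A\<^esub> q0"
      unfolding \<theta>_def using fD Z by simp_all
    have bd: "(f \<cdot>\<^bsub>A\<^esub> q0) \<cdot>\<^bsub>A\<^esub> on_Arr P (snd X) = f \<cdot>\<^bsub>A\<^esub> (q0 \<cdot>\<^bsub>A\<^esub> on_Arr P (snd X))"
      "(f' \<cdot>\<^bsub>A\<^esub> q0) \<cdot>\<^bsub>A\<^esub> c ?X = f' \<cdot>\<^bsub>A\<^esub> (q0 \<cdot>\<^bsub>A\<^esub> c ?X)"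
      using fD by simp_all
    have "flat2 ?SX ((\<theta> \<rhd>\<^bsub>A\<^esub> on_Arr P (snd X)) \<bullet>\<^bsub>A\<^esub> (f \<lhd>\<^bsub>A\<^esub> q1))
        = (?\<phi> \<rhd>\<^bsub>L\<^esub> snd X) \<bullet>\<^bsub>L\<^esub> flat2 ?SX (f \<lhd>\<^bsub>A\<^esub> q1)"
      using fD \<theta> by (simp add: flat2_vcomp flat_\<theta>)
    also have "\<dots> = flat2 ?SX (f' \<lhd>\<^bsub>A\<^esub> q1) \<bullet>\<^bsub>L\<^esub> (action Z \<lhd>\<^bsub>L\<^esub> mCell S ?\<phi>)"
      using S.alg_cell_coherence[OF w(1)] unfolding src tgt by simp
    also have "\<dots> = flat2 ?SX ((f' \<lhd>\<^bsub>A\<^esub> q1) \<bullet>\<^bsub>A\<^esub> (\<theta> \<rhd>\<^bsub>A\<^esub> c ?X))"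
      using fD \<theta> by (simp add: flat2_vcomp flat_\<theta>)
    finally have "(\<theta> \<rhd>\<^bsub>A\<^esub> on_Arr P (snd X)) \<bullet>\<^bsub>A\<^esub> (f \<lhd>\<^bsub>A\<^esub> q1) = (f' \<lhd>\<^bsub>A\<^esub> q1) \<bullet>\<^bsub>A\<^esub> (\<theta> \<rhd>\<^bsub>A\<^esub> c ?X)"
      using fD \<theta> by (subst (asm) flat2_inject) simp_all
    moreover have "is_cocone A R Z (f \<cdot>\<^bsub>A\<^esub> q0) (f \<lhd>\<^bsub>A\<^esub> q1)" "is_cocone A R Z (f' \<cdot>\<^bsub>A\<^esub> q0) (f' \<lhd>\<^bsub>A\<^esub> q1)"
      using cocone_postcomp[OF q] fD by simp_all
    moreover have "is_factorisation A Q q0 q1 Z (f \<cdot>\<^bsub>A\<^esub> q0) (f \<lhd>\<^bsub>A\<^esub> q1) f"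
      "is_factorisation A Q q0 q1 Z (f' \<cdot>\<^bsub>A\<^esub> q0) (f' \<lhd>\<^bsub>A\<^esub> q1) f'"
      using f f' by (simp_all add: is_factorisation_def)
    moreover have "\<theta> \<in> Hom2 A (f \<cdot>\<^bsub>A\<^esub> q0) (f' \<cdot>\<^bsub>A\<^esub> q0)"
      using \<theta> by (simp add: Hom2_iff)
    ultimately have "\<exists>!\<psi>. \<psi> \<in> Hom2 A f f' \<and> \<psi> \<rhd>\<^bsub>A\<^esub> q0 = \<theta>"
      using assms unfolding is_codescent_cocone_def by simp
    moreover have "\<psi> \<in> Hom2 A f f' \<and> on_Cell Jf \<psi> \<rhd>\<^bsub>Alg_l L S\<^esub> ?u = w
        \<longleftrightarrow> \<psi> \<in> Hom2 A f f' \<and> \<psi> \<rhd>\<^bsub>A\<^esub> q0 = \<theta>" for \<psi>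
    proof (cases "\<psi> \<in> Hom2 A f f'")
      case True
      then have \<psi>: "\<psi> \<in> Cell A" "Src A \<psi> = f" "Tgt A \<psi> = f'"
        by (simp_all add: Hom2_iff)
      have "on_Cell Jf \<psi> \<rhd>\<^bsub>Alg_l L S\<^esub> ?u = w \<longleftrightarrow> on_Cell U \<psi> \<rhd>\<^bsub>L\<^esub> flat ?X q0 = ?\<phi>"
        using \<psi> w(2,3) fD by (cases w) auto
      also have "on_Cell U \<psi> \<rhd>\<^bsub>L\<^esub> flat ?X q0 = flat2 ?X (\<psi> \<rhd>\<^bsub>A\<^esub> q0)"
        using \<psi> fD by (simp add: flat2_whisker)
      also have "\<dots> = ?\<phi> \<longleftrightarrow> \<psi> \<rhd>\<^bsub>A\<^esub> q0 = \<theta>"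
        unfolding flat_\<theta>[symmetric] using \<psi> fD \<theta> by (subst flat2_inject) simp_all
      finally show ?thesis
        using True by simp
    qed simp
    ultimately show ?thesis by simp
  qed
  ultimately show ?thesis
    using coconeD(8)[OF q] unfolding universal_2arrow_def
    by (simp add: Hom_iff Hom2_iff)
qed

end

theorem left_2adjoint_codescent:
  assumes R: "\<And>X. is_algebra L S X \<Longrightarrow> is_bar X (R X)"
    and Q: "\<And>X. is_algebra L S X \<Longrightarrow> is_codescent_object A (R X) (Q X)"
  shows "\<exists>H. left_2adjoint (Alg_l L S) A H Jf \<and> (\<forall>X \<in> Obj (Alg_l L S). on_Obj H X = Q X)"
proof -
  have "\<exists>u. universal_2arrow (Alg_l L S) A Jf X (Q X) u" if "is_algebra L S X" for X
    using Q[OF that] codescent_universal[OF that R[OF that]]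
    unfolding is_codescent_object_def by blast
  then obtain u where "universal_2arrow (Alg_l L S) A Jf X (Q X) (u X)" if "is_algebra L S X" for X
    by metis
  then interpret univ: universal_2arrows "Alg_l L S" A Jf Q u
    by (intro universal_2arrows.intro universal_2arrows_axioms.intro two_functor_J) simp
  show ?thesis
    using univ.adjunction unfolding left_2adjoint_def by (intro exI[of _ univ.adjoint]) auto
qed

end


section \<open>Adjunctions of 2-monads as right actions of free algebras\<close>

text \<open>
  Composites of 2-adjunctions serve to combine \<open>F\<^sub>! \<stileturn> F\<^sup>*\<close> with the free-forgetful adjunction.
\<close>

lemma comp_adjunction:
  assumes "two_adjunction C D F G \<eta> \<epsilon>" "two_adjunction D E F' G' \<eta>' \<epsilon>'"
  shows "two_adjunction C E (F' \<otimes> F) (G \<otimes> G')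
    (\<lambda>X. on_Arr G (\<eta>' (on_Obj F X)) \<cdot>\<^bsub>C\<^esub> \<eta> X) (\<lambda>Z. \<epsilon>' Z \<cdot>\<^bsub>E\<^esub> on_Arr F' (\<epsilon> (on_Obj G' Z)))"
proof -
  interpret a: two_adjunction C D F G \<eta> \<epsilon> by fact
  interpret b: two_adjunction D E F' G' \<eta>' \<epsilon>' by fact
  have eta [simp]: "\<eta> X \<in> Arr C" "Dom C (\<eta> X) = X" "Cod C (\<eta> X) = on_Obj G (on_Obj F X)" if "X \<in> Obj C" for X
    using a.eta.component_Arr[OF that] by simp_all
  have eps [simp]: "\<epsilon> Y \<in> Arr D" "Dom D (\<epsilon> Y) = on_Obj F (on_Obj G Y)" "Cod D (\<epsilon> Y) = Y" if "Y \<in> Obj D" for Y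
    using a.eps.component_Arr[OF that] by simp_all
  have eta' [simp]: "\<eta>' X \<in> Arr D" "Dom D (\<eta>' X) = X" "Cod D (\<eta>' X) = on_Obj G' (on_Obj F' X)" if "X \<in> Obj D" for X
    using b.eta.component_Arr[OF that] by simp_all
  have eps' [simp]: "\<epsilon>' Y \<in> Arr E" "Dom E (\<epsilon>' Y) = on_Obj F' (on_Obj G' Y)" "Cod E (\<epsilon>' Y) = Y" if "Y \<in> Obj E" for Y
    using b.eps.component_Arr[OF that] by simp_all
  have FF: "two_functor C E (F' \<otimes> F)" and GG: "two_functor E C (G \<otimes> G')"
    by (rule two_functor_comp2; rule a.F.two_functor_axioms b.F.two_functor_axioms
        a.G.two_functor_axioms b.G.two_functor_axioms)+
  have "two_natural C C id2 ((G \<otimes> G') \<otimes> (F' \<otimes> F)) (\<lambda>X. on_Arr G (\<eta>' (on_Obj F X)) \<cdot>\<^bsub>C\<^esub> \<eta> X)"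
  proof (rule two_naturalI[OF two_functor_id2[OF a.F.C.two_category_axioms] two_functor_comp2[OF FF GG]], goal_cases)
    case (2 f)
    have "on_Arr G (\<eta>' (on_Obj F (Cod C f))) \<cdot>\<^bsub>C\<^esub> (\<eta> (Cod C f) \<cdot>\<^bsub>C\<^esub> f)
        = on_Arr G (\<eta>' (on_Obj F (Cod C f)) \<cdot>\<^bsub>D\<^esub> on_Arr F f) \<cdot>\<^bsub>C\<^esub> \<eta> (Dom C f)"
      using 2 a.eta.natural_Arr[of f] by simp
    also have "\<dots> = on_Arr G (on_Arr G' (on_Arr F' (on_Arr F f)) \<cdot>\<^bsub>D\<^esub> \<eta>' (on_Obj F (Dom C f))) \<cdot>\<^bsub>C\<^esub> \<eta> (Dom C f)"
      using 2 b.eta.natural_Arr[of "on_Arr F f"] by (simp del: a.G.F_comp_Arr)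
    finally show ?case
      using 2 by simp
  next
    case (3 \<alpha>)
    let ?X = "Dom C (Src C \<alpha>)" and ?Y = "Cod C (Src C \<alpha>)"
    have "on_Arr G (\<eta>' (on_Obj F ?Y)) \<lhd>\<^bsub>C\<^esub> (\<eta> ?Y \<lhd>\<^bsub>C\<^esub> \<alpha>)
        = on_Cell G (\<eta>' (on_Obj F ?Y) \<lhd>\<^bsub>D\<^esub> on_Cell F \<alpha>) \<rhd>\<^bsub>C\<^esub> \<eta> ?X"
      using 3 a.eta.natural_Cell[of \<alpha>] by (simp del: a.F.C.lwhisker_lwhisker)
    also have "\<dots> = on_Cell G (on_Cell G' (on_Cell F' (on_Cell F \<alpha>)) \<rhd>\<^bsub>D\<^esub> \<eta>' (on_Obj F ?X)) \<rhd>\<^bsub>C\<^esub> \<eta> ?X"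
      using 3 b.eta.natural_Cell[of "on_Cell F \<alpha>"] by (simp del: a.G.F_hcomp_Cell)
    finally show ?case
      using 3 by simp
  qed simp
  moreover have "two_natural E E ((F' \<otimes> F) \<otimes> (G \<otimes> G')) id2 (\<lambda>Z. \<epsilon>' Z \<cdot>\<^bsub>E\<^esub> on_Arr F' (\<epsilon> (on_Obj G' Z)))"
  proof (rule two_naturalI[OF two_functor_comp2[OF GG FF] two_functor_id2[OF b.F.D.two_category_axioms]], goal_cases)
    case (2 f)
    have "\<epsilon>' (Cod E f) \<cdot>\<^bsub>E\<^esub> on_Arr F' (\<epsilon> (on_Obj G' (Cod E f)) \<cdot>\<^bsub>D\<^esub> on_Arr F (on_Arr G (on_Arr G' f)))
        = \<epsilon>' (Cod E f) \<cdot>\<^bsub>E\<^esub> on_Arr F' (on_Arr G' f \<cdot>\<^bsub>D\<^esub> \<epsilon> (on_Obj G' (Dom E f)))"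
      using 2 a.eps.natural_Arr[of "on_Arr G' f"] by (simp del: b.F.F_comp_Arr)
    also have "\<dots> = f \<cdot>\<^bsub>E\<^esub> (\<epsilon>' (Dom E f) \<cdot>\<^bsub>E\<^esub> on_Arr F' (\<epsilon> (on_Obj G' (Dom E f))))"
      using 2 b.eps.natural_Arr_assoc[of f "Cod E f" "on_Arr F' (\<epsilon> (on_Obj G' (Dom E f)))"] by simp
    finally show ?case
      using 2 by simp
  next
    case (3 \<alpha>)
    let ?X = "Dom E (Src E \<alpha>)" and ?Y = "Cod E (Src E \<alpha>)"
    have "\<epsilon>' ?Y \<lhd>\<^bsub>E\<^esub> on_Cell F' (\<epsilon> (on_Obj G' ?Y) \<lhd>\<^bsub>D\<^esub> on_Cell F (on_Cell G (on_Cell G' \<alpha>)))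
        = \<epsilon>' ?Y \<lhd>\<^bsub>E\<^esub> on_Cell F' (on_Cell G' \<alpha> \<rhd>\<^bsub>D\<^esub> \<epsilon> (on_Obj G' ?X))"
      using 3 a.eps.natural_Cell[of "on_Cell G' \<alpha>"] by (simp del: b.F.F_hcomp_Cell)
    also have "\<dots> = (\<epsilon>' ?Y \<lhd>\<^bsub>E\<^esub> on_Cell F' (on_Cell G' \<alpha>)) \<rhd>\<^bsub>E\<^esub> on_Arr F' (\<epsilon> (on_Obj G' ?X))"
      using 3 by simp
    also have "\<dots> = \<alpha> \<rhd>\<^bsub>E\<^esub> (\<epsilon>' ?X \<cdot>\<^bsub>E\<^esub> on_Arr F' (\<epsilon> (on_Obj G' ?X)))"
      using 3 b.eps.natural_Cell[of \<alpha>] by simp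
    finally show ?case
      using 3 by simp
  qed simp
  moreover have "\<epsilon>' (on_Obj F' (on_Obj F X)) \<cdot>\<^bsub>E\<^esub> on_Arr F' (\<epsilon> (on_Obj G' (on_Obj F' (on_Obj F X))))
      \<cdot>\<^bsub>E\<^esub> on_Arr F' (on_Arr F (on_Arr G (\<eta>' (on_Obj F X)) \<cdot>\<^bsub>C\<^esub> \<eta> X)) = Ide E (on_Obj F' (on_Obj F X))"
    if X: "X \<in> Obj C" for X
  proof -
    let ?Y = "on_Obj F X"
    have "on_Arr F' (\<epsilon> (on_Obj G' (on_Obj F' ?Y))) \<cdot>\<^bsub>E\<^esub> on_Arr F' (on_Arr F (on_Arr G (\<eta>' ?Y) \<cdot>\<^bsub>C\<^esub> \<eta> X))
        = on_Arr F' (\<epsilon> (on_Obj G' (on_Obj F' ?Y)) \<cdot>\<^bsub>D\<^esub> (on_Arr F (on_Arr G (\<eta>' ?Y)) \<cdot>\<^bsub>D\<^esub> on_Arr F (\<eta> X)))"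
      using X by simp
    also have "\<dots> = on_Arr F' (\<eta>' ?Y \<cdot>\<^bsub>D\<^esub> (\<epsilon> ?Y \<cdot>\<^bsub>D\<^esub> on_Arr F (\<eta> X)))"
      using X a.eps.natural_Arr_assoc[of "\<eta>' ?Y" _ "on_Arr F (\<eta> X)"] by (simp del: b.F.F_comp_Arr)
    also have "\<dots> = on_Arr F' (\<eta>' ?Y)"
      using X a.triangle_F[OF X] by simp
    finally show ?thesis
      using X b.triangle_F[of ?Y] by simp
  qed
  moreover have "on_Arr G (on_Arr G' (\<epsilon>' Z \<cdot>\<^bsub>E\<^esub> on_Arr F' (\<epsilon> (on_Obj G' Z)))) \<cdot>\<^bsub>C\<^esub>
      (on_Arr G (\<eta>' (on_Obj F (on_Obj G (on_Obj G' Z)))) \<cdot>\<^bsub>C\<^esub> \<eta> (on_Obj G (on_Obj G' Z)))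
      = Ide C (on_Obj G (on_Obj G' Z))" if Z: "Z \<in> Obj E" for Z
  proof -
    let ?Y = "on_Obj G' Z"
    have "on_Arr G (on_Arr G' (\<epsilon>' Z \<cdot>\<^bsub>E\<^esub> on_Arr F' (\<epsilon> ?Y))) \<cdot>\<^bsub>C\<^esub>
        (on_Arr G (\<eta>' (on_Obj F (on_Obj G ?Y))) \<cdot>\<^bsub>C\<^esub> \<eta> (on_Obj G ?Y))
      = on_Arr G (on_Arr G' (\<epsilon>' Z) \<cdot>\<^bsub>D\<^esub> (on_Arr G' (on_Arr F' (\<epsilon> ?Y)) \<cdot>\<^bsub>D\<^esub> \<eta>' (on_Obj F (on_Obj G ?Y))))
        \<cdot>\<^bsub>C\<^esub> \<eta> (on_Obj G ?Y)"
      using Z by simp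
    also have "on_Arr G' (on_Arr F' (\<epsilon> ?Y)) \<cdot>\<^bsub>D\<^esub> \<eta>' (on_Obj F (on_Obj G ?Y)) = \<eta>' ?Y \<cdot>\<^bsub>D\<^esub> \<epsilon> ?Y"
      using Z b.eta.natural_Arr[of "\<epsilon> ?Y" ?Y] by simp
    also have "on_Arr G' (\<epsilon>' Z) \<cdot>\<^bsub>D\<^esub> (\<eta>' ?Y \<cdot>\<^bsub>D\<^esub> \<epsilon> ?Y) = (on_Arr G' (\<epsilon>' Z) \<cdot>\<^bsub>D\<^esub> \<eta>' ?Y) \<cdot>\<^bsub>D\<^esub> \<epsilon> ?Y"
      using Z by simp
    also have "\<dots> = \<epsilon> ?Y"
      unfolding b.triangle_G[OF Z] using Z by simp
    finally show ?thesis
      using Z a.triangle_G[of ?Y] by simp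
  qed
  ultimately show ?thesis
    by (intro two_adjunction.intro two_adjunction_axioms.intro) (simp_all add: FF GG)
qed

definition free2 :: "('o, 'm, 'c) twocat \<Rightarrow> ('o, 'm, 'c) monad2
    \<Rightarrow> ('o, 'm, 'c, ('o, 'm) alg, ('o, 'm, 'c) lax_mor, ('o, 'm, 'c) alg_cell) twofun" where
  "free2 K T = (let fr = (\<lambda>f. strict_mor K (free_alg T (Dom K f)) (free_alg T (Cod K f)) (mArr T f)) in
    \<lparr>on_Obj = free_alg T, on_Arr = fr, on_Cell = \<lambda>\<alpha>. AlgCell (fr (Src K \<alpha>)) (fr (Tgt K \<alpha>)) (mCell T \<alpha>)\<rparr>)"

definition forget2 :: "(('o, 'm) alg, ('o, 'm, 'c) lax_mor, ('o, 'm, 'c) alg_cell, 'o, 'm, 'c) twofun" where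
  "forget2 = \<lparr>on_Obj = fst, on_Arr = lm_arr, on_Cell = ac_cell\<rparr>"

lemma free_alg_sel [simp]: "fst (free_alg T A) = mObj T A" "snd (free_alg T A) = Mult T A"
  by (simp_all add: free_alg_def)

lemma free2_sel [simp]:
  "on_Obj (free2 K T) A = free_alg T A"
  "on_Arr (free2 K T) f = strict_mor K (free_alg T (Dom K f)) (free_alg T (Cod K f)) (mArr T f)"
  "on_Cell (free2 K T) \<alpha> = AlgCell (strict_mor K (free_alg T (Dom K (Src K \<alpha>))) (free_alg T (Cod K (Src K \<alpha>))) (mArr T (Src K \<alpha>)))
     (strict_mor K (free_alg T (Dom K (Tgt K \<alpha>))) (free_alg T (Cod K (Tgt K \<alpha>))) (mArr T (Tgt K \<alpha>))) (mCell T \<alpha>)"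
  by (simp_all add: free2_def)

lemma forget2_sel [simp]:
  "on_Obj forget2 P = fst P" "on_Arr forget2 m = lm_arr m" "on_Cell forget2 w = ac_cell w"
  by (simp_all add: forget2_def)

context two_monad
begin

lemma free_alg_is_algebra [simp]: "A \<in> Obj K \<Longrightarrow> is_algebra K T (free_alg T A)"
  by (simp add: is_algebra_iff)

lemma mult_natural2:
  "\<lbrakk>\<alpha> \<in> Cell K; Cod K (Src K \<alpha>) = B\<rbrakk>
    \<Longrightarrow> Mult T B \<lhd>\<^bsub>K\<^esub> mCell T (mCell T \<alpha>) = mCell T \<alpha> \<rhd>\<^bsub>K\<^esub> Mult T (Dom K (Src K \<alpha>))"
  using mu.natural_Cell[of \<alpha> B] by simp

lemma unit_natural2:
  "\<lbrakk>\<alpha> \<in> Cell K; Cod K (Src K \<alpha>) = B\<rbrakk>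
    \<Longrightarrow> Unit T B \<lhd>\<^bsub>K\<^esub> \<alpha> = mCell T \<alpha> \<rhd>\<^bsub>K\<^esub> Unit T (Dom K (Src K \<alpha>))"
  using eta.natural_Cell[of \<alpha> B] by simp

lemma free_mor_is_lax_mor [simp]:
  "\<lbrakk>f \<in> Arr K; Dom K f = A; Cod K f = B\<rbrakk>
    \<Longrightarrow> is_lax_mor K T (strict_mor K (free_alg T A) (free_alg T B) (mArr T f))"
  by (rule strict_mor_is_lax_mor) auto

lemma structure_is_lax_mor [simp]:
  "is_algebra K T Z \<Longrightarrow> is_lax_mor K T (strict_mor K (free_alg T (fst Z)) Z (snd Z))"
  by (rule strict_mor_is_lax_mor) auto

lemma lax_comp_strict_mor:
  assumes "is_lax_mor K T (strict_mor K P Q f)" "is_lax_mor K T (strict_mor K Q R g)"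
  shows "lax_comp K T (strict_mor K Q R g) (strict_mor K P Q f) = strict_mor K P R (g \<cdot>\<^bsub>K\<^esub> f)"
  using lax_morD[OF assms(1)] lax_morD[OF assms(2)] assms by (subst lax_comp_strict) simp_all

lemma two_functor_free: "two_functor K (Alg_s K T) (free2 K T)"
proof (rule two_functorI, goal_cases)
  case (5 \<alpha>)
  then show ?case
    using mult_natural2[of \<alpha> "Cod K (Src K \<alpha>)"]
    by (simp add: is_alg_cell_iff)
next
  case (7 f g)
  then show ?case by (simp add: lax_comp_strict_mor)
next
  case (10 \<alpha> \<beta>)
  then show ?case by (simp add: lax_comp_strict_mor)
qed (simp_all add: two_category_Alg_s eta.F.C.two_category_axioms)

lemma two_functor_forget: "two_functor (Alg_s K T) K forget2"
  by (rule two_functorI) (simp_all add: two_category_Alg_s eta.F.C.two_category_axioms)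

text \<open>
  The counit at an algebra is its own structure map, which is strict by the associativity law. Its
  naturality in strict morphisms is strictness itself, and for 2-cells it is their coherence condition,
  in which the lax structure cells are identities.
\<close>

theorem free_forget_adjunction:
  "two_adjunction K (Alg_s K T) (free2 K T) forget2 (Unit T)
     (\<lambda>Z. strict_mor K (free_alg T (fst Z)) Z (snd Z))"
proof -
  interpret A: two_category "Alg_s K T" by (rule two_category_Alg_s)
  have "two_natural K K id2 (forget2 \<otimes> free2 K T) (Unit T)"
    by (rule two_naturalI[OF two_functor_id2[OF eta.F.C.two_category_axioms]
          two_functor_comp2[OF two_functor_free two_functor_forget]]) (simp_all add: unit_natural2)
  moreover have "two_natural (Alg_s K T) (Alg_s K T) (free2 K T \<otimes> forget2) id2
     (\<lambda>Z. strict_mor K (free_alg T (fst Z)) Z (snd Z))"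
  proof (rule two_naturalI[OF two_functor_comp2[OF two_functor_forget two_functor_free]
        two_functor_id2[OF two_category_Alg_s]], goal_cases)
    case (2 m)
    then show ?case by (simp add: lax_comp_strict)
  next
    case (3 w)
    then have "snd (lm_cod (ac_src w)) \<cdot>\<^bsub>K\<^esub> mArr T (lm_arr (ac_tgt w))
        = lm_arr (ac_tgt w) \<cdot>\<^bsub>K\<^esub> snd (lm_dom (ac_src w))"
      using strictD(2)[of "ac_tgt w"] by simp
    then show ?case
      using 3 alg_cell_coherence[of w] by (simp add: lax_comp_strict)
  qed simp
  moreover have "is_lax_mor K T (strict_mor K (free_alg T (mObj T B)) (free_alg T B) (Mult T B))"
    if "B \<in> Obj K" for B
    using that structure_is_lax_mor[of "free_alg T B"] by simp
  ultimately show ?thesis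
    by (intro two_adjunction.intro two_adjunction_axioms.intro)
      (simp_all add: two_functor_free two_functor_forget lax_comp_strict_mor)
qed

end

context two_monad_adjunction
begin

abbreviation "P \<equiv> free2 K T \<otimes> Lower F"
abbreviation "U \<equiv> Upper F \<otimes> forget2"

definition composite_unit where
  "composite_unit X = on_Arr (Upper F) (Unit T (on_Obj (Lower F) X)) \<cdot>\<^bsub>L\<^esub> AUnit F X"

definition composite_counit where
  "composite_counit Z = strict_mor K (free_alg T (fst Z)) Z (snd Z)
     \<cdot>\<^bsub>Alg_s K T\<^esub> on_Arr (free2 K T) (ACounit F (fst Z))"

text \<open>
  A colax \<open>F\<^sup>c : F\<^sub>! S \<rightarrow> T F\<^sub>!\<close> is the same as a right action on \<open>T F\<^sub>!\<close> by morphisms of free algebras, by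
  the universal property of free algebras.
\<close>

definition right_action where
  "right_action X = strict_mor K (free_alg T (on_Obj (Lower F) (mObj S X))) (free_alg T (on_Obj (Lower F) X))
     (Mult T (on_Obj (Lower F) X) \<cdot>\<^bsub>K\<^esub> mArr T (Colax F X))"

lemma AUnit_boundary [simp]:
  assumes "X \<in> Obj L"
  shows "AUnit F X \<in> Arr L" "Dom L (AUnit F X) = X"
    "Cod L (AUnit F X) = on_Obj (Upper F) (on_Obj (Lower F) X)"
  using adj.eta.component_Arr[OF assms] by simp_all

lemma ACounit_boundary [simp]:
  assumes "Y \<in> Obj K"
  shows "ACounit F Y \<in> Arr K" "Dom K (ACounit F Y) = on_Obj (Lower F) (on_Obj (Upper F) Y)"
    "Cod K (ACounit F Y) = Y"
  using adj.eps.component_Arr[OF assms] by simp_all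

lemma Colax_boundary [simp]:
  assumes "X \<in> Obj L"
  shows "Colax F X \<in> Arr K" "Dom K (Colax F X) = on_Obj (Lower F) (mObj S X)"
    "Cod K (Colax F X) = mObj T (on_Obj (Lower F) X)"
  using colax.component_Arr[OF assms] by simp_all

lemma composite_counit_eq [simp]:
  "is_algebra K T Z \<Longrightarrow> composite_counit Z
    = strict_mor K (free_alg T (on_Obj (Lower F) (on_Obj (Upper F) (fst Z)))) Z
        (snd Z \<cdot>\<^bsub>K\<^esub> mArr T (ACounit F (fst Z)))"
  by (simp add: composite_counit_def T.lax_comp_strict_mor)

lemma composite_adjunction: "two_adjunction L (Alg_s K T) P U composite_unit composite_counit"
  using comp_adjunction[OF adj.two_adjunction_axioms T.free_forget_adjunction]
  unfolding composite_unit_def[abs_def] composite_counit_def[abs_def] forget2_sel .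

lemma right_action_is_lax_mor [simp]:
  assumes "X \<in> Obj L" "mObj S X = Y"
  shows "is_lax_mor K T (strict_mor K (free_alg T (on_Obj (Lower F) Y))
    (free_alg T (on_Obj (Lower F) X)) (Mult T (on_Obj (Lower F) X) \<cdot>\<^bsub>K\<^esub> mArr T (Colax F X)))"
  using assms by (intro T.strict_mor_is_lax_mor) auto

lemma colax_natural:
  "\<lbrakk>h \<in> Arr L; Cod L h = Y\<rbrakk> \<Longrightarrow> Colax F Y \<cdot>\<^bsub>K\<^esub> on_Arr (Lower F) (mArr S h)
     = mArr T (on_Arr (Lower F) h) \<cdot>\<^bsub>K\<^esub> Colax F (Dom L h)"
  using colax.natural_Arr[of h Y] by simp

lemma colax_natural2:
  "\<lbrakk>\<phi> \<in> Cell L; Cod L (Src L \<phi>) = Y\<rbrakk> \<Longrightarrow> Colax F Y \<lhd>\<^bsub>K\<^esub> on_Cell (Lower F) (mCell S \<phi>)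
     = mCell T (on_Cell (Lower F) \<phi>) \<rhd>\<^bsub>K\<^esub> Colax F (Dom L (Src L \<phi>))"
  using colax.natural_Cell[of \<phi> Y] by simp

lemma right_action_natural: "two_natural L (Alg_s K T) (P \<otimes> Fun S) P right_action"
proof -
  interpret a: two_adjunction L "Alg_s K T" P U composite_unit composite_counit
    by (rule composite_adjunction)
  have arr: "(Mult T (on_Obj (Lower F) (Cod L h)) \<cdot>\<^bsub>K\<^esub> mArr T (Colax F (Cod L h)))
        \<cdot>\<^bsub>K\<^esub> mArr T (on_Arr (Lower F) (mArr S h))
      = mArr T (on_Arr (Lower F) h) \<cdot>\<^bsub>K\<^esub> (Mult T (on_Obj (Lower F) (Dom L h)) \<cdot>\<^bsub>K\<^esub> mArr T (Colax F (Dom L h)))"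
    if h: "h \<in> Arr L" for h
  proof -
    have "mArr T (Colax F (Cod L h)) \<cdot>\<^bsub>K\<^esub> mArr T (on_Arr (Lower F) (mArr S h))
        = mArr T (Colax F (Cod L h) \<cdot>\<^bsub>K\<^esub> on_Arr (Lower F) (mArr S h))"
      using h by simp
    also have "\<dots> = mArr T (mArr T (on_Arr (Lower F) h)) \<cdot>\<^bsub>K\<^esub> mArr T (Colax F (Dom L h))"
      using h by (simp add: colax_natural)
    finally show ?thesis
      using h by simp
  qed
  show ?thesis
  proof (rule two_naturalI[OF two_functor_comp2[OF S.eta.G.two_functor_axioms a.F.two_functor_axioms]
        a.F.two_functor_axioms], goal_cases)
    case (1 X)
    then show ?case by (simp add: right_action_def)
  next
    case (2 h)
    then show ?case
      using arr[of h] by (simp add: right_action_def T.lax_comp_strict_mor)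
  next
    case (3 \<phi>)
    let ?X = "Dom L (Src L \<phi>)" and ?Y = "Cod L (Src L \<phi>)"
    let ?l = "on_Cell (Lower F) \<phi>"
    have "(Mult T (on_Obj (Lower F) ?Y) \<cdot>\<^bsub>K\<^esub> mArr T (Colax F ?Y)) \<lhd>\<^bsub>K\<^esub> mCell T (on_Cell (Lower F) (mCell S \<phi>))
      = Mult T (on_Obj (Lower F) ?Y) \<lhd>\<^bsub>K\<^esub> mCell T (Colax F ?Y \<lhd>\<^bsub>K\<^esub> on_Cell (Lower F) (mCell S \<phi>))"
      using 3 by simp
    also have "\<dots> = (Mult T (on_Obj (Lower F) ?Y) \<lhd>\<^bsub>K\<^esub> mCell T (mCell T ?l)) \<rhd>\<^bsub>K\<^esub> mArr T (Colax F ?X)"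
      using 3 by (simp add: colax_natural2)
    also have "\<dots> = mCell T ?l \<rhd>\<^bsub>K\<^esub> (Mult T (on_Obj (Lower F) ?X) \<cdot>\<^bsub>K\<^esub> mArr T (Colax F ?X))"
      using 3 by (simp add: T.mult_natural2)
    finally show ?case
      using 3 arr[of "Src L \<phi>"] arr[of "Tgt L \<phi>"]
      by (simp add: right_action_def T.lax_comp_strict_mor)
  qed
qed

text \<open>
  The unit and multiplication laws of the action are the images under \<open>T\<close> of the two axioms on \<open>F\<^sup>c\<close>,
  composed with \<open>\<mu>\<^sup>T\<close>.
\<close>

lemma free_right_module: "module_adjunction L S (Alg_s K T) P U composite_unit composite_counit right_action"
proof -
  interpret a: two_adjunction L "Alg_s K T" P U composite_unit composite_counit
    by (rule composite_adjunction)
  interpret n: two_natural L "Alg_s K T" "P \<otimes> Fun S" P right_action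
    by (rule right_action_natural)
  have "right_action X \<cdot>\<^bsub>Alg_s K T\<^esub> on_Arr P (Unit S X) = Ide (Alg_s K T) (on_Obj P X)"
    if X: "X \<in> Obj L" for X
  proof -
    let ?Y = "on_Obj (Lower F) X"
    have "mArr T (Colax F X) \<cdot>\<^bsub>K\<^esub> mArr T (on_Arr (Lower F) (Unit S X))
        = mArr T (Colax F X \<cdot>\<^bsub>K\<^esub> on_Arr (Lower F) (Unit S X))"
      using X by simp
    also have "\<dots> = mArr T (Unit T ?Y)"
      using X by (simp add: colax_unit)
    finally show ?thesis
      using X by (simp add: right_action_def T.lax_comp_strict_mor)
  qed
  moreover have "right_action X \<cdot>\<^bsub>Alg_s K T\<^esub> on_Arr P (Mult S X)
      = right_action X \<cdot>\<^bsub>Alg_s K T\<^esub> right_action (mObj S X)" if X: "X \<in> Obj L" for X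
  proof -
    let ?Y = "on_Obj (Lower F) X" and ?Y' = "on_Obj (Lower F) (mObj S X)"
    have "mArr T (Colax F X) \<cdot>\<^bsub>K\<^esub> mArr T (on_Arr (Lower F) (Mult S X))
        = mArr T (Colax F X \<cdot>\<^bsub>K\<^esub> on_Arr (Lower F) (Mult S X))"
      using X by simp
    also have "\<dots> = mArr T (Mult T ?Y) \<cdot>\<^bsub>K\<^esub> (mArr T (mArr T (Colax F X)) \<cdot>\<^bsub>K\<^esub> mArr T (Colax F (mObj S X)))"
      using X by (simp add: colax_mult)
    finally have "Mult T ?Y \<cdot>\<^bsub>K\<^esub> (mArr T (Colax F X) \<cdot>\<^bsub>K\<^esub> mArr T (on_Arr (Lower F) (Mult S X)))
        = Mult T ?Y \<cdot>\<^bsub>K\<^esub> (mArr T (Colax F X) \<cdot>\<^bsub>K\<^esub> (Mult T ?Y' \<cdot>\<^bsub>K\<^esub> mArr T (Colax F (mObj S X))))"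
      using X by simp
    then show ?thesis
      using X by (simp add: right_action_def T.lax_comp_strict_mor)
  qed
  ultimately show ?thesis
    by (intro module_adjunction.intro module_adjunction_axioms.intro)
      (simp_all add: S.two_monad_axioms a.two_adjunction_axioms n.two_natural_axioms)
qed

sublocale M: module_adjunction L S "Alg_s K T" P U composite_unit composite_counit right_action
  by (rule free_right_module)

text \<open>
  The two constructions of the algebra structure on \<open>F\<^sup>*A\<close> differ by a factor \<open>\<mu>\<^sup>T (\<eta>\<^sup>T T) = 1\<close>, because
  one of them transposes along the free-forgetful adjunction in addition to \<open>F\<^sub>! \<stileturn> F\<^sup>*\<close>.
\<close>

lemma action_eq_mate:
  assumes Z: "is_algebra K T Z"
  shows "M.action Z = on_Arr (Upper F) (snd Z) \<cdot>\<^bsub>L\<^esub> mate L S T F (fst Z)"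
proof -
  let ?Y = "on_Obj (Upper F) (fst Z)"
  let ?W = "on_Obj (Lower F) ?Y"
  have "M.action Z = on_Arr (Upper F) ((snd Z \<cdot>\<^bsub>K\<^esub> mArr T (ACounit F (fst Z))) \<cdot>\<^bsub>K\<^esub> (Mult T ?W \<cdot>\<^bsub>K\<^esub> mArr T (Colax F ?Y)))
     \<cdot>\<^bsub>L\<^esub> (on_Arr (Upper F) (Unit T (on_Obj (Lower F) (mObj S ?Y))) \<cdot>\<^bsub>L\<^esub> AUnit F (mObj S ?Y))"
    unfolding M.action_def M.flat_def composite_unit_def right_action_def using Z by simp
  also have "\<dots> = on_Arr (Upper F) ((snd Z \<cdot>\<^bsub>K\<^esub> mArr T (ACounit F (fst Z))) \<cdot>\<^bsub>K\<^esub> (Mult T ?W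
      \<cdot>\<^bsub>K\<^esub> (mArr T (Colax F ?Y) \<cdot>\<^bsub>K\<^esub> Unit T (on_Obj (Lower F) (mObj S ?Y))))) \<cdot>\<^bsub>L\<^esub> AUnit F (mObj S ?Y)"
    using Z by simp
  also have "mArr T (Colax F ?Y) \<cdot>\<^bsub>K\<^esub> Unit T (on_Obj (Lower F) (mObj S ?Y))
      = Unit T (mObj T ?W) \<cdot>\<^bsub>K\<^esub> Colax F ?Y"
    using Z by simp
  also have "Mult T ?W \<cdot>\<^bsub>K\<^esub> (Unit T (mObj T ?W) \<cdot>\<^bsub>K\<^esub> Colax F ?Y)
     = (Mult T ?W \<cdot>\<^bsub>K\<^esub> Unit T (mObj T ?W)) \<cdot>\<^bsub>K\<^esub> Colax F ?Y"
    using Z by (simp del: T.unit_natural T.monad_laws)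
  also have "\<dots> = Colax F ?Y"
    using Z by simp
  finally show ?thesis
    using Z by (simp add: mate_def)
qed

lemma mate_boundary [simp]:
  assumes "Y \<in> Obj K"
  shows "mate L S T F Y \<in> Arr L" "Dom L (mate L S T F Y) = mObj S (on_Obj (Upper F) Y)"
    "Cod L (mate L S T F Y) = on_Obj (Upper F) (mObj T Y)"
  using assms by (simp_all add: mate_def)

lemma J_lifts: "lifted_right_adjoint L S (Alg_s K T) P U composite_unit composite_counit right_action
    (J L S T F)"
proof -
  have obj: "lift_obj L S T F Z = M.lifted Z" if "is_algebra K T Z" for Z
    using action_eq_mate[OF that] by (simp add: lift_obj_def M.lifted_def)
  have arr: "lift_mor L S T F m
      = strict_mor L (M.lifted (lm_dom m)) (M.lifted (lm_cod m)) (on_Arr (Upper F) (lm_arr m))"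
    if m: "is_lax_mor K T m" "is_strict K m" for m
    using m action_eq_mate[of "lm_dom m"]
    by (intro lax_mor_eqI) (simp_all add: lift_mor_def obj)
  show ?thesis
    by (intro lifted_right_adjoint.intro lifted_right_adjoint_axioms.intro M.module_adjunction_axioms)
      (simp_all add: J_def lift2_def obj arr)
qed

lemma Res_is_bar:
  assumes X: "is_algebra L S X"
  shows "M.is_bar X (Res S K T F X)"
proof -
  note [simp] = X S.pow2_Obj[OF X] S.bar_face_boundary[OF X] S.bar_degen_boundary[OF X]
  show ?thesis
    unfolding M.is_bar_def
    by (auto simp: Res_def Res_ob_def Let_def right_action_def; simp add: bar_face_eq bar_degen_eq)
qed

end


theorem proposition4p3p3:
  fixes L :: "('o, 'm, 'c) twocat" and S :: "('o, 'm, 'c) monad2"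
    and K :: "('p, 'n, 'd) twocat" and T :: "('p, 'n, 'd) monad2"
    and F :: "('o, 'm, 'c, 'p, 'n, 'd) monad_adj"
  assumes "two_monad_adjunction L S K T F"
    and "has_codescent_objects (Alg_s K T)"
  shows "(\<exists>H. left_2adjoint (Alg_l L S) (Alg_s K T) H (J L S T F) \<and>
           (\<forall>X \<in> Obj (Alg_l L S).
              is_codescent_object (Alg_s K T) (Res S K T F X) (on_Obj H X))) \<and>
         (\<forall>CoDesc. (\<forall>X \<in> Obj (Alg_l L S).
              is_codescent_object (Alg_s K T) (Res S K T F X) (CoDesc X)) \<longrightarrow>
           (\<exists>H. left_2adjoint (Alg_l L S) (Alg_s K T) H (J L S T F) \<and>
              (\<forall>X \<in> Obj (Alg_l L S). on_Obj H X = CoDesc X)))"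
proof -
  interpret two_monad_adjunction L S K T F by fact
  interpret lifted_right_adjoint L S "Alg_s K T" P U composite_unit composite_counit right_action
      "J L S T F"
    by (rule J_lifts)
  have adjoint: "\<exists>H. left_2adjoint (Alg_l L S) (Alg_s K T) H (J L S T F)
      \<and> (\<forall>X \<in> Obj (Alg_l L S). on_Obj H X = Q X)"
    if "\<forall>X \<in> Obj (Alg_l L S). is_codescent_object (Alg_s K T) (Res S K T F X) (Q X)" for Q
    using that by (intro left_2adjoint_codescent[where R = "Res S K T F"] Res_is_bar) auto
  have "\<exists>Q. is_codescent_object (Alg_s K T) (Res S K T F X) Q" if "X \<in> Obj (Alg_l L S)" for X
    using that assms(2) M.bar_simplicial[OF _ Res_is_bar, of X]
    unfolding has_codescent_objects_def by simp
  then obtain Q where Q: "\<forall>X \<in> Obj (Alg_l L S). is_codescent_object (Alg_s K T) (Res S K T F X) (Q X)"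
    by metis
  then obtain H where "left_2adjoint (Alg_l L S) (Alg_s K T) H (J L S T F)"
      "\<forall>X \<in> Obj (Alg_l L S). on_Obj H X = Q X"
    using adjoint by blast
  then have "\<exists>H. left_2adjoint (Alg_l L S) (Alg_s K T) H (J L S T F) \<and>
     (\<forall>X \<in> Obj (Alg_l L S). is_codescent_object (Alg_s K T) (Res S K T F X) (on_Obj H X))"
    using Q by auto
  then show ?thesis
    using adjoint by blast
qed


end
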